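(* Let $\Omega=\omega_1\times\omega_2$ be a bounded domain of $\mathbb{R}^q\times\mathbb{R}^{N-q}$. Assume $A$ satisfies ellipticity ($A\xi\cdot\xi\ge\lambda|\xi|^2$, $\lambda>0$), $a_{ij}\in L^\infty(\Omega)$, the block $A_{22}$ depends only on $X_2$, $\partial^2_{x_ix_j}a_{ij}\in L^2(\Omega)$ for $i=1,\dots,q$, $j=q+1,\dots,N$, and $A\in W^{1,\infty}(\Omega)^{N^2}$. Let $g\in L^2(\Omega)$ and $T\geq0$. Then $$\sup_{t\in[0,T]}\|S_\epsilon(t)g-S_0(t)g\|_{L^2(\Omega)}\to0\quad\text{as }\epsilon\to0.$$ In particular, for $g\in(H_0^1\cap H^2(\omega_1))\otimes(H_0^1\cap H^2(\omega_2))$ there exists $C_{g,A,\Omega}>0$ such that $$\forall\epsilon\in(0,1]:\ \sup_{t\in[0,T]}\|S_\epsilon(t)g-S_0(t)g\|_{L^2(\Omega)}\leq C_{g,A,\Omega}\,T\,\epsilon.$$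
   Context: $A$ is split into blocks $A_{11}$ ($q\times q$), $A_{12},A_{21}$, $A_{22}$, and $A_\epsilon=\begin{pmatrix}\epsilon^2A_{11}&\epsilon A_{12}\\ \epsilon A_{21}&A_{22}\end{pmatrix}$, $\epsilon\in(0,1]$. On $L^2(\Omega)$, define $\mathcal{A}_\epsilon u=\mathrm{div}(A_\epsilon\nabla u)$ with $D(\mathcal{A}_\epsilon)=\{u\in H_0^1(\Omega):\mathrm{div}(A_\epsilon\nabla u)\in L^2(\Omega)\}$, and $\mathcal{A}_0u=\mathrm{div}_{X_2}(A_{22}\nabla_{X_2}u)$ with $D(\mathcal{A}_0)=\{u\in H_0^1(\Omega;\omega_2):\mathrm{div}_{X_2}(A_{22}\nabla_{X_2}u)\in L^2(\Omega)\}$, where $H_0^1(\Omega;\omega_2)=\{v\in L^2(\Omega):\nabla_{X_2}v\in L^2,\ v(X_1,\cdot)\in H_0^1(\omega_2)\text{ a.e. }X_1\}$. These operators are maximal dissipative and generate $C_0$ semigroups of contractions $(S_\epsilon(t))_{t\ge0}$ and $(S_0(t))_{t\ge0}$ on $L^2(\Omega)$. *)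

theory Defs
  imports "HOL-Analysis.Analysis"
begin

text \<open>Real-valued functions on an open set U of a Euclidean space, Lebesgue measure.
  Elements of L2 are handled through representatives; all identities between
  L2 elements are stated via the L2 norm of the difference (i.e. a.e.).\<close>

definition L2 :: "'c::euclidean_space set \<Rightarrow> ('c \<Rightarrow> real) \<Rightarrow> bool" where
  "L2 U u \<longleftrightarrow> u \<in> borel_measurable (lebesgue_on U) \<and>
                integrable (lebesgue_on U) (\<lambda>x. (u x)^2)"

definition l2norm :: "'c::euclidean_space set \<Rightarrow> ('c \<Rightarrow> real) \<Rightarrow> real" where
  "l2norm U u = sqrt (integral\<^sup>L (lebesgue_on U) (\<lambda>x. (u x)^2))"

definition Linf :: "'c::euclidean_space set \<Rightarrow> ('c \<Rightarrow> real) \<Rightarrow> bool" where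
  "Linf U u \<longleftrightarrow> u \<in> borel_measurable (lebesgue_on U) \<and>
                  (\<exists>M. AE x in lebesgue_on U. \<bar>u x\<bar> \<le> M)"

text \<open>C-infinity functions on the whole space: a family D of iterated directional
  derivatives, D ds = derivative along the directions in the list ds.\<close>
definition smooth_fun :: "('c::euclidean_space \<Rightarrow> real) \<Rightarrow> bool" where
  "smooth_fun f \<longleftrightarrow> (\<exists>D :: 'c list \<Rightarrow> 'c \<Rightarrow> real. D [] = f \<and>
      (\<forall>ds x. (D ds has_derivative (\<lambda>v. D (v # ds) x)) (at x)))"

definition test_fun :: "'c::euclidean_space set \<Rightarrow> ('c \<Rightarrow> real) \<Rightarrow> bool" where
  "test_fun U \<phi> \<longleftrightarrow> smooth_fun \<phi> \<and> compact (closure {x. \<phi> x \<noteq> 0}) \<and>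
                     closure {x. \<phi> x \<noteq> 0} \<subseteq> U"

definition pd :: "'c::euclidean_space \<Rightarrow> ('c \<Rightarrow> real) \<Rightarrow> 'c \<Rightarrow> real" where
  "pd e \<phi> x = frechet_derivative \<phi> (at x) e"

definition grad :: "('c::euclidean_space \<Rightarrow> real) \<Rightarrow> 'c \<Rightarrow> 'c" where
  "grad \<phi> x = (\<Sum>e\<in>Basis. pd e \<phi> x *\<^sub>R e)"

definition weak_pderiv :: "'c::euclidean_space set \<Rightarrow> 'c \<Rightarrow> ('c \<Rightarrow> real) \<Rightarrow> ('c \<Rightarrow> real) \<Rightarrow> bool" where
  "weak_pderiv U e u w \<longleftrightarrow> (\<forall>\<phi>. test_fun U \<phi> \<longrightarrow>
      integrable (lebesgue_on U) (\<lambda>x. u x * pd e \<phi> x) \<and>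
      integrable (lebesgue_on U) (\<lambda>x. w x * \<phi> x) \<and>
      (\<integral>x. u x * pd e \<phi> x \<partial>lebesgue_on U) = - (\<integral>x. w x * \<phi> x \<partial>lebesgue_on U))"

definition weak_pderiv2 :: "'c::euclidean_space set \<Rightarrow> 'c \<Rightarrow> 'c \<Rightarrow> ('c \<Rightarrow> real) \<Rightarrow> ('c \<Rightarrow> real) \<Rightarrow> bool" where
  "weak_pderiv2 U e1 e2 u w \<longleftrightarrow> (\<forall>\<phi>. test_fun U \<phi> \<longrightarrow>
      integrable (lebesgue_on U) (\<lambda>x. u x * pd e1 (pd e2 \<phi>) x) \<and>
      integrable (lebesgue_on U) (\<lambda>x. w x * \<phi> x) \<and>
      (\<integral>x. u x * pd e1 (pd e2 \<phi>) x \<partial>lebesgue_on U) = (\<integral>x. w x * \<phi> x \<partial>lebesgue_on U))"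

definition weak_grad :: "'c::euclidean_space set \<Rightarrow> ('c \<Rightarrow> real) \<Rightarrow> ('c \<Rightarrow> 'c) \<Rightarrow> bool" where
  "weak_grad U u G \<longleftrightarrow> (\<forall>e\<in>Basis. L2 U (\<lambda>x. G x \<bullet> e) \<and> weak_pderiv U e u (\<lambda>x. G x \<bullet> e))"

definition H1 :: "'c::euclidean_space set \<Rightarrow> ('c \<Rightarrow> real) \<Rightarrow> bool" where
  "H1 U u \<longleftrightarrow> L2 U u \<and> (\<exists>G. weak_grad U u G)"

definition H2 :: "'c::euclidean_space set \<Rightarrow> ('c \<Rightarrow> real) \<Rightarrow> bool" where
  "H2 U u \<longleftrightarrow> H1 U u \<and> (\<forall>e1\<in>Basis. \<forall>e2\<in>Basis. \<exists>w. L2 U w \<and> weak_pderiv2 U e1 e2 u w)"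

definition H01 :: "'c::euclidean_space set \<Rightarrow> ('c \<Rightarrow> real) \<Rightarrow> bool" where
  "H01 U u \<longleftrightarrow> L2 U u \<and> (\<exists>G. weak_grad U u G \<and>
      (\<exists>\<phi>. (\<forall>n. test_fun U (\<phi> n)) \<and>
           (\<lambda>n. l2norm U (\<lambda>x. u x - \<phi> n x)) \<longlonglongrightarrow> 0 \<and>
           (\<forall>e\<in>Basis. (\<lambda>n. l2norm U (\<lambda>x. G x \<bullet> e - pd e (\<phi> n) x)) \<longlonglongrightarrow> 0)))"

definition tensor_H012 :: "'a::euclidean_space set \<Rightarrow> 'b::euclidean_space set \<Rightarrow> ('a \<times> 'b \<Rightarrow> real) \<Rightarrow> bool" where
  "tensor_H012 \<omega>1 \<omega>2 g \<longleftrightarrow> L2 (\<omega>1 \<times> \<omega>2) g \<and>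
     (\<exists>(n::nat) u v. (\<forall>k<n. H01 \<omega>1 (u k) \<and> H2 \<omega>1 (u k) \<and> H01 \<omega>2 (v k) \<and> H2 \<omega>2 (v k)) \<and>
        (AE x in lebesgue_on (\<omega>1 \<times> \<omega>2). g x = (\<Sum>k<n. u k (fst x) * v k (snd x))))"

text \<open>The matrix field A(x) is a linear map on R^q x R^(N-q); entry a_ij(x) = (A x j) . i.\<close>
definition entry :: "('a::euclidean_space \<times> 'b::euclidean_space \<Rightarrow> 'a \<times> 'b \<Rightarrow> 'a \<times> 'b) \<Rightarrow> ('a \<times> 'b) \<Rightarrow> ('a \<times> 'b) \<Rightarrow> ('a \<times> 'b) \<Rightarrow> real"
  where "entry A i j x = A x j \<bullet> i"

text \<open>A_eps = D_eps A D_eps with D_eps(xi1,xi2) = (eps xi1, xi2); this gives the blocks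
  eps^2 A11, eps A12, eps A21, A22.\<close>
definition Aeps :: "('a::euclidean_space \<times> 'b::euclidean_space \<Rightarrow> 'a \<times> 'b \<Rightarrow> 'a \<times> 'b) \<Rightarrow> real \<Rightarrow> 'a \<times> 'b \<Rightarrow> 'a \<times> 'b \<Rightarrow> 'a \<times> 'b" where
  "Aeps A eps x \<xi> = (let \<eta> = A x (eps *\<^sub>R fst \<xi>, snd \<xi>) in (eps *\<^sub>R fst \<eta>, snd \<eta>))"

definition A22 :: "('a::euclidean_space \<times> 'b::euclidean_space \<Rightarrow> 'a \<times> 'b \<Rightarrow> 'a \<times> 'b) \<Rightarrow> 'a \<times> 'b \<Rightarrow> 'b \<Rightarrow> 'b" where
  "A22 A x \<xi>2 = snd (A x (0, \<xi>2))"

text \<open>Graph of the operator u |-> div(B grad u) with domain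
  {u in H_0^1(U) : div(B grad u) in L2(U)}: gen_div U B u f means u in the domain and f = div(B grad u).\<close>
definition gen_div :: "'c::euclidean_space set \<Rightarrow> ('c \<Rightarrow> 'c \<Rightarrow> 'c) \<Rightarrow> ('c \<Rightarrow> real) \<Rightarrow> ('c \<Rightarrow> real) \<Rightarrow> bool" where
  "gen_div U B u f \<longleftrightarrow> H01 U u \<and> L2 U f \<and> (\<exists>G. weak_grad U u G \<and>
     (\<forall>\<phi>. test_fun U \<phi> \<longrightarrow>
        integrable (lebesgue_on U) (\<lambda>x. B x (G x) \<bullet> grad \<phi> x) \<and>
        integrable (lebesgue_on U) (\<lambda>x. f x * \<phi> x) \<and>
        (\<integral>x. B x (G x) \<bullet> grad \<phi> x \<partial>lebesgue_on U) = - (\<integral>x. f x * \<phi> x \<partial>lebesgue_on U)))"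

definition grad2 :: "('a::euclidean_space \<times> 'b::euclidean_space \<Rightarrow> real) \<Rightarrow> 'a \<times> 'b \<Rightarrow> 'b" where
  "grad2 \<phi> x = (\<Sum>e\<in>Basis. pd (0, e) \<phi> x *\<^sub>R e)"

definition weak_grad2 :: "('a::euclidean_space \<times> 'b::euclidean_space) set \<Rightarrow> ('a \<times> 'b \<Rightarrow> real) \<Rightarrow> ('a \<times> 'b \<Rightarrow> 'b) \<Rightarrow> bool" where
  "weak_grad2 U v G \<longleftrightarrow> (\<forall>e\<in>Basis. L2 U (\<lambda>x. G x \<bullet> e) \<and> weak_pderiv U (0, e) v (\<lambda>x. G x \<bullet> e))"

definition H01_partial :: "'a::euclidean_space set \<Rightarrow> 'b::euclidean_space set \<Rightarrow> ('a \<times> 'b \<Rightarrow> real) \<Rightarrow> bool" where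
  "H01_partial \<omega>1 \<omega>2 v \<longleftrightarrow> L2 (\<omega>1 \<times> \<omega>2) v \<and> (\<exists>G. weak_grad2 (\<omega>1 \<times> \<omega>2) v G) \<and>
     (AE x1 in lebesgue_on \<omega>1. H01 \<omega>2 (\<lambda>x2. v (x1, x2)))"

text \<open>Graph of A_0 u = div_X2(A22 grad_X2 u).\<close>
definition gen0 :: "'a::euclidean_space set \<Rightarrow> 'b::euclidean_space set \<Rightarrow> ('a \<times> 'b \<Rightarrow> 'a \<times> 'b \<Rightarrow> 'a \<times> 'b) \<Rightarrow> ('a \<times> 'b \<Rightarrow> real) \<Rightarrow> ('a \<times> 'b \<Rightarrow> real) \<Rightarrow> bool" where
  "gen0 \<omega>1 \<omega>2 A u f \<longleftrightarrow> H01_partial \<omega>1 \<omega>2 u \<and> L2 (\<omega>1 \<times> \<omega>2) f \<and>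
     (\<exists>G. weak_grad2 (\<omega>1 \<times> \<omega>2) u G \<and>
       (\<forall>\<phi>. test_fun (\<omega>1 \<times> \<omega>2) \<phi> \<longrightarrow>
          integrable (lebesgue_on (\<omega>1 \<times> \<omega>2)) (\<lambda>x. A22 A x (G x) \<bullet> grad2 \<phi> x) \<and>
          integrable (lebesgue_on (\<omega>1 \<times> \<omega>2)) (\<lambda>x. f x * \<phi> x) \<and>
          (\<integral>x. A22 A x (G x) \<bullet> grad2 \<phi> x \<partial>lebesgue_on (\<omega>1 \<times> \<omega>2)) =
            - (\<integral>x. f x * \<phi> x \<partial>lebesgue_on (\<omega>1 \<times> \<omega>2))))"

text \<open>S is a C_0 semigroup of (linear) contractions on L2(U) whose generator has graph Op.
  Equalities of L2 elements are up to null sets (L2 norm of the difference is 0).\<close>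
definition C0_contraction_semigroup ::
  "'c::euclidean_space set \<Rightarrow> (real \<Rightarrow> ('c \<Rightarrow> real) \<Rightarrow> ('c \<Rightarrow> real)) \<Rightarrow> (('c \<Rightarrow> real) \<Rightarrow> ('c \<Rightarrow> real) \<Rightarrow> bool) \<Rightarrow> bool" where
  "C0_contraction_semigroup U S Op \<longleftrightarrow>
     (\<forall>t\<ge>0. \<forall>u. L2 U u \<longrightarrow> L2 U (S t u)) \<and>
     (\<forall>t\<ge>0. \<forall>u v a b. L2 U u \<and> L2 U v \<longrightarrow>
         l2norm U (\<lambda>x. S t (\<lambda>y. a * u y + b * v y) x - (a * S t u x + b * S t v x)) = 0) \<and>
     (\<forall>t\<ge>0. \<forall>u. L2 U u \<longrightarrow> l2norm U (S t u) \<le> l2norm U u) \<and>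
     (\<forall>u. L2 U u \<longrightarrow> l2norm U (\<lambda>x. S 0 u x - u x) = 0) \<and>
     (\<forall>t\<ge>0. \<forall>s\<ge>0. \<forall>u. L2 U u \<longrightarrow> l2norm U (\<lambda>x. S (t + s) u x - S t (S s u) x) = 0) \<and>
     (\<forall>u. L2 U u \<longrightarrow> ((\<lambda>t. l2norm U (\<lambda>x. S t u x - u x)) \<longlongrightarrow> 0) (at_right 0)) \<and>
     (\<forall>u f. (L2 U u \<and> L2 U f \<and>
              ((\<lambda>h. l2norm U (\<lambda>x. (S h u x - u x) / h - f x)) \<longlongrightarrow> 0) (at_right 0))
            \<longleftrightarrow> Op u f)"

end

theory Submission
  imports Defs "HOL-Real_Asymp.Real_Asymp"
begin

text \<open>Write \<open>w t = S0 t g\<close> for a tensor \<open>g = u \<otimes> v\<close>. If \<open>w t\<close> lies in the domain of \<open>A\<^sub>\<epsilon>\<close> and \<open>A\<^sub>\<epsilon> - A0\<close> has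
  norm at most \<open>C \<epsilon>\<close> on it, then \<open>\<parallel>S\<^sub>\<epsilon> t g - S0 t g\<parallel>\<close> has upper right Dini derivative at most \<open>C \<epsilon>\<close>, hence is at
  most \<open>C \<epsilon> t\<close>; contractivity and density of tensors give the convergence for all data.

  To control \<open>w t\<close>, take a test function \<open>b\<close> with \<open>\<integral> u b = 1\<close> and let \<open>P h = u \<otimes> \<integral> h (y, \<cdot>) b y dy\<close>. As \<open>A22\<close> only
  depends on the second variable, \<open>P\<close> commutes with \<open>A0\<close>, and the same Dini argument shows that it commutes with
  \<open>S0 t\<close>. Therefore \<open>w t = P (w t) = u \<otimes> p\<close>, where ellipticity bounds the gradient of \<open>p\<close> uniformly in \<open>t\<close>. In
  \<open>(A\<^sub>\<epsilon> - A0) (u \<otimes> p)\<close> at most one derivative falls on \<open>p\<close>, and every term carries a factor \<open>\<epsilon>\<close>. That the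
  average \<open>p\<close> of the sections of \<open>w t\<close> is again in H01 is seen by approximating it with finite averages of
  sections.\<close>

subsection \<open>Smooth functions and bump functions\<close>

text \<open>Two gaps in regularity separate the generators along the orbit \<open>S0 t g\<close>.
  The domain of A0 controls no derivative in X1, while A_eps differentiates twice in X1; and in X2
  it gives only the whole expression div(A22 grad), not the single second derivatives. The form u
  \<otimes> p closes both: each X1 derivative falls on the fixed u, and the A22 block is never
  expanded but kept as the L2 function A0 (u \<otimes> p). The bound on grad p needs A0 (S0 t g)
  bounded in t; it equals S0 t (A0 g), and A0 g exists because the factors v of g are H2. The bound
  on the generators is then the same multiple of \<epsilon> for all t, so integrating it in time
  produces the factor T \<epsilon>. P is bounded but in general no contraction, hence the comparison
  lemma admits a bounded operator between the two semigroups. Membership of sections in H01 is known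
  only for almost every x1, with approximating test functions that depend on x1 in an uncontrolled
  way. Integrating these in x1 is not possible, which is why p is reached through finite
  averages.\<close>

lemma smooth_funI_closed:
  assumes "f \<in> F"
    and "\<And>g. g \<in> F \<Longrightarrow> \<exists>g'. (\<forall>x. (g has_derivative (\<lambda>v. g' v x)) (at x)) \<and> (\<forall>v. g' v \<in> F)"
  shows "smooth_fun f"
proof -
  obtain d where d: "\<And>g x. g \<in> F \<Longrightarrow> (g has_derivative (\<lambda>v. d g v x)) (at x)"
      "\<And>g v. g \<in> F \<Longrightarrow> d g v \<in> F"
    using assms(2) by metis
  \<comment> \<open>One derivative map d on F is fixed by choice; iterating it along the list never
    leaves F, so it supplies the whole family at once.\<close>
  define D where "D ds = foldr (\<lambda>v g. d g v) ds f" for ds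
  have "D ds \<in> F" for ds
    by (induction ds) (auto simp: D_def assms(1) d(2))
  then show ?thesis
    unfolding smooth_fun_def
    by (intro exI[of _ D]) (use d(1) in \<open>auto simp: D_def\<close>)
qed

lemma pd_eqI: "(f has_derivative f') (at x) \<Longrightarrow> pd e f x = f' e"
  unfolding pd_def by (metis frechet_derivative_at)

lemma smooth_has_derivative:
  assumes "smooth_fun f"
  shows "(f has_derivative (\<lambda>v. pd v f x)) (at x)"
proof -
  obtain D where D: "D [] = f" "\<And>ds x. (D ds has_derivative (\<lambda>v. D (v # ds) x)) (at x)"
    using assms unfolding smooth_fun_def by blast
  from D(2)[of "[]" x] D(1) have *: "(f has_derivative (\<lambda>v. D [v] x)) (at x)" by simp
  then have "pd v f x = D [v] x" for v by (rule pd_eqI)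
  with * show ?thesis by simp
qed

lemma smooth_fun_pd:
  assumes "smooth_fun f"
  shows "smooth_fun (pd e f)"
proof -
  obtain D where D: "D [] = f" "\<And>ds x. (D ds has_derivative (\<lambda>v. D (v # ds) x)) (at x)"
    using assms unfolding smooth_fun_def by blast
  have "pd e f = D [e]"
    using pd_eqI[OF D(2)[of "[]"]] D(1) by auto
  then show ?thesis
    \<comment> \<open>The head of a list is the last differentiation, so a derivative taken
      beforehand in direction \<open>e\<close> is appended at the end.\<close>
    unfolding smooth_fun_def
    by (intro exI[of _ "\<lambda>ds. D (ds @ [e])"]) (use D(2) in auto)
qed

lemma smooth_fun_const [simp]: "smooth_fun (\<lambda>x. c)"
  by (rule smooth_funI_closed[where F = "range (\<lambda>c x. c)"])
     (auto intro!: exI[of _ "\<lambda>v x. 0"])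

lemma smooth_fun_add:
  assumes "smooth_fun f" "smooth_fun g"
  shows "smooth_fun (\<lambda>x. f x + g x)"
proof -
  obtain D E where "D [] = f" "\<And>ds x. (D ds has_derivative (\<lambda>v. D (v # ds) x)) (at x)"
    "E [] = g" "\<And>ds x. (E ds has_derivative (\<lambda>v. E (v # ds) x)) (at x)"
    using assms unfolding smooth_fun_def by blast
  then show ?thesis
    unfolding smooth_fun_def
    by (intro exI[of _ "\<lambda>ds x. D ds x + E ds x"]) (auto intro: has_derivative_add)
qed

text \<open>The Leibniz rule leads from products to sums of products; adding sums gives a class
  closed under differentiation, as \<open>smooth_funI_closed\<close> requires.\<close>

inductive_set sum_prod_smooth :: "('c::euclidean_space \<Rightarrow> real) set" where
  prod: "smooth_fun f \<Longrightarrow> smooth_fun g \<Longrightarrow> (\<lambda>x. f x * g x) \<in> sum_prod_smooth"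
| add: "f \<in> sum_prod_smooth \<Longrightarrow> g \<in> sum_prod_smooth \<Longrightarrow> (\<lambda>x. f x + g x) \<in> sum_prod_smooth"

lemma smooth_fun_mult:
  assumes "smooth_fun f" "smooth_fun g"
  shows "smooth_fun (\<lambda>x. f x * g x)"
proof (rule smooth_funI_closed[where F = sum_prod_smooth])
  show "(\<lambda>x. f x * g x) \<in> sum_prod_smooth"
    using assms by (rule sum_prod_smooth.prod)
  fix h :: "'a \<Rightarrow> real" assume "h \<in> sum_prod_smooth"
  then show "\<exists>h'. (\<forall>x. (h has_derivative (\<lambda>v. h' v x)) (at x)) \<and> (\<forall>v. h' v \<in> sum_prod_smooth)"
  proof induction
    case (prod f g)
    show ?case
    proof (intro exI[of _ "\<lambda>v x. f x * pd v g x + pd v f x * g x"] conjI allI)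
      fix v
      show "(\<lambda>x. f x * pd v g x + pd v f x * g x) \<in> sum_prod_smooth"
        by (intro sum_prod_smooth.intros smooth_fun_pd prod)
    qed (intro has_derivative_mult smooth_has_derivative prod)
  next
    case (add f g)
    then obtain f' g' where
      "\<And>x. (f has_derivative (\<lambda>v. f' v x)) (at x)" "\<And>v. f' v \<in> sum_prod_smooth"
      "\<And>x. (g has_derivative (\<lambda>v. g' v x)) (at x)" "\<And>v. g' v \<in> sum_prod_smooth"
      by metis
    then show ?case
      by (intro exI[of _ "\<lambda>v x. f' v x + g' v x"]) (auto intro: has_derivative_add sum_prod_smooth.add)
  qed
qed

lemma smooth_fun_prod:
  assumes "\<And>i. i \<in> I \<Longrightarrow> smooth_fun (f i)"
  shows "smooth_fun (\<lambda>x. \<Prod>i\<in>I. f i x)"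
  using assms by (induction I rule: infinite_finite_induct) (auto intro: smooth_fun_mult)

lemma smooth_fun_affine:
  assumes "smooth_fun f" "bounded_linear L"
  shows "smooth_fun (\<lambda>x. f (c + L x))"
proof -
  obtain D where D: "D [] = f" "\<And>ds x. (D ds has_derivative (\<lambda>v. D (v # ds) x)) (at x)"
    using assms(1) unfolding smooth_fun_def by blast
  have "((\<lambda>x. D ds (c + L x)) has_derivative (\<lambda>v. D (L v # ds) (c + L x))) (at x)" for ds x
    by (rule has_derivative_compose[OF _ D(2), of "\<lambda>x. c + L x" L])
       (auto intro!: derivative_eq_intros bounded_linear_imp_has_derivative assms(2))
  then show ?thesis
    unfolding smooth_fun_def
    by (intro exI[of _ "\<lambda>ds x. D (map L ds) (c + L x)"]) (auto simp: D(1))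
qed

lemma pd_affine:
  assumes "smooth_fun f" "bounded_linear L"
  shows "pd e (\<lambda>x. f (c + L x)) x = pd (L e) f (c + L x)"
proof (rule pd_eqI)
  show "((\<lambda>x. f (c + L x)) has_derivative (\<lambda>v. pd (L v) f (c + L x))) (at x)"
    by (rule has_derivative_compose[OF _ smooth_has_derivative[OF assms(1)], of "\<lambda>x. c + L x" L])
       (auto intro!: derivative_eq_intros bounded_linear_imp_has_derivative assms(2))
qed

lemma pd_mult:
  assumes "smooth_fun f" "smooth_fun g"
  shows "pd e (\<lambda>x. f x * g x) x = f x * pd e g x + pd e f x * g x"
  by (rule pd_eqI[OF has_derivative_mult]) (auto intro: smooth_has_derivative assms)

lemma pd_add:
  assumes "smooth_fun f" "smooth_fun g"
  shows "pd e (\<lambda>x. f x + g x) x = pd e f x + pd e g x"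
  by (rule pd_eqI[OF has_derivative_add]) (auto intro: smooth_has_derivative assms)

lemma pd_cmult:
  assumes "smooth_fun f"
  shows "pd e (\<lambda>x. c * f x) x = c * pd e f x"
  using pd_mult[OF smooth_fun_const assms, of e c x] pd_eqI[OF has_derivative_const, of e c x] by simp

section \<open>Test functions and their supports\<close>

lemma test_funD:
  assumes "test_fun U \<phi>"
  shows "smooth_fun \<phi>" "compact (closure {x. \<phi> x \<noteq> 0})" "closure {x. \<phi> x \<noteq> 0} \<subseteq> U"
  using assms by (auto simp: test_fun_def)

lemma test_fun_eq_0: "test_fun U \<phi> \<Longrightarrow> x \<notin> U \<Longrightarrow> \<phi> x = 0"
  using closure_subset[of "{x. \<phi> x \<noteq> 0}"] by (auto simp: test_fun_def)

lemma test_funI: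
  assumes "smooth_fun \<phi>" "compact K" "K \<subseteq> U" "\<And>x. x \<notin> K \<Longrightarrow> \<phi> x = 0"
  shows "test_fun U \<phi>"
proof -
  have "{x. \<phi> x \<noteq> 0} \<subseteq> K" using assms(4) by blast
  then have "closure {x. \<phi> x \<noteq> 0} \<subseteq> K"
    by (intro closure_minimal compact_imp_closed assms)
  then show ?thesis
    unfolding test_fun_def using assms
    by (metis closed_closure compact_Int_closed inf.absorb_iff2 order_trans)
qed

text \<open>The complement of the closed support is open and \<phi> vanishes on it, so all
  derivatives vanish there too. A single compact set thus serves \<phi> and its derivatives.\<close>

lemma test_fun_support:
  assumes "test_fun U \<phi>"
  obtains K where "compact K" "K \<subseteq> U" "\<And>x. x \<notin> K \<Longrightarrow> \<phi> x = 0" "\<And>e x. x \<notin> K \<Longrightarrow> pd e \<phi> x = 0"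
proof (rule that[of "closure {x. \<phi> x \<noteq> 0}"])
  fix e x assume x: "x \<notin> closure {x. \<phi> x \<noteq> 0}"
  have "(\<phi> has_derivative (\<lambda>v. 0)) (at x)"
    by (rule has_derivative_transform_within_open[of "\<lambda>x. 0", where s = "- closure {x. \<phi> x \<noteq> 0}"])
       (use x closure_subset[of "{x. \<phi> x \<noteq> 0}"] in auto)
  then show "pd e \<phi> x = 0" by (rule pd_eqI)
qed (use test_funD[OF assms] closure_subset[of "{x. \<phi> x \<noteq> 0}"] in auto)

lemma test_fun_pd:
  assumes "test_fun U \<phi>"
  shows "test_fun U (pd e \<phi>)"
proof -
  obtain K where "compact K" "K \<subseteq> U" "\<And>e x. x \<notin> K \<Longrightarrow> pd e \<phi> x = 0"
    using test_fun_support[OF assms] by metis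
  then show ?thesis by (intro test_funI[of _ K] smooth_fun_pd test_funD[OF assms]) auto
qed

lemma test_fun_mult_right:
  assumes "smooth_fun f" "test_fun U \<phi>"
  shows "test_fun U (\<lambda>x. f x * \<phi> x)"
proof -
  obtain K where "compact K" "K \<subseteq> U" "\<And>x. x \<notin> K \<Longrightarrow> \<phi> x = 0"
    using test_fun_support[OF assms(2)] by metis
  then show ?thesis by (intro test_funI[of _ K] smooth_fun_mult assms test_funD[OF assms(2)]) auto
qed

lemma test_fun_zero [simp]: "test_fun U (\<lambda>x. 0)"
  by (rule test_funI[of _ "{}"]) auto

lemma test_fun_add:
  assumes "test_fun U \<phi>" "test_fun U \<psi>"
  shows "test_fun U (\<lambda>x. \<phi> x + \<psi> x)"
proof -
  obtain K where "compact K" "K \<subseteq> U" "\<And>x. x \<notin> K \<Longrightarrow> \<phi> x = 0"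
    using test_fun_support[OF assms(1)] by metis
  moreover obtain L where "compact L" "L \<subseteq> U" "\<And>x. x \<notin> L \<Longrightarrow> \<psi> x = 0"
    using test_fun_support[OF assms(2)] by metis
  ultimately show ?thesis
    by (intro test_funI[of _ "K \<union> L"] smooth_fun_add test_funD(1)[OF assms(1)] test_funD(1)[OF assms(2)]) auto
qed

lemma test_fun_cmult: "test_fun U \<phi> \<Longrightarrow> test_fun U (\<lambda>x. c * \<phi> x)"
  by (intro test_fun_mult_right) auto

section \<open>Tensor products and sections of test functions\<close>

lemma smooth_fun_tensor:
  fixes f :: "'a::euclidean_space \<Rightarrow> real" and g :: "'b::euclidean_space \<Rightarrow> real"
  assumes "smooth_fun f" "smooth_fun g"
  shows "smooth_fun (\<lambda>x. f (fst x) * g (snd x))"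
  using smooth_fun_affine[OF assms(1) bounded_linear_fst, of 0]
    smooth_fun_affine[OF assms(2) bounded_linear_snd, of 0]
  by (auto intro: smooth_fun_mult)

lemma test_fun_tensor:
  assumes "test_fun S f" "test_fun T g"
  shows "test_fun (S \<times> T) (\<lambda>x. f (fst x) * g (snd x))"
proof -
  obtain K where "compact K" "K \<subseteq> S" "\<And>x. x \<notin> K \<Longrightarrow> f x = 0"
    using test_fun_support[OF assms(1)] by metis
  moreover obtain L where "compact L" "L \<subseteq> T" "\<And>x. x \<notin> L \<Longrightarrow> g x = 0"
    using test_fun_support[OF assms(2)] by metis
  ultimately show ?thesis
    by (intro test_funI[of _ "K \<times> L"] smooth_fun_tensor test_funD(1)[OF assms(1)]
        test_funD(1)[OF assms(2)] compact_Times) (auto simp: mem_Times_iff)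
qed

lemma pd_tensor:
  fixes f :: "'a::euclidean_space \<Rightarrow> real" and g :: "'b::euclidean_space \<Rightarrow> real"
  assumes "smooth_fun f" "smooth_fun g"
  shows "pd e (\<lambda>x. f (fst x) * g (snd x)) x
    = pd (fst e) f (fst x) * g (snd x) + f (fst x) * pd (snd e) g (snd x)"
proof (rule pd_eqI)
  show "((\<lambda>x. f (fst x) * g (snd x)) has_derivative
      (\<lambda>e. pd (fst e) f (fst x) * g (snd x) + f (fst x) * pd (snd e) g (snd x))) (at x)"
    by (rule derivative_eq_intros
        has_derivative_compose[OF has_derivative_fst[OF has_derivative_ident] smooth_has_derivative[OF assms(1)]]
        has_derivative_compose[OF has_derivative_snd[OF has_derivative_ident] smooth_has_derivative[OF assms(2)]])+
       auto
qed

lemma pd_zero_direction [simp]: "smooth_fun f \<Longrightarrow> pd 0 f x = 0"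
  using smooth_has_derivative[of f x] has_derivative_bounded_linear linear_simps(3) by blast

text \<open>Fixing one variable is composition with an affine map. The slice of the compact set
  \<open>K\<close> is closed and contained in a projection of \<open>K\<close>, hence
  compact.\<close>

lemma
  assumes "test_fun (S \<times> T) \<phi>"
  shows test_fun_section_snd: "test_fun T (\<lambda>y. \<phi> (x, y))"
    and test_fun_section_fst: "test_fun S (\<lambda>x. \<phi> (x, y))"
    and pd_section_snd: "pd e2 (\<lambda>y. \<phi> (x, y)) y = pd (0, e2) \<phi> (x, y)"
    and pd_section_fst: "pd e1 (\<lambda>x. \<phi> (x, y)) x = pd (e1, 0) \<phi> (x, y)"
proof -
  obtain K where K: "compact K" "K \<subseteq> S \<times> T" "\<And>x. x \<notin> K \<Longrightarrow> \<phi> x = 0"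
    using test_fun_support[OF assms] by metis
  note sm = test_funD(1)[OF assms]
  have bl: "bounded_linear (\<lambda>y::'b. (0::'a, y))" "bounded_linear (\<lambda>x::'a. (x, 0::'b))"
    by (intro bounded_linear_Pair bounded_linear_zero bounded_linear_ident)+
  have s: "smooth_fun (\<lambda>y. \<phi> (x, y))" for x
    using smooth_fun_affine[OF sm bl(1), of "(x, 0)"] by simp
  have f: "smooth_fun (\<lambda>x. \<phi> (x, y))" for y
    using smooth_fun_affine[OF sm bl(2), of "(0, y)"] by simp
  show "pd e2 (\<lambda>y. \<phi> (x, y)) y = pd (0, e2) \<phi> (x, y)"
    using pd_affine[OF sm bl(1), of e2 "(x, 0)" y] by simp
  show "pd e1 (\<lambda>x. \<phi> (x, y)) x = pd (e1, 0) \<phi> (x, y)"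
    using pd_affine[OF sm bl(2), of e1 "(0, y)" x] by simp
  have cl: "closed ((\<lambda>y. (x, y)) -` K)" "closed ((\<lambda>x. (x, y)) -` K)"
    by (intro closed_vimage compact_imp_closed K continuous_intros)+
  have "compact ((\<lambda>y. (x, y)) -` K)"
  proof -
    have "(\<lambda>y. (x, y)) -` K \<subseteq> snd ` K" by force
    then have eq: "snd ` K \<inter> (\<lambda>y. (x, y)) -` K = (\<lambda>y. (x, y)) -` K" by blast
    show ?thesis
      using compact_Int_closed[OF compact_continuous_image[OF continuous_on_snd[OF continuous_on_id] K(1)] cl(1)]
      unfolding eq .
  qed
  then show "test_fun T (\<lambda>y. \<phi> (x, y))"
    by (rule test_funI[OF s]) (use K in auto)
  have "compact ((\<lambda>x. (x, y)) -` K)"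
  proof -
    have "(\<lambda>x. (x, y)) -` K \<subseteq> fst ` K" by force
    then have eq: "fst ` K \<inter> (\<lambda>x. (x, y)) -` K = (\<lambda>x. (x, y)) -` K" by blast
    show ?thesis
      using compact_Int_closed[OF compact_continuous_image[OF continuous_on_fst[OF continuous_on_id] K(1)] cl(2)]
      unfolding eq .
  qed
  then show "test_fun S (\<lambda>x. \<phi> (x, y))"
    by (rule test_funI[OF f]) (use K in auto)
qed

lemma smooth_fun_continuous: "smooth_fun f \<Longrightarrow> continuous_on S f"
  using has_derivative_continuous[OF smooth_has_derivative] continuous_at_imp_continuous_on by blast

lemma test_fun_bounded:
  assumes "test_fun U \<phi>"
  obtains M where "\<And>x. \<bar>\<phi> x\<bar> \<le> M"
proof -
  obtain K where K: "compact K" "\<And>x. x \<notin> K \<Longrightarrow> \<phi> x = 0"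
    using test_fun_support[OF assms] by metis
  have "bounded (\<phi> ` K)"
    by (intro compact_imp_bounded compact_continuous_image smooth_fun_continuous test_funD[OF assms] K)
  then obtain M where "\<And>x. x \<in> K \<Longrightarrow> \<bar>\<phi> x\<bar> \<le> M" by (auto simp: bounded_iff)
  then have "\<bar>\<phi> x\<bar> \<le> max M 0" for x by (cases "x \<in> K") (auto simp: K(2) intro: max.coboundedI1)
  then show ?thesis by (rule that)
qed

text \<open>The polynomial factors in \<open>1 / t\<close> make the family closed under differentiation.\<close>
definition flat :: "real poly \<Rightarrow> real \<Rightarrow> real" where
  "flat p t = (if t > 0 then poly p (1 / t) * exp (- (1 / t)) else 0)"

lemma poly_times_exp_minus_tendsto_0: "((\<lambda>x::real. poly p x * exp (- x)) \<longlongrightarrow> 0) at_top"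
proof -
  have "((\<lambda>x::real. x ^ n * exp (- x)) \<longlongrightarrow> 0) at_top" for n
    using tendsto_power_div_exp_0[of n] by (simp add: exp_minus divide_inverse)
  then have "((\<lambda>x::real. \<Sum>i\<le>degree p. coeff p i * (x ^ i * exp (- x))) \<longlongrightarrow> (\<Sum>i\<le>degree p. coeff p i * 0)) at_top"
    by (intro tendsto_intros)
  then show ?thesis by (simp add: poly_altdef sum_distrib_right mult.assoc)
qed

text \<open>With X = 1 / t the derivative of p(X) exp(-X) is X^2 (p - p')(X) exp(-X), and
  \<open>[:0, 0, 1:]\<close> is X^2. At 0 the right difference quotient is (X p)(X) exp(-X), which
  tends to 0 as X grows.\<close>

lemma flat_has_derivative:
  "(flat p has_real_derivative flat ([:0, 0, 1:] * (p - pderiv p)) t) (at t)"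
proof -
  consider "t > 0" | "t < 0" | "t = 0" by linarith
  then show ?thesis
  proof cases
    case 1
    have "((\<lambda>t. poly p (1 / t) * exp (- (1 / t))) has_real_derivative
        flat ([:0, 0, 1:] * (p - pderiv p)) t) (at t)"
      using 1 by (auto intro!: derivative_eq_intros DERIV_chain2[OF poly_DERIV]
          simp: flat_def field_simps power2_eq_square)
    then show ?thesis
      by (rule has_field_derivative_transform_within_open[where S = "{0<..}"])
         (use 1 in \<open>auto simp: flat_def\<close>)
  next
    case 2
    then have "flat ([:0, 0, 1:] * (p - pderiv p)) t = 0" by (simp add: flat_def)
    with DERIV_const[of 0] show ?thesis
      by (rule_tac has_field_derivative_transform_within_open[where f = "\<lambda>_. 0" and S = "{..<0}"])
         (use 2 in \<open>simp_all add: flat_def\<close>)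
  next
    case 3
    have "((\<lambda>s. flat p s / s) \<longlongrightarrow> 0) (at_right 0)"
    proof (rule Lim_transform_eventually)
      show "((\<lambda>s. poly (pCons 0 p) (inverse s) * exp (- inverse s)) \<longlongrightarrow> 0) (at_right 0)"
        using filterlim_compose[OF poly_times_exp_minus_tendsto_0 filterlim_inverse_at_top_right] .
      show "\<forall>\<^sub>F s in at_right 0. poly (pCons 0 p) (inverse s) * exp (- inverse s) = flat p s / s"
        using eventually_at_right_less[of "0::real"]
        by eventually_elim (simp add: flat_def inverse_eq_divide)
    qed
    moreover have "((\<lambda>s. flat p s / s) \<longlongrightarrow> 0) (at_left 0)"
    proof (rule Lim_transform_eventually[OF tendsto_const])
      have "\<forall>\<^sub>F s::real in at_left 0. s < 0" by (simp add: eventually_at_filter)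
      then show "\<forall>\<^sub>F s in at_left 0. 0 = flat p s / s"
        by eventually_elim (simp add: flat_def)
    qed
    ultimately have "((\<lambda>s. flat p s / s) \<longlongrightarrow> 0) (at 0)"
      using filterlim_at_split by blast
    then show ?thesis
      using 3 by (simp add: has_field_derivative_iff flat_def[of _ 0])
  qed
qed

lemma smooth_fun_flat: "smooth_fun (flat p)"
proof (rule smooth_funI_closed[where F = "range flat"])
  fix g assume "g \<in> range flat"
  then obtain p where g: "g = flat p" by auto
  \<comment> \<open>A directional derivative on the line carries a factor \<open>v\<close>;
    absorbing it into the polynomial keeps the derivative inside \<open>range flat\<close>.\<close>
  have "(g has_derivative (\<lambda>v. flat (smult v ([:0, 0, 1:] * (p - pderiv p))) x)) (at x)" for x
    using flat_has_derivative[of p x] unfolding has_field_derivative_def g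
    by (rule has_derivative_eq_rhs) (auto simp: flat_def)
  then show "\<exists>g'. (\<forall>x. (g has_derivative (\<lambda>v. g' v x)) (at x)) \<and> (\<forall>v. g' v \<in> range flat)"
    by (intro exI[of _ "\<lambda>v. flat (smult v ([:0, 0, 1:] * (p - pderiv p)))"]) auto
qed auto

text \<open>A product of one-dimensional cutoffs. Each factor vanishes until the coordinate is more
  than 1 / n inside the box, so the support is a compact subset of the open box, and for large n the
  values approach 1 inside.\<close>

definition bump :: "'c::euclidean_space \<Rightarrow> 'c \<Rightarrow> nat \<Rightarrow> 'c \<Rightarrow> real" where
  "bump a b n x = (\<Prod>i\<in>Basis. flat 1 (real n * (x \<bullet> i - a \<bullet> i) - 1) * flat 1 (real n * (b \<bullet> i - x \<bullet> i) - 1))"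

lemma flat_1_bounds: "0 \<le> flat 1 t" "flat 1 t \<le> 1"
  by (auto simp: flat_def)

lemma bump_bounds: "0 \<le> bump a b n x" "bump a b n x \<le> 1"
  unfolding bump_def
  by (auto intro!: prod_nonneg prod_le_1 mult_nonneg_nonneg mult_le_one flat_1_bounds)

lemma smooth_fun_bump: "smooth_fun (bump a b n)"
proof -
  have *: "smooth_fun (\<lambda>x::'a. flat 1 (c + x \<bullet> v))" for c v
    by (rule smooth_fun_affine[OF smooth_fun_flat bounded_linear_inner_left])
  have "smooth_fun (\<lambda>x. flat 1 (real n * (x \<bullet> i - a \<bullet> i) - 1) * flat 1 (real n * (b \<bullet> i - x \<bullet> i) - 1))" for i
    using *[of "- real n * (a \<bullet> i) - 1" "real n *\<^sub>R i"] *[of "real n * (b \<bullet> i) - 1" "- real n *\<^sub>R i"]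
    by (intro smooth_fun_mult) (simp_all add: algebra_simps)
  then show ?thesis
    unfolding bump_def by (intro smooth_fun_prod)
qed

lemma bump_eq_0:
  assumes "x \<notin> cbox (a + (1 / n) *\<^sub>R One) (b - (1 / n) *\<^sub>R One)" "n > 0"
  shows "bump a b n x = 0"
proof -
  obtain i where i: "i \<in> Basis" "x \<bullet> i < a \<bullet> i + 1 / n \<or> b \<bullet> i - 1 / n < x \<bullet> i"
    using assms(1) by (auto simp: mem_box inner_simps inner_Basis not_le)
  then have "flat 1 (real n * (x \<bullet> i - a \<bullet> i) - 1) * flat 1 (real n * (b \<bullet> i - x \<bullet> i) - 1) = 0"
    using assms(2) by (auto simp: flat_def field_simps)
  then show ?thesis unfolding bump_def using i(1) by (simp add: prod_zero_iff) blast
qed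

lemma test_fun_bump:
  assumes "box a b \<subseteq> U" "n > 0"
  shows "test_fun U (bump a b n)"
proof (rule test_funI[OF smooth_fun_bump compact_cbox])
  show "cbox (a + (1 / n) *\<^sub>R One) (b - (1 / n) *\<^sub>R One) \<subseteq> U"
  proof (rule order_trans[OF _ assms(1)], rule subsetI)
    fix x assume x: "x \<in> cbox (a + (1 / n) *\<^sub>R One) (b - (1 / n) *\<^sub>R One)"
    have "a \<bullet> i < x \<bullet> i \<and> x \<bullet> i < b \<bullet> i" if "i \<in> Basis" for i
    proof -
      have "a \<bullet> i + 1 / n \<le> x \<bullet> i" "x \<bullet> i \<le> b \<bullet> i - 1 / n"
        using x that by (auto simp: mem_box inner_simps)
      moreover have "1 / real n > 0" using assms(2) by simp
      ultimately show ?thesis by linarith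
    qed
    then show "x \<in> box a b" by (auto simp: mem_box)
  qed
qed (use bump_eq_0 assms in auto)

lemma bump_tendsto: "(\<lambda>n. bump a b n x) \<longlonglongrightarrow> indicator (box a b) x"
proof (cases "x \<in> box a b")
  case True
  have *: "(\<lambda>n. flat 1 (real n * t - 1)) \<longlonglongrightarrow> 1" if "t > 0" for t
  proof -
    have lim: "filterlim (\<lambda>n. real n * t - 1) at_top sequentially"
      using that by real_asymp
    have "(\<lambda>n. exp (- inverse (real n * t - 1))) \<longlonglongrightarrow> exp (- 0)"
      by (intro tendsto_intros filterlim_compose[OF tendsto_inverse_0_at_top lim] tendsto_inverse_0_at_top[OF lim])
    moreover have "\<forall>\<^sub>F n in sequentially. exp (- inverse (real n * t - 1)) = flat 1 (real n * t - 1)"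
      using filterlim_at_top_dense[THEN iffD1, OF lim, rule_format, of 0]
      by eventually_elim (auto simp: flat_def inverse_eq_divide)
    ultimately show ?thesis by (auto intro: Lim_transform_eventually)
  qed
  have "(\<lambda>n. bump a b n x) \<longlonglongrightarrow> (\<Prod>i\<in>(Basis::'a set). 1 * 1)"
    unfolding bump_def by (intro tendsto_intros *) (use True in \<open>auto simp: mem_box\<close>)
  then show ?thesis using True by simp
next
  case False
  have "bump a b n x = 0" for n
  proof -
    obtain i where i: "i \<in> Basis" "x \<bullet> i \<le> a \<bullet> i \<or> b \<bullet> i \<le> x \<bullet> i"
      using False by (auto simp: mem_box not_less)
    then have "real n * (x \<bullet> i - a \<bullet> i) \<le> 0 \<or> real n * (b \<bullet> i - x \<bullet> i) \<le> 0"
      by (auto simp: mult_nonneg_nonpos)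
    then have "flat 1 (real n * (x \<bullet> i - a \<bullet> i) - 1) * flat 1 (real n * (b \<bullet> i - x \<bullet> i) - 1) = 0"
      by (auto simp: flat_def)
    then show ?thesis unfolding bump_def using i(1) by (simp add: prod_zero_iff) blast
  qed
  then show ?thesis using False by simp
qed

text \<open>This is what makes density of bumps in L2 of a product yield density of tensors.\<close>

lemma bump_Pair: "bump (a1, a2) (b1, b2) n x = bump a1 b1 n (fst x) * bump a2 b2 n (snd x)"
  unfolding bump_def Basis_prod_def
  by (subst prod.union_disjoint) (auto simp: prod.reindex inj_on_def inner_Pair_0 o_def inner_prod_def)

subsection \<open>The L2 seminorm\<close>

lemma L2_measurable: "L2 U u \<Longrightarrow> u \<in> borel_measurable (lebesgue_on U)"
  by (simp add: L2_def)

lemma L2_sq_integrable: "L2 U u \<Longrightarrow> integrable (lebesgue_on U) (\<lambda>x. (u x)\<^sup>2)"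
  by (simp add: L2_def)

lemma L2_mult_integrable:
  assumes "L2 U u" "L2 U v"
  shows "integrable (lebesgue_on U) (\<lambda>x. u x * v x)"
proof (rule Bochner_Integration.integrable_bound)
  show "integrable (lebesgue_on U) (\<lambda>x. (u x)\<^sup>2 + (v x)\<^sup>2)"
    using assms by (simp add: L2_def)
  have "\<bar>u x * v x\<bar> \<le> (u x)\<^sup>2 + (v x)\<^sup>2" for x
    using sum_squares_bound[of "\<bar>u x\<bar>" "\<bar>v x\<bar>"] mult_nonneg_nonneg[OF abs_ge_zero abs_ge_zero, of "u x" "v x"]
    unfolding abs_mult power2_abs by linarith
  then show "AE x in lebesgue_on U. norm (u x * v x) \<le> norm ((u x)\<^sup>2 + (v x)\<^sup>2)"
    by (intro AE_I2) (simp add: abs_mult)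
qed (use assms in \<open>auto simp: L2_def\<close>)

lemma L2_cmult: "L2 U u \<Longrightarrow> L2 U (\<lambda>x. c * u x)"
  by (auto simp: L2_def power_mult_distrib)

lemma L2_zero [simp]: "L2 U (\<lambda>x. 0)"
  by (simp add: L2_def)

lemma L2_add:
  assumes "L2 U u" "L2 U v"
  shows "L2 U (\<lambda>x. u x + v x)"
  using assms L2_mult_integrable[OF assms]
  by (auto simp: L2_def power2_sum mult.assoc intro!: Bochner_Integration.integrable_add)

lemma L2_minus: "L2 U u \<Longrightarrow> L2 U (\<lambda>x. - u x)"
  using L2_cmult[of U u "-1"] by simp

lemma L2_diff: "L2 U u \<Longrightarrow> L2 U v \<Longrightarrow> L2 U (\<lambda>x. u x - v x)"
  using L2_add[OF _ L2_minus, of U u v] by simp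

lemma L2_divide: "L2 U u \<Longrightarrow> L2 U (\<lambda>x. u x / c)"
  using L2_cmult[of U u "1 / c"] by simp

lemma L2_sum: "(\<And>i. i \<in> I \<Longrightarrow> L2 U (u i)) \<Longrightarrow> L2 U (\<lambda>x. \<Sum>i\<in>I. u i x)"
  by (induction I rule: infinite_finite_induct) (auto intro: L2_add)

lemmas L2_intros = L2_cmult L2_add L2_diff L2_divide L2_sum

lemma l2norm_nonneg [simp]: "0 \<le> l2norm U u"
  by (simp add: l2norm_def)

lemma l2norm_sq: "(l2norm U u)\<^sup>2 = (\<integral>x. (u x)\<^sup>2 \<partial>lebesgue_on U)"
  by (simp add: l2norm_def)

lemma l2norm_zero [simp]: "l2norm U (\<lambda>x. 0) = 0"
  by (simp add: l2norm_def)

lemma l2norm_cmult: "l2norm U (\<lambda>x. c * u x) = \<bar>c\<bar> * l2norm U u"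
  by (simp add: l2norm_def power_mult_distrib real_sqrt_mult)

lemma l2norm_minus: "l2norm U (\<lambda>x. - u x) = l2norm U u"
  by (simp add: l2norm_def)

lemma l2norm_minus_commute: "l2norm U (\<lambda>x. u x - v x) = l2norm U (\<lambda>x. v x - u x)"
  by (simp add: l2norm_def power2_commute)

lemma l2norm_eq_0_iff:
  assumes "L2 U u"
  shows "l2norm U u = 0 \<longleftrightarrow> (AE x in lebesgue_on U. u x = 0)"
  using integral_nonneg_eq_0_iff_AE[OF L2_sq_integrable[OF assms]]
  by (simp add: l2norm_def)

lemma l2norm_cong_AE:
  assumes "L2 U u" "L2 U v" "AE x in lebesgue_on U. u x = v x"
  shows "l2norm U u = l2norm U v"
proof -
  have "(\<integral>x. (u x)\<^sup>2 \<partial>lebesgue_on U) = (\<integral>x. (v x)\<^sup>2 \<partial>lebesgue_on U)"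
    using assms by (intro integral_cong_AE) (auto dest!: L2_measurable)
  then show ?thesis by (simp add: l2norm_def)
qed

lemma L2_Cauchy_Schwarz:
  assumes "L2 U u" "L2 U v"
  shows "\<bar>\<integral>x. u x * v x \<partial>lebesgue_on U\<bar> \<le> l2norm U u * l2norm U v"
proof (cases "l2norm U u = 0 \<or> l2norm U v = 0")
  case True
  then have "AE x in lebesgue_on U. u x * v x = 0"
    using assms by (auto simp: l2norm_eq_0_iff)
  then show ?thesis by (simp add: integral_eq_zero_AE)
next
  case False
  define a b where "a = l2norm U u" and "b = l2norm U v"
  have ab: "a > 0" "b > 0"
    using False by (simp_all add: a_def b_def order_le_neq_trans)
  \<comment> \<open>The square of \<open>b * u - s * a * v\<close> has nonnegative integral; the
    signs s = 1 and s = -1 give the two halves of the absolute value.\<close>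
  have *: "s * (\<integral>x. u x * v x \<partial>lebesgue_on U) \<le> a * b" if "s\<^sup>2 = 1" for s :: real
  proof -
    have "0 \<le> (\<integral>x. (b * u x - s * a * v x)\<^sup>2 \<partial>lebesgue_on U)" by simp
    also have "(\<lambda>x. (b * u x - s * a * v x)\<^sup>2) = (\<lambda>x. b\<^sup>2 * (u x)\<^sup>2 + a\<^sup>2 * (v x)\<^sup>2 - (2 * s * a * b) * (u x * v x))"
      using that by (auto simp: fun_eq_iff power2_diff power_mult_distrib)
    also have "(\<integral>x. b\<^sup>2 * (u x)\<^sup>2 + a\<^sup>2 * (v x)\<^sup>2 - (2 * s * a * b) * (u x * v x) \<partial>lebesgue_on U)
        = b\<^sup>2 * a\<^sup>2 + a\<^sup>2 * b\<^sup>2 - (2 * s * a * b) * (\<integral>x. u x * v x \<partial>lebesgue_on U)"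
      using L2_mult_integrable[OF assms] assms
      by (simp add: L2_def a_def b_def l2norm_sq)
    finally have "(2 * a * b) * (s * (\<integral>x. u x * v x \<partial>lebesgue_on U)) \<le> (2 * a * b) * (a * b)"
      by (simp add: power2_eq_square algebra_simps)
    then show ?thesis
      using ab by (auto dest: mult_left_le_imp_le)
  qed
  from *[of 1] *[of "-1"] show ?thesis
    unfolding a_def b_def by auto
qed

lemma l2norm_triangle:
  assumes "L2 U u" "L2 U v"
  shows "l2norm U (\<lambda>x. u x + v x) \<le> l2norm U u + l2norm U v"
proof (rule power2_le_imp_le)
  have "(l2norm U (\<lambda>x. u x + v x))\<^sup>2 = (l2norm U u)\<^sup>2 + (l2norm U v)\<^sup>2 + 2 * (\<integral>x. u x * v x \<partial>lebesgue_on U)"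
    unfolding l2norm_sq power2_sum
    using assms L2_mult_integrable[OF assms] by (simp add: L2_def mult.assoc)
  also have "\<dots> \<le> (l2norm U u + l2norm U v)\<^sup>2"
    using L2_Cauchy_Schwarz[OF assms] unfolding power2_sum by simp
  finally show "(l2norm U (\<lambda>x. u x + v x))\<^sup>2 \<le> (l2norm U u + l2norm U v)\<^sup>2" .
qed simp

lemma l2norm_triangle_diff:
  assumes "L2 U u" "L2 U v" "L2 U w"
  shows "l2norm U (\<lambda>x. u x - w x) \<le> l2norm U (\<lambda>x. u x - v x) + l2norm U (\<lambda>x. v x - w x)"
  using l2norm_triangle[OF L2_diff[OF assms(1,2)] L2_diff[OF assms(2,3)]] by simp

lemma l2norm_diff_le:
  assumes "L2 U u" "L2 U v"
  shows "l2norm U (\<lambda>x. u x - v x) \<le> l2norm U u + l2norm U v"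
  using l2norm_triangle[OF assms(1) L2_minus[OF assms(2)]] by (simp add: l2norm_minus)

lemma l2norm_le_diff:
  assumes "L2 U u" "L2 U v"
  shows "l2norm U u \<le> l2norm U v + l2norm U (\<lambda>x. u x - v x)"
  using l2norm_triangle[OF assms(2) L2_diff[OF assms]] by simp

lemma l2norm_sum_le:
  assumes "\<And>i. i \<in> I \<Longrightarrow> L2 U (u i)"
  shows "l2norm U (\<lambda>x. \<Sum>i\<in>I. u i x) \<le> (\<Sum>i\<in>I. l2norm U (u i))"
  using assms
proof (induction I rule: infinite_finite_induct)
  case (insert i I)
  then have "l2norm U (\<lambda>x. u i x + (\<Sum>i\<in>I. u i x)) \<le> l2norm U (u i) + l2norm U (\<lambda>x. \<Sum>i\<in>I. u i x)"
    by (intro l2norm_triangle L2_intros) auto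
  with insert show ?case by auto
qed auto

lemma L2_bounded_mult:
  assumes "L2 U u" "a \<in> borel_measurable (lebesgue_on U)" "AE x in lebesgue_on U. \<bar>a x\<bar> \<le> M"
  shows "L2 U (\<lambda>x. a x * u x)" "M \<ge> 0 \<Longrightarrow> l2norm U (\<lambda>x. a x * u x) \<le> M * l2norm U u"
proof -
  have le: "AE x in lebesgue_on U. (a x * u x)\<^sup>2 \<le> M\<^sup>2 * (u x)\<^sup>2"
    using assms(3)
  proof eventually_elim
    case (elim x)
    then have "(a x)\<^sup>2 \<le> M\<^sup>2" using power_mono[of "\<bar>a x\<bar>" M 2] by simp
    then show ?case by (simp add: power_mult_distrib mult_right_mono)
  qed
  have int: "integrable (lebesgue_on U) (\<lambda>x. M\<^sup>2 * (u x)\<^sup>2)"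
    using assms(1) by (simp add: L2_def)
  have "integrable (lebesgue_on U) (\<lambda>x. (a x * u x)\<^sup>2)"
    by (rule Bochner_Integration.integrable_bound[OF int])
       (use le assms(1,2) in \<open>auto dest!: L2_measurable\<close>)
  then show L2: "L2 U (\<lambda>x. a x * u x)"
    using assms(1,2) by (auto simp: L2_def)
  assume "M \<ge> 0"
  have "(\<integral>x. (a x * u x)\<^sup>2 \<partial>lebesgue_on U) \<le> (\<integral>x. M\<^sup>2 * (u x)\<^sup>2 \<partial>lebesgue_on U)"
    by (rule integral_mono_AE[OF L2_sq_integrable[OF L2] int le])
  also have "\<dots> = (M * l2norm U u)\<^sup>2"
    by (simp add: l2norm_sq power_mult_distrib)
  finally have "(l2norm U (\<lambda>x. a x * u x))\<^sup>2 \<le> (M * l2norm U u)\<^sup>2"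
    by (simp only: l2norm_sq)
  then show "l2norm U (\<lambda>x. a x * u x) \<le> M * l2norm U u"
    using \<open>M \<ge> 0\<close> by (rule power2_le_imp_le[OF _ mult_nonneg_nonneg]) simp
qed

lemma finite_measure_lebesgue_on_bounded:
  assumes "open U" "bounded U"
  shows "finite_measure (lebesgue_on U)"
  by (intro finite_measure_lebesgue_on bounded_set_imp_lmeasurable assms lmeasurable_open) 

lemma L2_bounded:
  assumes "open U" "bounded U" "u \<in> borel_measurable (lebesgue_on U)" "\<And>x. \<bar>u x\<bar> \<le> M"
  shows "L2 U u"
proof -
  interpret finite_measure "lebesgue_on U"
    by (rule finite_measure_lebesgue_on_bounded[OF assms(1,2)])
  have "integrable (lebesgue_on U) (\<lambda>x. (u x)\<^sup>2)"
    by (rule integrable_const_bound[of _ "M\<^sup>2"])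
       (use assms(3) power_mono[OF assms(4) abs_ge_zero, of _ 2] in auto)
  then show ?thesis using assms by (simp add: L2_def)
qed

lemma open_lebesgue: "open U \<Longrightarrow> U \<in> sets lebesgue"
  by auto

lemma smooth_fun_measurable:
  assumes "smooth_fun f"
  shows "f \<in> borel_measurable (lebesgue_on U)"
proof -
  have "f \<in> borel_measurable lborel"
    using borel_measurable_continuous_onI[OF smooth_fun_continuous[OF assms]] by simp
  then show ?thesis
    by (intro measurable_restrict_space1 measurable_completion)
qed

lemma test_fun_L2:
  assumes "test_fun V \<phi>" "open U" "bounded U"
  shows "L2 U \<phi>"
  using test_fun_bounded[OF assms(1)] L2_bounded[OF assms(2,3) smooth_fun_measurable[OF test_funD(1)[OF assms(1)]]]
  by metis

lemma l2norm_tendsto_integral: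
  assumes "\<And>n. L2 U (u n)" "L2 U u'" "L2 U v" "(\<lambda>n. l2norm U (\<lambda>x. u' x - u n x)) \<longlonglongrightarrow> 0"
  shows "(\<lambda>n. \<integral>x. u n x * v x \<partial>lebesgue_on U) \<longlonglongrightarrow> (\<integral>x. u' x * v x \<partial>lebesgue_on U)"
proof (rule LIM_zero_cancel, rule Lim_null_comparison)
  show "\<forall>\<^sub>F n in sequentially. norm ((\<integral>x. u n x * v x \<partial>lebesgue_on U) - (\<integral>x. u' x * v x \<partial>lebesgue_on U))
      \<le> l2norm U (\<lambda>x. u' x - u n x) * l2norm U v"
  proof (intro always_eventually allI)
    fix n
    have "(\<integral>x. u' x * v x \<partial>lebesgue_on U) - (\<integral>x. u n x * v x \<partial>lebesgue_on U)
        = (\<integral>x. (u' x - u n x) * v x \<partial>lebesgue_on U)"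
      using L2_mult_integrable[OF assms(2,3)] L2_mult_integrable[OF assms(1,3), of n]
      by (simp add: left_diff_distrib)
    then show "norm ((\<integral>x. u n x * v x \<partial>lebesgue_on U) - (\<integral>x. u' x * v x \<partial>lebesgue_on U))
      \<le> l2norm U (\<lambda>x. u' x - u n x) * l2norm U v"
      using L2_Cauchy_Schwarz[of U "\<lambda>x. u' x - u n x" v] assms by (simp add: L2_diff abs_minus_commute)
  qed
  show "(\<lambda>n. l2norm U (\<lambda>x. u' x - u n x) * l2norm U v) \<longlonglongrightarrow> 0"
    using tendsto_mult_right[OF assms(4)] by simp
qed

subsection \<open>Fubini for the completed measure\<close>

lemma lebesgue_measurable_AE_eq:
  fixes g g' :: "'a::euclidean_space \<Rightarrow> real"
  assumes "g' \<in> borel_measurable lebesgue" "AE x in lebesgue. g x = g' x"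
  shows "g \<in> borel_measurable lebesgue"
proof (rule measurableI)
  fix B :: "real set" assume B: "B \<in> sets borel"
  show "g -` B \<inter> space lebesgue \<in> sets lebesgue"
    by (rule completion.in_sets_AE[of "g' -` B \<inter> space lebesgue"])
       (use assms(2) measurable_sets[OF assms(1) B] in \<open>auto elim: eventually_mono\<close>)
qed auto

lemma
  fixes g g' :: "'c::euclidean_space \<Rightarrow> real"
  assumes g': "g' \<in> borel_measurable lborel" and ae: "AE y in lborel. g y = g' y"
  shows integrable_lebesgue_AE_eq: "integrable lborel g' \<Longrightarrow> integrable lebesgue g"
    and integral_lebesgue_AE_eq: "integral\<^sup>L lebesgue g = integral\<^sup>L lborel g'"
proof -
  have m': "g' \<in> borel_measurable lebesgue" using g' by (rule measurable_completion)
  have ae': "AE y in lebesgue. g y = g' y" using ae by (rule AE_completion)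
  have m: "g \<in> borel_measurable lebesgue" by (rule lebesgue_measurable_AE_eq[OF m' ae'])
  have "integrable lebesgue g = integrable lebesgue g'" by (rule integrable_cong_AE[OF m m' ae'])
  moreover have "integral\<^sup>L lebesgue g = integral\<^sup>L lebesgue g'" by (rule integral_cong_AE[OF m m' ae'])
  ultimately show "integrable lborel g' \<Longrightarrow> integrable lebesgue g" "integral\<^sup>L lebesgue g = integral\<^sup>L lborel g'"
    using g' by (simp_all add: integrable_completion integral_completion)
qed

text \<open>Fubini for Borel functions is applied to a Borel version \<open>f'\<close> of
  \<open>f\<close>. What remains is that almost every section of \<open>f\<close> agrees almost
  everywhere with the corresponding section of \<open>f'\<close>, in both variables; the integrals
  then agree because sections are integrated with the completed measure.\<close>

lemma
  fixes f :: "'a::euclidean_space \<times> 'b::euclidean_space \<Rightarrow> real"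
  assumes f: "integrable lebesgue f"
  shows lebesgue_AE_integrable_fst: "AE x in lebesgue. integrable lebesgue (\<lambda>y. f (x, y))"
    and lebesgue_integrable_fst: "integrable lebesgue (\<lambda>x. \<integral>y. f (x, y) \<partial>lebesgue)"
    and lebesgue_integral_fst: "(\<integral>x. \<integral>y. f (x, y) \<partial>lebesgue \<partial>lebesgue) = integral\<^sup>L lebesgue f"
    and lebesgue_AE_integrable_snd: "AE y in lebesgue. integrable lebesgue (\<lambda>x. f (x, y))"
    and lebesgue_integrable_snd: "integrable lebesgue (\<lambda>y. \<integral>x. f (x, y) \<partial>lebesgue)"
    and lebesgue_integral_snd: "(\<integral>y. \<integral>x. f (x, y) \<partial>lebesgue \<partial>lebesgue) = integral\<^sup>L lebesgue f"
proof -
  obtain f' where f': "f' \<in> borel_measurable lborel" "AE x in lborel. f x = f' x"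
    using completion_ex_borel_measurable_real[OF borel_measurable_integrable[OF f]] by auto
  have lf': "f' \<in> borel_measurable lebesgue" using f'(1) by (rule measurable_completion)
  have "integrable lebesgue f'"
    using f by (rule integrable_cong_AE_imp[OF _ lf']) (use f'(2) in \<open>auto intro!: AE_completion\<close>)
  then have "integrable lborel f'" using integrable_completion[OF f'(1)] by simp
  then have int: "integrable (lborel \<Otimes>\<^sub>M lborel) f'" by (simp add: lborel_prod)
  then have int2: "integrable (lborel \<Otimes>\<^sub>M lborel) (\<lambda>(x, y). f' (x, y))" by simp
  have eqi: "integral\<^sup>L lebesgue f = integral\<^sup>L (lborel \<Otimes>\<^sub>M lborel) f'"
    using integral_cong_AE[of f lebesgue f'] f lf' f' by (auto simp: AE_completion integral_completion lborel_prod)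
  have ae: "AE z in lborel \<Otimes>\<^sub>M lborel. f z = f' z" unfolding lborel_prod by (rule f'(2))
  \<comment> \<open>The set where \<open>f\<close> and \<open>f'\<close> differ need not be Borel.
    Exchanging the two almost-everywhere quantifiers requires measurability, so that set is replaced
    by a Borel null set containing it.\<close>
  obtain N where N: "N \<in> null_sets (lborel \<Otimes>\<^sub>M lborel)" "\<And>z. z \<notin> N \<Longrightarrow> f z = f' z"
    using ae by (force elim!: AE_E simp: null_sets_def space_pair_measure)
  have aeN: "AE z in lborel \<Otimes>\<^sub>M lborel. z \<notin> N" by (rule AE_not_in[OF N(1)])
  have Nm: "N \<in> sets (lborel \<Otimes>\<^sub>M lborel)" using N(1) by auto
  have bm: "f' \<in> borel_measurable (lborel \<Otimes>\<^sub>M lborel)" using int by auto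
  have m1: "(\<lambda>y. f' (x, y)) \<in> borel_measurable lborel" for x
    using bm by (rule measurable_Pair2) simp
  have m2: "(\<lambda>x. f' (x, y)) \<in> borel_measurable lborel" for y
    using bm by (rule measurable_Pair1) simp
  have ae1: "AE x in lborel. AE y in lborel. f (x, y) = f' (x, y)"
    using lborel_pair.AE_pair[OF ae] .
  have "AE x in lborel. AE y in lborel. (x, y) \<notin> N"
    using lborel_pair.AE_pair[OF aeN] .
  then have "AE y in lborel. AE x in lborel. (x, y) \<notin> N"
  proof (subst (asm) lborel_pair.AE_commute)
    have "{x \<in> space (lborel \<Otimes>\<^sub>M lborel). (fst x, snd x) \<notin> N} = space (lborel \<Otimes>\<^sub>M lborel) - N" by auto
    then show "{x \<in> space (lborel \<Otimes>\<^sub>M lborel). (fst x, snd x) \<notin> N} \<in> sets (lborel \<Otimes>\<^sub>M lborel)"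
      using sets.compl_sets[OF Nm] by simp
  qed
  then have ae2: "AE y in lborel. AE x in lborel. f (x, y) = f' (x, y)"
    by (rule AE_mp) (auto intro!: AE_I2 elim!: eventually_mono N(2))
  have *: "AE x in lborel. integrable lebesgue (\<lambda>y. f (x, y)) \<and> (\<integral>y. f (x, y) \<partial>lebesgue) = (\<integral>y. f' (x, y) \<partial>lborel)"
    using ae1 lborel_pair.AE_integrable_fst[OF int2] by eventually_elim (simp add: integrable_lebesgue_AE_eq[OF m1] integral_lebesgue_AE_eq[OF m1])
  have **: "AE y in lborel. integrable lebesgue (\<lambda>x. f (x, y)) \<and> (\<integral>x. f (x, y) \<partial>lebesgue) = (\<integral>x. f' (x, y) \<partial>lborel)"
    using ae2 lborel_pair.AE_integrable_snd[OF int2] by eventually_elim (simp add: integrable_lebesgue_AE_eq[OF m2] integral_lebesgue_AE_eq[OF m2])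
  show "AE x in lebesgue. integrable lebesgue (\<lambda>y. f (x, y))"
    by (rule AE_completion) (use * in \<open>auto elim: eventually_mono\<close>)
  show "AE y in lebesgue. integrable lebesgue (\<lambda>x. f (x, y))"
    by (rule AE_completion) (use ** in \<open>auto elim: eventually_mono\<close>)
  have i1: "integrable lborel (\<lambda>x. \<integral>y. f' (x, y) \<partial>lborel)" "(\<integral>x. \<integral>y. f' (x, y) \<partial>lborel \<partial>lborel) = integral\<^sup>L (lborel \<Otimes>\<^sub>M lborel) f'"
    using lborel_pair.integrable_fst[OF int2] lborel_pair.integral_fst[OF int2] by auto
  have i2: "integrable lborel (\<lambda>y. \<integral>x. f' (x, y) \<partial>lborel)" "(\<integral>y. \<integral>x. f' (x, y) \<partial>lborel \<partial>lborel) = integral\<^sup>L (lborel \<Otimes>\<^sub>M lborel) f'"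
    using lborel_pair.integrable_snd[OF int2] lborel_pair.integral_snd[OF int2] by auto
  have s1: "AE x in lborel. (\<integral>y. f (x, y) \<partial>lebesgue) = (\<integral>y. f' (x, y) \<partial>lborel)"
    using * by (auto elim: eventually_mono)
  have s2: "AE y in lborel. (\<integral>x. f (x, y) \<partial>lebesgue) = (\<integral>x. f' (x, y) \<partial>lborel)"
    using ** by (auto elim: eventually_mono)
  note r1 = integrable_lebesgue_AE_eq[OF borel_measurable_integrable[OF i1(1)] s1]
    integral_lebesgue_AE_eq[OF borel_measurable_integrable[OF i1(1)] s1]
  note r2 = integrable_lebesgue_AE_eq[OF borel_measurable_integrable[OF i2(1)] s2]
    integral_lebesgue_AE_eq[OF borel_measurable_integrable[OF i2(1)] s2]
  show "integrable lebesgue (\<lambda>x. \<integral>y. f (x, y) \<partial>lebesgue)"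
    "(\<integral>x. \<integral>y. f (x, y) \<partial>lebesgue \<partial>lebesgue) = integral\<^sup>L lebesgue f"
    using r1 i1 eqi by auto
  show "integrable lebesgue (\<lambda>y. \<integral>x. f (x, y) \<partial>lebesgue)"
    "(\<integral>y. \<integral>x. f (x, y) \<partial>lebesgue \<partial>lebesgue) = integral\<^sup>L lebesgue f"
    using r2 i2 eqi by auto
qed

lemma
  fixes f :: "'c::euclidean_space \<Rightarrow> real"
  assumes "U \<in> sets lebesgue"
  shows integrable_lebesgue_on_iff: "integrable (lebesgue_on U) f \<longleftrightarrow> integrable lebesgue (\<lambda>x. indicator U x * f x)"
    and integral_lebesgue_on: "integral\<^sup>L (lebesgue_on U) f = (\<integral>x. indicator U x * f x \<partial>lebesgue)"
  using integrable_restrict_space[of U lebesgue f] integral_restrict_space[of U lebesgue f] assms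
  by auto

lemma
  fixes f :: "'a::euclidean_space \<times> 'b::euclidean_space \<Rightarrow> real"
  assumes f: "integrable (lebesgue_on (S \<times> T)) f" and S: "open S" and T: "open T"
  shows AE_integrable_section_snd: "AE x in lebesgue_on S. integrable (lebesgue_on T) (\<lambda>y. f (x, y))"
    and integrable_section_snd: "integrable (lebesgue_on S) (\<lambda>x. \<integral>y. f (x, y) \<partial>lebesgue_on T)"
    and integral_section_snd:
      "integral\<^sup>L (lebesgue_on (S \<times> T)) f = (\<integral>x. \<integral>y. f (x, y) \<partial>lebesgue_on T \<partial>lebesgue_on S)"
    and AE_integrable_section_fst: "AE y in lebesgue_on T. integrable (lebesgue_on S) (\<lambda>x. f (x, y))"
    and integrable_section_fst: "integrable (lebesgue_on T) (\<lambda>y. \<integral>x. f (x, y) \<partial>lebesgue_on S)"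
    and integral_section_fst:
      "integral\<^sup>L (lebesgue_on (S \<times> T)) f = (\<integral>y. \<integral>x. f (x, y) \<partial>lebesgue_on S \<partial>lebesgue_on T)"
proof -
  note op = open_lebesgue[OF S] open_lebesgue[OF T] open_lebesgue[OF open_Times[OF S T]]
  define g where "g z = indicator (S \<times> T) z * f z" for z
  have g: "integrable lebesgue g"
    using f op by (simp add: integrable_lebesgue_on_iff g_def[abs_def])
  have g1: "indicator S x * (indicator T y * f (x, y)) = g (x, y)" for x y
    by (simp add: g_def indicator_times)
  have g2: "indicator T y * (indicator S x * f (x, y)) = g (x, y)" for x y
    by (simp add: g_def indicator_times)
  have e1: "indicator S x * (\<integral>y. f (x, y) \<partial>lebesgue_on T) = (\<integral>y. g (x, y) \<partial>lebesgue)" for x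
    using op by (simp add: integral_lebesgue_on g1 flip: integral_mult_right_zero)
  have e2: "indicator T y * (\<integral>x. f (x, y) \<partial>lebesgue_on S) = (\<integral>x. g (x, y) \<partial>lebesgue)" for y
    using op by (simp add: integral_lebesgue_on g2 flip: integral_mult_right_zero)
  show "AE x in lebesgue_on S. integrable (lebesgue_on T) (\<lambda>y. f (x, y))"
    using lebesgue_AE_integrable_fst[OF g] op
    by (subst AE_restrict_space_iff) (auto simp: integrable_lebesgue_on_iff g_def indicator_times elim!: eventually_mono)
  show "AE y in lebesgue_on T. integrable (lebesgue_on S) (\<lambda>x. f (x, y))"
    using lebesgue_AE_integrable_snd[OF g] op
    by (subst AE_restrict_space_iff) (auto simp: integrable_lebesgue_on_iff g_def indicator_times elim!: eventually_mono)
  show "integrable (lebesgue_on S) (\<lambda>x. \<integral>y. f (x, y) \<partial>lebesgue_on T)"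
    using lebesgue_integrable_fst[OF g] op(1) by (simp add: integrable_lebesgue_on_iff e1)
  show "integrable (lebesgue_on T) (\<lambda>y. \<integral>x. f (x, y) \<partial>lebesgue_on S)"
    using lebesgue_integrable_snd[OF g] op(2) by (simp add: integrable_lebesgue_on_iff[OF op(2)] e2)
  show "integral\<^sup>L (lebesgue_on (S \<times> T)) f = (\<integral>x. \<integral>y. f (x, y) \<partial>lebesgue_on T \<partial>lebesgue_on S)"
    using lebesgue_integral_fst[OF g] by (simp add: integral_lebesgue_on[OF op(1)] integral_lebesgue_on[OF op(3)] e1 flip: g_def)
  show "integral\<^sup>L (lebesgue_on (S \<times> T)) f = (\<integral>y. \<integral>x. f (x, y) \<partial>lebesgue_on S \<partial>lebesgue_on T)"
    using lebesgue_integral_snd[OF g] by (simp add: integral_lebesgue_on[OF op(2)] integral_lebesgue_on[OF op(3)] e2 flip: g_def)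
qed

text \<open>Both factors are replaced by Borel versions, for which the product is plainly
  measurable. The error is confined to the null cylinders over the two exceptional sets, and the
  completed measure ignores it.\<close>

lemma
  fixes u :: "'a::euclidean_space \<Rightarrow> real" and v :: "'b::euclidean_space \<Rightarrow> real"
  assumes u: "u \<in> borel_measurable (lebesgue_on S)" and v: "v \<in> borel_measurable (lebesgue_on T)"
    and S: "open S" and T: "open T"
  shows measurable_tensor: "(\<lambda>x. u (fst x) * v (snd x)) \<in> borel_measurable (lebesgue_on (S \<times> T))"
    and integrable_tensor_aux: "integrable (lebesgue_on S) u \<Longrightarrow> integrable (lebesgue_on T) v \<Longrightarrow>
      integrable (lebesgue_on (S \<times> T)) (\<lambda>x. u (fst x) * v (snd x))"
proof -
  note op = open_lebesgue[OF S] open_lebesgue[OF T] open_lebesgue[OF open_Times[OF S T]]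
  define f where "f x = indicator S x * u x" for x
  define g where "g x = indicator T x * v x" for x
  have f: "f \<in> borel_measurable lebesgue" and g: "g \<in> borel_measurable lebesgue"
    using u v op by (simp_all add: borel_measurable_restrict_space_iff f_def[abs_def] g_def[abs_def])
  obtain f' where f': "f' \<in> borel_measurable lborel" "AE x in lborel. f x = f' x"
    using completion_ex_borel_measurable_real[OF f] by auto
  obtain g' where g': "g' \<in> borel_measurable lborel" "AE x in lborel. g x = g' x"
    using completion_ex_borel_measurable_real[OF g] by auto
  have eq: "indicator (S \<times> T) x * (u (fst x) * v (snd x)) = f (fst x) * g (snd x)" for x
    by (simp add: f_def g_def indicator_times)
  have mm: "(\<lambda>x. f' (fst x) * g' (snd x)) \<in> borel_measurable (lborel \<Otimes>\<^sub>M lborel)"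
    using f' g' by measurable
  obtain M where M: "M \<in> null_sets lborel" "\<And>z. z \<notin> M \<Longrightarrow> f z = f' z"
    using f'(2) by (force elim!: AE_E simp: null_sets_def)
  obtain N where N: "N \<in> null_sets lborel" "\<And>z. z \<notin> N \<Longrightarrow> g z = g' z"
    using g'(2) by (force elim!: AE_E simp: null_sets_def)
  have "AE z in lborel \<Otimes>\<^sub>M lborel. fst z \<notin> M \<and> snd z \<notin> N"
  proof (rule lborel_pair.AE_pair_measure)
    have [measurable]: "M \<in> sets borel" "N \<in> sets borel" using M N by auto
    show "{z \<in> space (lborel \<Otimes>\<^sub>M lborel). fst z \<notin> M \<and> snd z \<notin> N} \<in> sets (lborel \<Otimes>\<^sub>M lborel)"
      by measurable
    have "AE x in lborel. x \<notin> M" "AE y in lborel. y \<notin> N" using AE_not_in M N by auto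
    then show "AE x in lborel. AE y in lborel. fst (x, y) \<notin> M \<and> snd (x, y) \<notin> N"
      by auto
  qed
  then have ae: "AE z in lborel. f (fst z) * g (snd z) = f' (fst z) * g' (snd z)"
    unfolding lborel_prod by (rule eventually_mono) (use M N in auto)
  have m2: "(\<lambda>x. f' (fst x) * g' (snd x)) \<in> borel_measurable lebesgue"
    by (rule measurable_completion) (use mm in \<open>simp add: lborel_prod\<close>)
  have m: "(\<lambda>x. f (fst x) * g (snd x)) \<in> borel_measurable lebesgue"
    by (rule lebesgue_measurable_AE_eq[OF m2 AE_completion[OF ae]])
  then show "(\<lambda>x. u (fst x) * v (snd x)) \<in> borel_measurable (lebesgue_on (S \<times> T))"
    using op by (simp add: borel_measurable_restrict_space_iff eq)
  assume "integrable (lebesgue_on S) u" "integrable (lebesgue_on T) v"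
  then have "integrable lebesgue f" "integrable lebesgue g"
    using op by (simp_all add: integrable_lebesgue_on_iff f_def[abs_def] g_def[abs_def])
  then have "integrable lebesgue f'" "integrable lebesgue g'"
    using integrable_cong_AE_imp[OF _ measurable_completion[OF f'(1)], of f]
      integrable_cong_AE_imp[OF _ measurable_completion[OF g'(1)], of g]
      AE_completion[OF f'(2)] AE_completion[OF g'(2)] by (auto simp: eq_commute)
  then have i': "integrable lborel f'" "integrable lborel g'"
    using f' g' by (auto simp: integrable_completion)
  have "integrable (lborel \<Otimes>\<^sub>M lborel) (\<lambda>x. f' (fst x) * g' (snd x))"
  proof (rule lborel_pair.Fubini_integrable[OF mm])
    show "integrable lborel (\<lambda>x. \<integral>y. norm (f' (fst (x, y)) * g' (snd (x, y))) \<partial>lborel)"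
      using i' by (simp add: abs_mult)
    show "AE x in lborel. integrable lborel (\<lambda>y. f' (fst (x, y)) * g' (snd (x, y)))"
      using i' by simp
  qed
  then have "integrable lebesgue (\<lambda>x. f' (fst x) * g' (snd x))"
    using mm by (simp add: lborel_prod integrable_completion)
  then have "integrable lebesgue (\<lambda>x. f (fst x) * g (snd x))"
    by (rule integrable_cong_AE_imp[OF _ m]) (use AE_completion[OF ae] in \<open>auto elim: eventually_mono\<close>)
  then show "integrable (lebesgue_on (S \<times> T)) (\<lambda>x. u (fst x) * v (snd x))"
    using op by (simp add: integrable_lebesgue_on_iff eq)
qed

lemma integrable_tensor:
  assumes "open S" "open T" "integrable (lebesgue_on S) u" "integrable (lebesgue_on T) v"
  shows "integrable (lebesgue_on (S \<times> T)) (\<lambda>x. u (fst x) * v (snd x) :: real)"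
  using integrable_tensor_aux[of u S v T] assms by auto

lemma L2_tensor:
  assumes "L2 S u" "L2 T v" "open S" "open T"
  shows "L2 (S \<times> T) (\<lambda>x. u (fst x) * v (snd x))"
  using integrable_tensor[OF assms(3,4) L2_sq_integrable[OF assms(1)] L2_sq_integrable[OF assms(2)]]
    measurable_tensor[OF L2_measurable[OF assms(1)] L2_measurable[OF assms(2)] assms(3,4)]
  by (simp add: L2_def power_mult_distrib)

lemma integral_tensor:
  fixes u :: "'a::euclidean_space \<Rightarrow> real" and v :: "'b::euclidean_space \<Rightarrow> real"
  assumes "integrable (lebesgue_on S) u" "integrable (lebesgue_on T) v" "open S" "open T"
  shows "(\<integral>x. u (fst x) * v (snd x) \<partial>lebesgue_on (S \<times> T)) = (\<integral>x. u x \<partial>lebesgue_on S) * (\<integral>y. v y \<partial>lebesgue_on T)"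
  using integral_section_snd[OF integrable_tensor[OF assms(3,4,1,2)] assms(3,4)] by simp

lemma l2norm_tensor:
  assumes "L2 S u" "L2 T v" "open S" "open T"
  shows "l2norm (S \<times> T) (\<lambda>x. u (fst x) * v (snd x)) = l2norm S u * l2norm T v"
  using integral_tensor[OF L2_sq_integrable[OF assms(1)] L2_sq_integrable[OF assms(2)] assms(3,4)]
  by (simp add: l2norm_def power_mult_distrib real_sqrt_mult)

lemma L2_integrable:
  assumes "L2 U u" "open U" "bounded U"
  shows "integrable (lebesgue_on U) u"
proof -
  have "L2 U (\<lambda>x. 1)" by (rule L2_bounded[OF assms(2,3), of _ 1]) auto
  from L2_mult_integrable[OF assms(1) this] show ?thesis by simp
qed

subsection \<open>Density of bump functions\<close>

lemma l2norm_dominated_convergence: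
  assumes "\<And>n. u n \<in> borel_measurable (lebesgue_on U)" "u' \<in> borel_measurable (lebesgue_on U)"
    and "L2 U w" "\<And>x. x \<in> U \<Longrightarrow> (\<lambda>n. u n x) \<longlonglongrightarrow> u' x"
    and "\<And>n x. x \<in> U \<Longrightarrow> \<bar>u' x - u n x\<bar> \<le> w x"
  shows "(\<lambda>n. l2norm U (\<lambda>x. u' x - u n x)) \<longlonglongrightarrow> 0"
proof -
  have "(\<lambda>n. \<integral>x. (u' x - u n x)\<^sup>2 \<partial>lebesgue_on U) \<longlonglongrightarrow> (\<integral>x. 0 \<partial>lebesgue_on U)"
  proof (rule integral_dominated_convergence[where w = "\<lambda>x. (w x)\<^sup>2"])
    show "AE x in lebesgue_on U. (\<lambda>n. (u' x - u n x)\<^sup>2) \<longlonglongrightarrow> 0"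
    proof (rule AE_I2)
      fix x assume "x \<in> space (lebesgue_on U)"
      then have "(\<lambda>n. (u' x - u n x)\<^sup>2) \<longlonglongrightarrow> (u' x - u' x)\<^sup>2"
        by (intro tendsto_intros assms) auto
      then show "(\<lambda>n. (u' x - u n x)\<^sup>2) \<longlonglongrightarrow> 0" by simp
    qed
    show "AE x in lebesgue_on U. norm ((u' x - u n x)\<^sup>2) \<le> (w x)\<^sup>2" for n
      using power_mono[OF assms(5) abs_ge_zero, of _ n 2] by (intro AE_I2) auto
  qed (use assms(1,2,3) in \<open>auto simp: L2_def\<close>)
  then have "(\<lambda>n. sqrt (\<integral>x. (u' x - u n x)\<^sup>2 \<partial>lebesgue_on U)) \<longlonglongrightarrow> sqrt 0"
    by (intro tendsto_intros) simp
  then show ?thesis by (simp add: l2norm_def)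
qed

section \<open>A countable family of bumps\<close>

definition rational_box :: "'c::euclidean_space set \<Rightarrow> 'c \<times> 'c \<Rightarrow> bool" where
  "rational_box U p \<longleftrightarrow> (\<forall>i\<in>Basis. fst p \<bullet> i \<in> \<rat> \<and> snd p \<bullet> i \<in> \<rat>) \<and> box (fst p) (snd p) \<subseteq> U"

definition rboxes :: "'c::euclidean_space set \<Rightarrow> 'c set set" where
  "rboxes U = (\<lambda>p. box (fst p) (snd p)) ` {p. rational_box U p}"

lemma rboxesI: "rational_box U (a, b) \<Longrightarrow> box a b \<in> rboxes U"
  unfolding rboxes_def by force

lemma rboxesE:
  assumes "B \<in> rboxes U"
  obtains a b where "B = box a b" "rational_box U (a, b)"
  using assms by (auto simp: rboxes_def)

lemma rboxes_subset: "rboxes U \<subseteq> Pow U"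
  by (auto simp: rboxes_def rational_box_def)

text \<open>Rational corners and integer n make the family countable, so a property valid almost
  everywhere for each bump holds off one common null set.\<close>

definition bumps :: "'c::euclidean_space set \<Rightarrow> ('c \<Rightarrow> real) set" where
  "bumps U = (\<lambda>(p, n). bump (fst p) (snd p) n) ` ({p. rational_box U p} \<times> {0<..})"

lemma bumpsE:
  assumes "\<phi> \<in> bumps U"
  obtains a b n where "\<phi> = bump a b n" "rational_box U (a, b)" "n > 0"
  using assms by (auto simp: bumps_def)

lemma bumps_test_fun: "\<phi> \<in> bumps U \<Longrightarrow> test_fun U \<phi>"
  by (auto simp: bumps_def rational_box_def intro: test_fun_bump)

lemma countable_rational_points: "countable {a::'c::euclidean_space. \<forall>i\<in>Basis. a \<bullet> i \<in> \<rat>}"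
proof (rule countable_subset)
  show "{a::'c. \<forall>i\<in>Basis. a \<bullet> i \<in> \<rat>} \<subseteq> (\<lambda>f. \<Sum>i\<in>Basis. f i *\<^sub>R i) ` (Basis \<rightarrow>\<^sub>E \<rat>)"
  proof
    fix a :: 'c assume "a \<in> {a. \<forall>i\<in>Basis. a \<bullet> i \<in> \<rat>}"
    moreover have "a = (\<Sum>i\<in>Basis. restrict (\<lambda>i. a \<bullet> i) Basis i *\<^sub>R i)"
      by (simp add: euclidean_representation)
    moreover have "restrict (\<lambda>i. a \<bullet> i) Basis \<in> Basis \<rightarrow>\<^sub>E \<rat>"
      using calculation(1) by auto
    ultimately show "a \<in> (\<lambda>f. \<Sum>i\<in>Basis. f i *\<^sub>R i) ` (Basis \<rightarrow>\<^sub>E \<rat>)"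
      by (intro image_eqI)
  qed
  show "countable ((\<lambda>f. \<Sum>i\<in>Basis. f i *\<^sub>R i) ` ((Basis :: 'c set) \<rightarrow>\<^sub>E (\<rat> :: real set)))"
    by (intro countable_image countable_PiE countable_rat) auto
qed

lemma countable_bumps: "countable (bumps U)"
proof -
  have "countable ({a::'a. \<forall>i\<in>Basis. a \<bullet> i \<in> \<rat>} \<times> {a::'a. \<forall>i\<in>Basis. a \<bullet> i \<in> \<rat>})"
    by (intro countable_SIGMA countable_rational_points)
  then have "countable {p. rational_box U p}"
    by (rule countable_subset[rotated]) (auto simp: rational_box_def)
  then show ?thesis
    unfolding bumps_def by (intro countable_image countable_SIGMA) auto
qed

inductive_set bump_span :: "'c::euclidean_space set \<Rightarrow> ('c \<Rightarrow> real) set" for U where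
  zero: "(\<lambda>x. 0) \<in> bump_span U"
| step: "\<phi> \<in> bumps U \<Longrightarrow> p \<in> bump_span U \<Longrightarrow> (\<lambda>x. c * \<phi> x + p x) \<in> bump_span U"

lemma bump_span_add:
  assumes "p \<in> bump_span U" "q \<in> bump_span U"
  shows "(\<lambda>x. p x + q x) \<in> bump_span U"
  using assms(1)
proof induction
  case (step \<phi> p c)
  from bump_span.step[OF step(1,3), of c] show ?case by (simp add: add.assoc)
qed (use assms(2) in simp)

lemma bump_span_cmult:
  assumes "p \<in> bump_span U"
  shows "(\<lambda>x. d * p x) \<in> bump_span U"
  using assms
proof induction
  case (step \<phi> p c)
  from bump_span.step[OF step(1,3), of "d * c"] show ?case by (simp add: algebra_simps)
qed (auto intro: bump_span.zero)

lemma bump_span_test_fun: "p \<in> bump_span U \<Longrightarrow> test_fun U p"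
proof (induction rule: bump_span.induct)
  case (step \<phi> p c)
  from test_fun_add[OF test_fun_cmult[OF bumps_test_fun[OF step(1)], of c] step(3)] show ?case .
qed simp

definition approximable :: "'c::euclidean_space set \<Rightarrow> ('c \<Rightarrow> real) \<Rightarrow> bool" where
  "approximable U h \<longleftrightarrow> L2 U h \<and> (\<forall>e>0. \<exists>p\<in>bump_span U. l2norm U (\<lambda>x. h x - p x) < e)"

context
  fixes U :: "'c::euclidean_space set"
  assumes U: "open U" "bounded U"
begin

lemma bump_span_L2: "p \<in> bump_span U \<Longrightarrow> L2 U p"
  using test_fun_L2[OF bump_span_test_fun U] .

lemma approximable_add:
  assumes "approximable U f" "approximable U g"
  shows "approximable U (\<lambda>x. f x + g x)"
  unfolding approximable_def
proof (intro conjI allI impI)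
  fix e :: real assume "e > 0"
  then have "e / 2 > 0" by simp
  then obtain p q where p: "p \<in> bump_span U" "l2norm U (\<lambda>x. f x - p x) < e / 2"
    and q: "q \<in> bump_span U" "l2norm U (\<lambda>x. g x - q x) < e / 2"
    using assms unfolding approximable_def by meson
  have "l2norm U (\<lambda>x. f x + g x - (p x + q x)) \<le> l2norm U (\<lambda>x. f x - p x) + l2norm U (\<lambda>x. g x - q x)"
    using l2norm_triangle[of U "\<lambda>x. f x - p x" "\<lambda>x. g x - q x"] assms bump_span_L2 p q
    by (simp add: L2_diff approximable_def algebra_simps)
  then show "\<exists>p\<in>bump_span U. l2norm U (\<lambda>x. f x + g x - p x) < e"
    using p q bump_span_add by (intro bexI[of _ "\<lambda>x. p x + q x"]) auto
qed (use assms in \<open>auto simp: approximable_def intro: L2_add\<close>)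

lemma approximable_zero: "approximable U (\<lambda>x. 0)"
  unfolding approximable_def by (auto intro!: bexI[OF _ bump_span.zero])

lemma approximable_cmult:
  assumes "approximable U f"
  shows "approximable U (\<lambda>x. c * f x)"
proof (cases "c = 0")
  case False
  show ?thesis
    unfolding approximable_def
  proof (intro conjI allI impI)
    fix e :: real assume "e > 0"
    then have "e / \<bar>c\<bar> > 0" using False by simp
    then obtain p where p: "p \<in> bump_span U" "l2norm U (\<lambda>x. f x - p x) < e / \<bar>c\<bar>"
      using assms unfolding approximable_def by meson
    have "l2norm U (\<lambda>x. c * f x - c * p x) = \<bar>c\<bar> * l2norm U (\<lambda>x. f x - p x)"
      by (simp flip: l2norm_cmult add: right_diff_distrib)
    also have "\<dots> < e" using p(2) False by (simp add: field_simps)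
    finally show "\<exists>p\<in>bump_span U. l2norm U (\<lambda>x. c * f x - p x) < e"
      using p bump_span_cmult by (intro bexI[of _ "\<lambda>x. c * p x"]) auto
  qed (use assms in \<open>auto simp: approximable_def intro: L2_cmult\<close>)
qed (simp add: approximable_zero)

lemma approximable_diff:
  assumes "approximable U f" "approximable U g"
  shows "approximable U (\<lambda>x. f x - g x)"
  using approximable_add[OF assms(1) approximable_cmult[OF assms(2), of "-1"]] by simp

lemma approximable_sum:
  "(\<And>i. i \<in> I \<Longrightarrow> approximable U (f i)) \<Longrightarrow> approximable U (\<lambda>x. \<Sum>i\<in>I. f i x)"
  by (induction I rule: infinite_finite_induct) (auto intro: approximable_add approximable_zero)

lemma approximable_limit:
  assumes "\<And>n. approximable U (f n)" "L2 U h" "(\<lambda>n. l2norm U (\<lambda>x. h x - f n x)) \<longlonglongrightarrow> 0"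
  shows "approximable U h"
  unfolding approximable_def
proof (intro conjI allI impI)
  fix e :: real assume "e > 0"
  then have e: "e / 2 > 0" by simp
  from order_tendstoD(2)[OF assms(3) e] obtain n where n: "l2norm U (\<lambda>x. h x - f n x) < e / 2"
    by (auto simp: eventually_sequentially)
  obtain p where p: "p \<in> bump_span U" "l2norm U (\<lambda>x. f n x - p x) < e / 2"
    using assms(1)[of n] e unfolding approximable_def by meson
  have "l2norm U (\<lambda>x. h x - p x) \<le> l2norm U (\<lambda>x. h x - f n x) + l2norm U (\<lambda>x. f n x - p x)"
    using assms(1)[of n] assms(2) bump_span_L2[OF p(1)] by (intro l2norm_triangle_diff) (auto simp: approximable_def)
  with n p show "\<exists>p\<in>bump_span U. l2norm U (\<lambda>x. h x - p x) < e" by (intro bexI[of _ p]) auto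
qed fact

lemma approximable_cong:
  assumes "approximable U f" "g \<in> borel_measurable (lebesgue_on U)" "AE x in lebesgue_on U. f x = g x"
  shows "approximable U g"
proof -
  have f: "L2 U f" using assms(1) by (simp add: approximable_def)
  have "integrable (lebesgue_on U) (\<lambda>x. (g x)\<^sup>2)"
    by (rule integrable_cong_AE_imp[OF L2_sq_integrable[OF f]]) (use assms(2,3) in auto)
  then have g: "L2 U g" using assms(2) by (simp add: L2_def)
  have "l2norm U (\<lambda>x. g x - f x) = 0"
    using assms(3) by (subst l2norm_eq_0_iff[OF L2_diff[OF g f]]) auto
  then show ?thesis
    using approximable_limit[of "\<lambda>_. f" g] assms(1) g by simp
qed

lemma L2_indicator: "E \<in> sets (lebesgue_on U) \<Longrightarrow> L2 U (indicator E)"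
  by (rule L2_bounded[OF U, of _ 1]) (auto simp: indicator_def)

lemma borel_sets_lebesgue_on: "E \<in> sets borel \<Longrightarrow> E \<subseteq> U \<Longrightarrow> E \<in> sets (lebesgue_on U)"
  using U(1) by (auto simp: sets_restrict_space_iff)

section \<open>From indicators of boxes to all of L2\<close>

lemma approximable_indicator_limit:
  assumes "\<And>n. approximable U (f n)" "E \<in> sets (lebesgue_on U)"
    and "\<And>x. x \<in> U \<Longrightarrow> (\<lambda>n. f n x) \<longlonglongrightarrow> indicator E x" "\<And>n x. x \<in> U \<Longrightarrow> 0 \<le> f n x \<and> f n x \<le> 1"
  shows "approximable U (indicator E)"
proof (rule approximable_limit[OF assms(1) L2_indicator[OF assms(2)]])
  show "(\<lambda>n. l2norm U (\<lambda>x. indicator E x - f n x)) \<longlonglongrightarrow> 0"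
  proof (rule l2norm_dominated_convergence)
    show "L2 U (\<lambda>x. 1)" by (rule L2_bounded[OF U, of _ 1]) auto
    show "f n \<in> borel_measurable (lebesgue_on U)" for n
      using assms(1)[of n] by (simp add: approximable_def L2_def)
    show "\<bar>indicator E x - f n x\<bar> \<le> 1" if "x \<in> U" for n x
      using assms(4)[OF that, of n] by (auto simp: indicator_def)
  qed (use assms(2,3) in auto)
qed

lemma approximable_rational_box:
  assumes "rational_box U (a, b)"
  shows "approximable U (indicator (box a b))"
proof (rule approximable_indicator_limit)
  show "approximable U (bump a b (Suc n))" for n
  proof -
    have "bump a b (Suc n) \<in> bumps U" unfolding bumps_def using assms by force
    from bump_span.step[OF this bump_span.zero, of 1] have "bump a b (Suc n) \<in> bump_span U" by simp
    then show ?thesis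
      unfolding approximable_def using bump_span_L2 by (auto intro!: bexI[of _ "bump a b (Suc n)"])
  qed
  show "(\<lambda>n. bump a b (Suc n) x) \<longlonglongrightarrow> indicator (box a b) x" for x
    using bump_tendsto by (rule LIMSEQ_Suc)
qed (use assms borel_sets_lebesgue_on bump_bounds in \<open>auto simp: rational_box_def\<close>)

lemma rboxes_Int:
  assumes "A \<in> rboxes U" "B \<in> rboxes U"
  shows "A \<inter> B \<in> rboxes U"
proof -
  obtain a b c d where A: "A = box a b" "rational_box U (a, b)" and B: "B = box c d" "rational_box U (c, d)"
    using assms by (meson rboxesE)
  let ?l = "\<Sum>i\<in>Basis. max (a \<bullet> i) (c \<bullet> i) *\<^sub>R i" and ?u = "\<Sum>i\<in>Basis. min (b \<bullet> i) (d \<bullet> i) *\<^sub>R i"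
  have eq: "A \<inter> B = box ?l ?u" unfolding A B box_Int_box ..
  have "A \<inter> B \<subseteq> U" using A by (auto simp: rational_box_def)
  then have "rational_box U (?l, ?u)"
    using A B unfolding rational_box_def eq[symmetric] fst_conv snd_conv by (simp add: max_def min_def)
  then show ?thesis unfolding eq by (rule rboxesI)
qed

lemma open_rboxes:
  assumes "open V" "V \<subseteq> U"
  obtains B where "V = (\<Union>i::nat. B i)" "\<And>i. B i \<in> rboxes U"
proof -
  define a' where "a' = (\<lambda>f :: 'c \<Rightarrow> real \<times> real. (\<Sum>(i::'c)\<in>Basis. fst (f i) *\<^sub>R i))"
  define b' where "b' = (\<lambda>f :: 'c \<Rightarrow> real \<times> real. (\<Sum>(i::'c)\<in>Basis. snd (f i) *\<^sub>R i))"
  define I where "I = {f\<in>Basis \<rightarrow>\<^sub>E \<rat> \<times> \<rat>. box (a' f) (b' f) \<subseteq> V}"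
  have V: "V = (\<Union>f\<in>I. box (a' f) (b' f))"
    unfolding I_def a'_def b'_def by (rule open_UNION_box[OF assms(1)])
  have r: "box (a' f) (b' f) \<in> rboxes U" if "f \<in> I" for f
  proof -
    have "\<forall>i\<in>Basis. a' f \<bullet> i \<in> \<rat> \<and> b' f \<bullet> i \<in> \<rat>"
      using that by (auto simp: I_def a'_def b'_def PiE_iff mem_Times_iff)
    then have "rational_box U (a' f, b' f)"
      using that assms(2) by (auto simp: rational_box_def I_def)
    then show ?thesis by (rule rboxesI)
  qed
  \<comment> \<open>The degenerate box is empty; adding it makes the countable family nonempty, so
    that it is the range of a sequence even if \<open>V\<close> is empty.\<close>
  have "rational_box U (0, 0)" by (simp add: rational_box_def)
  from rboxesI[OF this] have e: "{} \<in> rboxes U" by simp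
  let ?C = "insert {} ((\<lambda>f. box (a' f) (b' f)) ` I)"
  have "countable I"
    unfolding I_def by (rule countable_subset[of _ "Basis \<rightarrow>\<^sub>E \<rat> \<times> \<rat>"])
       (auto intro!: countable_PiE countable_SIGMA countable_rat)
  then have "countable ?C" by simp
  then obtain B :: "nat \<Rightarrow> 'c set" where B: "range B = ?C"
    using uncountable_def by (metis insert_not_empty)
  show ?thesis
  proof (rule that)
    have "(\<Union>i. B i) = \<Union>?C" unfolding B ..
    then show "V = (\<Union>i. B i)" using V by simp
    fix i
    have "B i \<in> ?C" using B by blast
    then show "B i \<in> rboxes U" using r e by auto
  qed
qed

lemma approximable_rboxes: "B \<in> rboxes U \<Longrightarrow> approximable U (indicator B)"
  using approximable_rational_box by (auto elim!: rboxesE)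

lemma rboxes_sets: "B \<in> rboxes U \<Longrightarrow> B \<in> sets borel \<and> B \<subseteq> U"
  using subsetD[OF rboxes_subset, of B U] by (auto elim!: rboxesE)

text \<open>Inclusion-exclusion for one more box involves the intersection of the earlier union with
  that box. The induction therefore carries intersections with an arbitrary box along.\<close>

lemma approximable_finite_union:
  assumes "\<And>i. B i \<in> rboxes U"
  shows "approximable U (indicator (\<Union>i<n::nat. B i)) \<and>
    (\<forall>C\<in>rboxes U. approximable U (indicator ((\<Union>i<n. B i) \<inter> C)))"
proof (induction n)
  case 0
  then show ?case using approximable_zero by (simp add: indicator_def)
next
  case (Suc n)
  let ?E = "\<Union>i<n. B i"
  have 1: "indicator (\<Union>i<Suc n. B i) = (\<lambda>x. indicator ?E x + indicator (B n) x - indicator (?E \<inter> B n) x :: real)"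
    by (auto simp: fun_eq_iff indicator_def lessThan_Suc)
  have 2: "indicator ((\<Union>i<Suc n. B i) \<inter> C) = (\<lambda>x. indicator (?E \<inter> C) x + indicator (B n \<inter> C) x - indicator (?E \<inter> (B n \<inter> C)) x :: real)" for C
    by (auto simp: fun_eq_iff indicator_def lessThan_Suc)
  show ?case
    unfolding 1 2 using Suc assms
    by (intro conjI ballI approximable_diff approximable_add) (auto intro: approximable_rboxes rboxes_Int)
qed

lemma approximable_open:
  assumes "open V" "V \<subseteq> U"
  shows "approximable U (indicator V)"
proof -
  obtain B where B: "V = (\<Union>i::nat. B i)" "\<And>i. B i \<in> rboxes U"
    using open_rboxes[OF assms] by metis
  show ?thesis
  proof (rule approximable_indicator_limit)
    show "approximable U (indicator (\<Union>i<n. B i))" for n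
      using approximable_finite_union[of B n] B(2) by blast
    show "(\<lambda>n. indicator (\<Union>i<n. B i) x) \<longlonglongrightarrow> indicator V x" for x
      unfolding B(1) by (rule LIMSEQ_indicator_UN)
  qed (use assms borel_sets_lebesgue_on in \<open>auto simp: indicator_def\<close>)
qed

lemma borel_sigma_sets_rboxes:
  assumes "E \<in> sets borel" "E \<subseteq> U"
  shows "E \<in> sigma_sets U (rboxes U)"
proof -
  interpret sigma_algebra U "sigma_sets U (rboxes U)"
    by (rule sigma_algebra_sigma_sets[OF rboxes_subset])
  have "E \<inter> U \<in> sigma_sets U (rboxes U)" if "E \<in> sigma_sets UNIV {S. open S}" for E
    using that
  proof induction
    case (Basic V)
    then have "open (V \<inter> U)" "V \<inter> U \<subseteq> U" using U by auto
    then obtain B where B: "V \<inter> U = (\<Union>i::nat. B i)" "\<And>i. B i \<in> rboxes U"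
      using open_rboxes by metis
    then show ?case by (auto intro: sigma_sets.Union sigma_sets.Basic)
  next
    case (Compl E)
    have "(UNIV - E) \<inter> U = U - (E \<inter> U)" by auto
    with Compl show ?case by (auto intro: sigma_sets.Compl)
  next
    case (Union E)
    have "(\<Union>i. E i) \<inter> U = (\<Union>i. E i \<inter> U)" by auto
    moreover have "(\<Union>i. E i \<inter> U) \<in> sigma_sets U (rboxes U)"
      using Union by (intro sigma_sets.Union)
    ultimately show ?case by (simp only:)
  qed auto
  from this[of E] assms show ?thesis by (simp add: sets_borel Int_absorb2)
qed

lemma sigma_sets_rboxes_borel:
  assumes "E \<in> sigma_sets U (rboxes U)"
  shows "E \<in> sets (lebesgue_on U)"
  using assms
proof induction
  case (Basic B)
  then show ?case using borel_sets_lebesgue_on rboxes_sets by blast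
next
  case (Compl E)
  then show ?case using sets.compl_sets[of E "lebesgue_on U"] by simp
qed auto

lemma approximable_borel_set:
  assumes "E \<in> sets borel" "E \<subseteq> U"
  shows "approximable U (indicator E)"
proof -
  have "Int_stable (rboxes U)" using rboxes_Int unfolding Int_stable_def by blast
  moreover note rboxes_subset
  ultimately show ?thesis
    using borel_sigma_sets_rboxes[OF assms]
  proof (induction rule: sigma_sets_induct_disjoint)
    case (basic A)
    then show ?case by (rule approximable_rboxes)
  next
    case empty
    then show ?case using approximable_zero by (simp add: indicator_def)
  next
    case (compl A)
    have "A \<subseteq> U" using sigma_sets_into_sp[OF rboxes_subset compl(1)] .
    then have "indicator (U - A) = (\<lambda>x. indicator U x - indicator A x :: real)"
      by (auto simp: fun_eq_iff indicator_def)
    then show ?case using approximable_diff[OF approximable_open[OF U(1)] compl(2)] by simp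
  next
    case (union A)
    show ?case
    proof (rule approximable_indicator_limit)
      have eq: "(\<Sum>i<n. indicator (A i) x) = (indicator (\<Union>i<n. A i) x :: real)" for n x
        by (rule indicator_UN_disjoint[symmetric]) (use union(1) in \<open>auto simp: disjoint_family_on_def\<close>)
      show "approximable U (indicator (\<Union>i<n. A i))" for n
        using approximable_sum[of "{..<n}" "\<lambda>i. indicator (A i)"] union(3) by (simp add: eq)
      show "(\<lambda>n. indicator (\<Union>i<n. A i) x) \<longlonglongrightarrow> indicator (\<Union>i. A i) x" for x
        by (rule LIMSEQ_indicator_UN)
      have "A i \<in> sets (lebesgue_on U)" for i
        using union(2) sigma_sets_rboxes_borel by blast
      then show "(\<Union>i. A i) \<in> sets (lebesgue_on U)" by auto
    qed (auto simp: indicator_def)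
  qed
qed

lemma approximable_set:
  assumes "E \<in> sets (lebesgue_on U)"
  shows "approximable U (indicator E)"
proof -
  have "E \<subseteq> U" "E \<in> sets lebesgue"
    using assms U(1) by (auto simp: sets_restrict_space_iff dest: sets.sets_into_space)
  then obtain S N N' where E: "E = S \<union> N" "N \<subseteq> N'" "N' \<in> null_sets lborel" "S \<in> sets lborel"
    by (meson sets_completionE)
  show ?thesis
  proof (rule approximable_cong)
    show "approximable U (indicator S)"
      by (rule approximable_borel_set) (use E \<open>E \<subseteq> U\<close> in auto)
    show "indicator E \<in> borel_measurable (lebesgue_on U)" using assms by simp
    have "AE x in lebesgue. x \<notin> N'" by (intro AE_completion AE_not_in E)
    then show "AE x in lebesgue_on U. indicator S x = (indicator E x :: real)"
      using U(1) by (subst AE_restrict_space_iff) (auto elim!: eventually_mono simp: E indicator_def dest: subsetD[OF E(2)])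
  qed
qed

lemma L2_approximable:
  assumes "L2 U h"
  shows "approximable U h"
proof -
  have sp: "space (lebesgue_on U) = U" by simp
  obtain F where F': "\<forall>i. simple_function (lebesgue_on U) (F i)"
    "\<forall>x\<in>U. (\<lambda>i. F i x) \<longlonglongrightarrow> h x" "\<forall>i. \<forall>x\<in>U. dist (F i x) 0 \<le> 2 * dist (h x) 0"
    using borel_measurable_implies_sequence_metric[OF L2_measurable[OF assms], of 0] unfolding sp by blast
  then have F: "\<And>i. simple_function (lebesgue_on U) (F i)"
    "\<And>x. x \<in> U \<Longrightarrow> (\<lambda>i. F i x) \<longlonglongrightarrow> h x" "\<And>i x. x \<in> U \<Longrightarrow> dist (F i x) 0 \<le> 2 * dist (h x) 0"
    by blast+
  show ?thesis
  proof (rule approximable_limit)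
    show "approximable U (F n)" for n
    proof (rule approximable_cong)
      let ?I = "F n ` space (lebesgue_on U)"
      show "approximable U (\<lambda>x. \<Sum>y\<in>?I. y * indicator (F n -` {y} \<inter> space (lebesgue_on U)) x)"
        using F(1)[of n] by (intro approximable_sum approximable_cmult approximable_set) (auto simp: simple_function_def)
      show "AE x in lebesgue_on U. (\<Sum>y\<in>?I. y * indicator (F n -` {y} \<inter> space (lebesgue_on U)) x) = F n x"
      proof (rule AE_I2)
        fix x assume x: "x \<in> space (lebesgue_on U)"
        have "(\<Sum>y\<in>?I. y * indicator (F n -` {y} \<inter> space (lebesgue_on U)) x)
            = (\<Sum>y\<in>?I. indicator (F n -` {y} \<inter> space (lebesgue_on U)) x *\<^sub>R y)"
          by (intro sum.cong refl) simp
        also have "\<dots> = F n x"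
          by (rule simple_function_indicator_representation_banach[OF F(1) x, symmetric])
        finally show "(\<Sum>y\<in>?I. y * indicator (F n -` {y} \<inter> space (lebesgue_on U)) x) = F n x" .
      qed
      show "F n \<in> borel_measurable (lebesgue_on U)" using F(1) by (rule borel_measurable_simple_function)
    qed
    show "(\<lambda>n. l2norm U (\<lambda>x. h x - F n x)) \<longlonglongrightarrow> 0"
    proof (rule l2norm_dominated_convergence)
      \<comment> \<open>The simple functions are bounded by twice |h|, hence their distance to
        \<open>h\<close> by three times |h|.\<close>
      show "L2 U (\<lambda>x. 3 * \<bar>h x\<bar>)"
        using assms by (auto simp: L2_def power_mult_distrib)
      show "\<bar>h x - F n x\<bar> \<le> 3 * \<bar>h x\<bar>" if "x \<in> U" for n x
        using F(3)[OF that, of n] by (simp add: dist_real_def)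
    qed (use F assms in \<open>auto intro: borel_measurable_simple_function L2_measurable\<close>)
  qed fact
qed

lemma bump_span_dense:
  assumes "L2 U h" "e > 0"
  obtains p where "p \<in> bump_span U" "l2norm U (\<lambda>x. h x - p x) < e"
  using L2_approximable[OF assms(1)] assms(2) unfolding approximable_def by blast

text \<open>By density some \<open>p\<close> in the span is within e of \<open>h\<close>;
  orthogonality gives that the squared norm of \<open>h\<close> is the integral of h (h - p), at
  most e times the norm of \<open>h\<close>. Testing only with a countable family is what makes
  sections tractable later.\<close>

lemma AE_zero_if_orthogonal_bumps:
  assumes "L2 U h" "\<And>\<phi>. \<phi> \<in> bumps U \<Longrightarrow> (\<integral>x. h x * \<phi> x \<partial>lebesgue_on U) = 0"
  shows "AE x in lebesgue_on U. h x = 0"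
proof -
  have 0: "(\<integral>x. h x * p x \<partial>lebesgue_on U) = 0" if "p \<in> bump_span U" for p
    using that
  proof induction
    case (step \<phi> p c)
    have "integrable (lebesgue_on U) (\<lambda>x. h x * \<phi> x)" "integrable (lebesgue_on U) (\<lambda>x. h x * p x)"
      using assms(1) step test_fun_L2[OF bumps_test_fun U] bump_span_L2 by (auto intro: L2_mult_integrable)
    then show ?case
      using step assms(2)[OF step(1)] by (simp add: distrib_left mult.left_commute[of _ c])
  qed auto
  have "l2norm U h \<le> e" if "e > 0" for e
  proof -
    obtain p where p: "p \<in> bump_span U" "l2norm U (\<lambda>x. h x - p x) < e"
      using bump_span_dense[OF assms(1) \<open>e > 0\<close>] by blast
    note pL = bump_span_L2[OF p(1)]
    have "(l2norm U h)\<^sup>2 = (\<integral>x. h x * (h x - p x) \<partial>lebesgue_on U)"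
      using L2_mult_integrable[OF assms(1) pL] L2_mult_integrable[OF assms(1) assms(1)] 0[OF p(1)]
      by (simp add: l2norm_sq right_diff_distrib flip: power2_eq_square)
    also have "\<dots> \<le> l2norm U h * l2norm U (\<lambda>x. h x - p x)"
      using L2_Cauchy_Schwarz[OF assms(1) L2_diff[OF assms(1) pL]] by linarith
    also have "\<dots> \<le> l2norm U h * e" using p(2) by (intro mult_left_mono) auto
    finally have "l2norm U h * l2norm U h \<le> l2norm U h * e" by (simp add: power2_eq_square)
    then show ?thesis using that l2norm_nonneg[of U h] by (cases "l2norm U h = 0") (auto simp: mult_le_cancel_left)
  qed
  then have "l2norm U h = 0"
    by (meson field_le_epsilon l2norm_nonneg add_0 order_antisym dense_ge)
  then show ?thesis using l2norm_eq_0_iff[OF assms(1)] by simp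
qed

lemma AE_eq_if_weak_pderiv_bumps:
  assumes "L2 U w" "L2 U w'"
    and "\<And>\<phi>. \<phi> \<in> bumps U \<Longrightarrow> (\<integral>x. w x * \<phi> x \<partial>lebesgue_on U) = (\<integral>x. w' x * \<phi> x \<partial>lebesgue_on U)"
  shows "AE x in lebesgue_on U. w x = w' x"
proof -
  have "AE x in lebesgue_on U. w x - w' x = 0"
  proof (rule AE_zero_if_orthogonal_bumps)
    fix \<phi> assume \<phi>: "\<phi> \<in> bumps U"
    have "L2 U \<phi>" using test_fun_L2[OF bumps_test_fun[OF \<phi>] U] .
    then show "(\<integral>x. (w x - w' x) * \<phi> x \<partial>lebesgue_on U) = 0"
      using assms(3)[OF \<phi>] L2_mult_integrable[OF assms(1)] L2_mult_integrable[OF assms(2)] by (simp add: left_diff_distrib)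
  qed (intro L2_diff assms)
  then show ?thesis by simp
qed

lemma weak_pderiv_unique:
  assumes "weak_pderiv U e u w" "weak_pderiv U e u w'" "L2 U w" "L2 U w'"
  shows "AE x in lebesgue_on U. w x = w' x"
proof (rule AE_eq_if_weak_pderiv_bumps[OF assms(3,4)])
  fix \<phi> assume "\<phi> \<in> bumps U"
  then have "test_fun U \<phi>" by (rule bumps_test_fun)
  with assms(1,2) show "(\<integral>x. w x * \<phi> x \<partial>lebesgue_on U) = (\<integral>x. w' x * \<phi> x \<partial>lebesgue_on U)"
    unfolding weak_pderiv_def by (metis neg_equal_iff_equal)
qed

end

subsection \<open>Weak derivatives of tensor products\<close>

lemma weak_pderivD:
  assumes "weak_pderiv U e u w" "test_fun U \<phi>"
  shows "integrable (lebesgue_on U) (\<lambda>x. u x * pd e \<phi> x)" "integrable (lebesgue_on U) (\<lambda>x. w x * \<phi> x)"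
    "(\<integral>x. u x * pd e \<phi> x \<partial>lebesgue_on U) = - (\<integral>x. w x * \<phi> x \<partial>lebesgue_on U)"
  using assms unfolding weak_pderiv_def by auto

lemma weak_pderivI_L2:
  assumes "open U" "bounded U" "L2 U u" "L2 U w"
    and "\<And>\<phi>. test_fun U \<phi> \<Longrightarrow>
      (\<integral>x. u x * pd e \<phi> x \<partial>lebesgue_on U) = - (\<integral>x. w x * \<phi> x \<partial>lebesgue_on U)"
  shows "weak_pderiv U e u w"
  unfolding weak_pderiv_def
  using assms test_fun_L2[OF _ assms(1,2)] test_fun_pd by (blast intro: L2_mult_integrable)

text \<open>For fixed y the section of \<phi> is a test function in the first variable alone, so the
  one-factor identity applies under the y-integral and Fubini puts it together.\<close>

lemma weak_pderiv_tensor_fst: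
  assumes S: "open S" "bounded S" and T: "open T" "bounded T"
    and u: "L2 S u" "L2 S u'" and p: "L2 T p" and "weak_pderiv S e u u'"
  shows "weak_pderiv (S \<times> T) (e, 0) (\<lambda>x. u (fst x) * p (snd x)) (\<lambda>x. u' (fst x) * p (snd x))"
proof (rule weak_pderivI_L2)
  note ST = open_Times[OF S(1) T(1)] bounded_Times[OF S(2) T(2)]
  show "open (S \<times> T)" "bounded (S \<times> T)" by (fact ST)+
  show L: "L2 (S \<times> T) (\<lambda>x. u (fst x) * p (snd x))" "L2 (S \<times> T) (\<lambda>x. u' (fst x) * p (snd x))"
    by (intro L2_tensor u p S T)+
  fix \<phi> assume \<phi>: "test_fun (S \<times> T) \<phi>"
  have i: "integrable (lebesgue_on (S \<times> T)) (\<lambda>x. u (fst x) * p (snd x) * pd (e, 0) \<phi> x)"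
    "integrable (lebesgue_on (S \<times> T)) (\<lambda>x. u' (fst x) * p (snd x) * \<phi> x)"
    by (intro L2_mult_integrable L test_fun_L2[OF \<phi> ST] test_fun_L2[OF test_fun_pd[OF \<phi>] ST])+
  have "(\<integral>x. u x * p y * pd (e, 0) \<phi> (x, y) \<partial>lebesgue_on S) = - (\<integral>x. u' x * p y * \<phi> (x, y) \<partial>lebesgue_on S)" for y
    using weak_pderivD(3)[OF assms(8) test_fun_section_fst[OF \<phi>, of y]]
      integral_mult_right_zero[of "lebesgue_on S" "p y" "\<lambda>x. u x * pd (e, 0) \<phi> (x, y)"]
      integral_mult_right_zero[of "lebesgue_on S" "p y" "\<lambda>x. u' x * \<phi> (x, y)"]
    by (simp add: pd_section_fst[OF \<phi>] ac_simps)
  then show "(\<integral>x. u (fst x) * p (snd x) * pd (e, 0) \<phi> x \<partial>lebesgue_on (S \<times> T))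
      = - (\<integral>x. u' (fst x) * p (snd x) * \<phi> x \<partial>lebesgue_on (S \<times> T))"
    by (simp add: integral_section_fst[OF i(1) S(1) T(1)] integral_section_fst[OF i(2) S(1) T(1)])
qed

lemma weak_pderiv_tensor_snd:
  assumes S: "open S" "bounded S" and T: "open T" "bounded T"
    and u: "L2 S u" and p: "L2 T p" "L2 T p'" and "weak_pderiv T e p p'"
  shows "weak_pderiv (S \<times> T) (0, e) (\<lambda>x. u (fst x) * p (snd x)) (\<lambda>x. u (fst x) * p' (snd x))"
proof (rule weak_pderivI_L2)
  note ST = open_Times[OF S(1) T(1)] bounded_Times[OF S(2) T(2)]
  show "open (S \<times> T)" "bounded (S \<times> T)" by (fact ST)+
  show L: "L2 (S \<times> T) (\<lambda>x. u (fst x) * p (snd x))" "L2 (S \<times> T) (\<lambda>x. u (fst x) * p' (snd x))"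
    by (intro L2_tensor u p S T)+
  fix \<phi> assume \<phi>: "test_fun (S \<times> T) \<phi>"
  have i: "integrable (lebesgue_on (S \<times> T)) (\<lambda>x. u (fst x) * p (snd x) * pd (0, e) \<phi> x)"
    "integrable (lebesgue_on (S \<times> T)) (\<lambda>x. u (fst x) * p' (snd x) * \<phi> x)"
    by (intro L2_mult_integrable L test_fun_L2[OF \<phi> ST] test_fun_L2[OF test_fun_pd[OF \<phi>] ST])+
  have "(\<integral>y. u x * p y * pd (0, e) \<phi> (x, y) \<partial>lebesgue_on T) = - (\<integral>y. u x * p' y * \<phi> (x, y) \<partial>lebesgue_on T)" for x
    using weak_pderivD(3)[OF assms(8) test_fun_section_snd[OF \<phi>, of x]]
    by (simp add: pd_section_snd[OF \<phi>] mult.assoc)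
  then show "(\<integral>x. u (fst x) * p (snd x) * pd (0, e) \<phi> x \<partial>lebesgue_on (S \<times> T))
      = - (\<integral>x. u (fst x) * p' (snd x) * \<phi> x \<partial>lebesgue_on (S \<times> T))"
    by (simp add: integral_section_snd[OF i(1) S(1) T(1)] integral_section_snd[OF i(2) S(1) T(1)])
qed

text \<open>The first-order identity is tested with \<open>pd e2 \<phi>\<close>, itself a test
  function; its left side is then the one of the second-order identity.\<close>

lemma weak_pderiv2_weak_pderiv:
  assumes "weak_pderiv U e1 u w" "weak_pderiv2 U e1 e2 u w2" "L2 U w" "L2 U w2" "open U" "bounded U"
  shows "weak_pderiv U e2 w w2"
proof (rule weak_pderivI_L2)
  fix \<phi> assume \<phi>: "test_fun U \<phi>"
  show "(\<integral>x. w x * pd e2 \<phi> x \<partial>lebesgue_on U) = - (\<integral>x. w2 x * \<phi> x \<partial>lebesgue_on U)"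
    using weak_pderivD(3)[OF assms(1) test_fun_pd[OF \<phi>, of e2]] assms(2) \<phi>
    unfolding weak_pderiv2_def by auto
qed (use assms in auto)

subsection \<open>The product rule\<close>

text \<open>Covers translations and point reflections, c = 1 and c = -1. Both occur because a kernel
  \<rho>(x - y) is integrated in x as well as in y.\<close>

lemma lborel_distr_isometric_affine:
  assumes "\<bar>c\<bar> = 1"
  shows "distr lborel borel (\<lambda>x. t + c *\<^sub>R x) = (lborel :: 'a::euclidean_space measure)"
proof -
  have "(lborel :: 'a measure) = density (distr lborel borel (\<lambda>x. t + c *\<^sub>R x)) (\<lambda>_. \<bar>c\<bar> ^ DIM('a))"
    by (rule lborel_affine) (use assms in auto)
  then show ?thesis using assms by (simp add: density_1)
qed

lemma smooth_fun_borel: "smooth_fun f \<Longrightarrow> f \<in> borel_measurable borel"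
  by (intro borel_measurable_continuous_onI smooth_fun_continuous)

lemma lebesgue_integral_isometric_affine:
  fixes f :: "'a::euclidean_space \<Rightarrow> real"
  assumes "f \<in> borel_measurable borel" "\<bar>c\<bar> = 1"
  shows "(\<integral>x. f (t + c *\<^sub>R x) \<partial>lebesgue) = (\<integral>x. f x \<partial>lebesgue)"
proof -
  have "(\<integral>x. f x \<partial>lborel) = (\<integral>x. f x \<partial>distr lborel borel (\<lambda>x. t + c *\<^sub>R x))"
    by (simp add: lborel_distr_isometric_affine[OF assms(2)])
  also have "\<dots> = (\<integral>x. f (t + c *\<^sub>R x) \<partial>lborel)"
    using assms(1) by (intro integral_distr) auto
  finally show ?thesis using assms(1) by (simp add: integral_completion)
qed

section \<open>Mollifiers\<close>

definition mollifier :: "real \<Rightarrow> ('c::euclidean_space \<Rightarrow> real) \<Rightarrow> bool" where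
  "mollifier d \<rho> \<longleftrightarrow> test_fun (ball 0 d) \<rho> \<and> (\<forall>x. \<rho> x \<ge> 0) \<and> (\<integral>x. \<rho> x \<partial>lebesgue) = 1"

text \<open>The integrals of the bumps on a small box around 0 converge to its volume, so one of
  them is positive and can be normalised.\<close>

lemma mollifier_exists:
  assumes "d > 0"
  obtains \<rho> :: "'c::euclidean_space \<Rightarrow> real" where "mollifier d \<rho>"
proof -
  obtain a b :: 'c where ab: "0 \<in> box a b" "box a b \<subseteq> ball 0 d"
    using rational_boxes[OF assms, of "0::'c"] by blast
  have bm: "bump a b n \<in> borel_measurable lborel" for n
    using smooth_fun_borel[OF smooth_fun_bump] by simp
  have fin: "integrable lborel (indicator (box a b) :: 'c \<Rightarrow> real)"
    by (simp add: emeasure_lborel_box_eq integrable_indicator_iff)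
  have "(\<lambda>n. \<integral>x. bump a b (Suc n) x \<partial>lborel) \<longlonglongrightarrow> (\<integral>x. indicator (box a b) x \<partial>lborel)"
  proof (rule integral_dominated_convergence[OF _ bm fin])
    show "AE x in lborel. (\<lambda>n. bump a b (Suc n) x) \<longlonglongrightarrow> indicator (box a b) x"
      by (intro AE_I2 LIMSEQ_Suc bump_tendsto)
    have "\<bar>bump a b (Suc n) x\<bar> \<le> indicator (box a b) x" for n x
    proof (cases "x \<in> box a b")
      case False
      have "test_fun (box a b) (bump a b (Suc n))" by (rule test_fun_bump) auto
      from test_fun_eq_0[OF this False] have "bump a b (Suc n) x = 0" .
      then show ?thesis by simp
    qed (use bump_bounds[of a b "Suc n" x] in simp)
    then show "AE x in lborel. norm (bump a b (Suc n) x) \<le> indicator (box a b) x" for n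
      by simp
  qed simp
  moreover have "(\<integral>x. indicator (box a b) x \<partial>lborel) > (0::real)"
    using ab(1) by (auto simp: content_eq_0 mem_box measure_lborel_box_eq intro!: prod_pos dest: less_trans simp: inner_diff_left less_imp_le)
  ultimately have "\<forall>\<^sub>F n in sequentially. (\<integral>x. bump a b (Suc n) x \<partial>lborel) > 0"
    by (rule order_tendstoD(1))
  then obtain n where n: "(\<integral>x. bump a b (Suc n) x \<partial>lborel) > 0"
    by (auto simp: eventually_sequentially)
  define c where "c = inverse (\<integral>x. bump a b (Suc n) x \<partial>lborel)"
  have "mollifier d (\<lambda>x. c * bump a b (Suc n) x)"
    unfolding mollifier_def
  proof (intro conjI allI)
    show "test_fun (ball 0 d) (\<lambda>x. c * bump a b (Suc n) x)"
      by (intro test_fun_cmult test_fun_bump ab) simp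
    show "c * bump a b (Suc n) x \<ge> 0" for x
      using n by (auto simp: c_def bump_bounds)
    show "(\<integral>x. c * bump a b (Suc n) x \<partial>lebesgue) = 1"
      using n bm by (simp add: integral_completion c_def)
  qed
  then show ?thesis by (rule that)
qed

lemma
  assumes "mollifier d \<rho>" "open U"
  shows mollifier_integral_le: "\<bar>s\<bar> = 1 \<Longrightarrow> (\<integral>x. \<rho> (t + s *\<^sub>R x) \<partial>lebesgue_on U) \<le> 1"
    and mollifier_integral_eq: "ball x d \<subseteq> U \<Longrightarrow> (\<integral>y. \<rho> (x - y) \<partial>lebesgue_on U) = 1"
proof -
  have \<rho>: "test_fun (ball 0 d) \<rho>" "\<And>x. \<rho> x \<ge> 0" "(\<integral>x. \<rho> x \<partial>lebesgue) = 1"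
    using assms by (auto simp: mollifier_def)
  note bm = smooth_fun_borel[OF test_funD(1)[OF \<rho>(1)]]
  have one: "(\<integral>x. \<rho> (t + s *\<^sub>R x) \<partial>lebesgue) = 1" if "\<bar>s\<bar> = 1" for t s
    using lebesgue_integral_isometric_affine[OF bm that] \<rho>(3) by simp
  \<comment> \<open>The Bochner integral of a non-integrable function is 0 by convention, so an
    integral equal to 1 proves integrability.\<close>
  then have int: "integrable lebesgue (\<lambda>x. \<rho> (t + s *\<^sub>R x))" if "\<bar>s\<bar> = 1" for t s
    using that not_integrable_integral_eq by fastforce
  show "(\<integral>x. \<rho> (t + s *\<^sub>R x) \<partial>lebesgue_on U) \<le> 1" if s: "\<bar>s\<bar> = 1"
  proof -
    have "(\<integral>x. indicator U x * \<rho> (t + s *\<^sub>R x) \<partial>lebesgue) \<le> (\<integral>x. \<rho> (t + s *\<^sub>R x) \<partial>lebesgue)"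
    proof (rule integral_mono)
      show "integrable lebesgue (\<lambda>x. indicator U x * \<rho> (t + s *\<^sub>R x))"
        using integrable_mult_indicator[OF open_lebesgue[OF assms(2)] int[OF s]] by simp
    qed (use int[OF s] \<rho>(2) in \<open>auto simp: indicator_def\<close>)
    then show ?thesis using one[OF s] by (simp add: integral_lebesgue_on[OF open_lebesgue[OF assms(2)]])
  qed
  assume "ball x d \<subseteq> U"
  have z: "\<rho> z = 0" if "z \<notin> ball 0 d" for z
    using test_fun_eq_0[OF \<rho>(1) that] .
  have eq: "indicator U y * \<rho> (x - y) = \<rho> (x - y)" for y
  proof (cases "y \<in> U")
    case False
    then have "y \<notin> ball x d" using \<open>ball x d \<subseteq> U\<close> by blast
    then have "x - y \<notin> ball 0 d" by (simp add: dist_norm norm_minus_commute)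
    then show ?thesis using z by simp
  qed simp
  show "(\<integral>y. \<rho> (x - y) \<partial>lebesgue_on U) = 1"
    using one[of "-1" x] unfolding integral_lebesgue_on[OF open_lebesgue[OF assms(2)]] eq by simp
qed

section \<open>Smoothing with a kernel\<close>

context
  fixes U :: "'c::euclidean_space set"
  assumes U: "open U" "bounded U"
begin

text \<open>The pairing of F with the convolution of k and g, both variables restricted to U. As a
  double integral it can be read either as F against a smoothed g or as g against a smoothed
  F.\<close>

definition kernel_integral :: "('c \<Rightarrow> real) \<Rightarrow> ('c \<Rightarrow> real) \<Rightarrow> ('c \<Rightarrow> real) \<Rightarrow> real" where
  "kernel_integral k F g = (\<integral>z. F (fst z) * g (snd z) * k (fst z - snd z) \<partial>lebesgue_on (U \<times> U))"

lemma kernel_integrable: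
  assumes "test_fun V k" "L2 U F" "L2 U g"
  shows "integrable (lebesgue_on (U \<times> U)) (\<lambda>z. F (fst z) * g (snd z) * k (fst z - snd z))"
proof -
  note UU = open_Times[OF U(1) U(1)] bounded_Times[OF U(2) U(2)]
  obtain M where M: "\<And>x. \<bar>k x\<bar> \<le> M" using test_fun_bounded[OF assms(1)] by metis
  have "bounded_linear (\<lambda>z::'c \<times> 'c. fst z - snd z)"
    by (intro bounded_linear_sub bounded_linear_fst bounded_linear_snd)
  from smooth_fun_affine[OF test_funD(1)[OF assms(1)] this, of 0]
  have "smooth_fun (\<lambda>z. k (fst z - snd z))" by simp
  then have "(\<lambda>z. k (fst z - snd z)) \<in> borel_measurable (lebesgue_on (U \<times> U))"
    by (rule smooth_fun_measurable)
  from L2_bounded[OF UU this M] show ?thesis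
    by (intro L2_mult_integrable L2_tensor assms U)
qed

lemma kernel_integral_fst:
  assumes "test_fun V k" "L2 U F" "L2 U g"
  shows "kernel_integral k F g = (\<integral>x. F x * (\<integral>y. g y * k (x - y) \<partial>lebesgue_on U) \<partial>lebesgue_on U)"
  unfolding kernel_integral_def integral_section_snd[OF kernel_integrable[OF assms] U(1) U(1)]
  by (simp add: mult.assoc)

lemma kernel_integral_snd:
  assumes "test_fun V k" "L2 U F" "L2 U g"
  shows "kernel_integral k F g = (\<integral>y. g y * (\<integral>x. F x * k (x - y) \<partial>lebesgue_on U) \<partial>lebesgue_on U)"
  unfolding kernel_integral_def integral_section_fst[OF kernel_integrable[OF assms] U(1) U(1)]
  by (simp flip: integral_mult_right_zero add: ac_simps)

text \<open>The smoothed F stays below M because the mollifier has mass at most 1. The bound is the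
  same for all radii d, which allows g to be replaced by a test function before d is chosen.\<close>

lemma kernel_integral_bound:
  assumes \<rho>: "mollifier d \<rho>" and F: "L2 U F" "AE x in lebesgue_on U. \<bar>F x\<bar> \<le> M" "M \<ge> 0" and h: "L2 U h"
  shows "\<bar>kernel_integral \<rho> F h\<bar> \<le> M * (\<integral>y. \<bar>h y\<bar> \<partial>lebesgue_on U)"
proof -
  have t: "test_fun (ball 0 d) \<rho>" and nn: "\<And>x. \<rho> x \<ge> 0" using \<rho> by (auto simp: mollifier_def)
  have tr: "smooth_fun (\<lambda>x. \<rho> (- y + 1 *\<^sub>R x))" for y
    by (rule smooth_fun_affine[OF test_funD(1)[OF t] bounded_linear_scaleR_right])
  obtain R where R: "\<And>x. \<bar>\<rho> x\<bar> \<le> R" using test_fun_bounded[OF t] by metis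
  have L: "L2 U (\<lambda>x. \<rho> (x - y))" for y
    using L2_bounded[OF U smooth_fun_measurable[OF tr[of y]] R] by simp
  have in_le: "\<bar>\<integral>x. F x * \<rho> (x - y) \<partial>lebesgue_on U\<bar> \<le> M" for y
  proof -
    have "\<bar>\<integral>x. F x * \<rho> (x - y) \<partial>lebesgue_on U\<bar> \<le> (\<integral>x. \<bar>F x * \<rho> (x - y)\<bar> \<partial>lebesgue_on U)"
      by (rule integral_abs_bound)
    also have "\<dots> \<le> (\<integral>x. M * \<rho> (x - y) \<partial>lebesgue_on U)"
    proof (rule integral_mono_AE)
      show "AE x in lebesgue_on U. \<bar>F x * \<rho> (x - y)\<bar> \<le> M * \<rho> (x - y)"
        using F(2) by eventually_elim (simp add: abs_mult nn mult_right_mono)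
      show "integrable (lebesgue_on U) (\<lambda>x. \<bar>F x * \<rho> (x - y)\<bar>)"
        using L2_mult_integrable[OF F(1) L] by (rule integrable_abs)
      show "integrable (lebesgue_on U) (\<lambda>x. M * \<rho> (x - y))"
        using L2_integrable[OF L U] by simp
    qed
    also have "\<dots> = M * (\<integral>x. \<rho> (- y + 1 *\<^sub>R x) \<partial>lebesgue_on U)" by simp
    also have "\<dots> \<le> M * 1"
      by (intro mult_left_mono mollifier_integral_le[OF \<rho> U(1)] F) simp
    finally show ?thesis by simp
  qed
  have "\<bar>kernel_integral \<rho> F h\<bar> \<le> (\<integral>y. \<bar>h y * (\<integral>x. F x * \<rho> (x - y) \<partial>lebesgue_on U)\<bar> \<partial>lebesgue_on U)"
    unfolding kernel_integral_snd[OF t F(1) h] by (rule integral_abs_bound)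
  also have "\<dots> \<le> (\<integral>y. M * \<bar>h y\<bar> \<partial>lebesgue_on U)"
  proof (rule integral_mono)
    have "integrable (lebesgue_on U) (\<lambda>y. h y * (\<integral>x. F x * \<rho> (x - y) \<partial>lebesgue_on U))"
      using integrable_section_fst[OF kernel_integrable[OF t F(1) h] U(1) U(1)]
      by (simp flip: integral_mult_right_zero add: ac_simps)
    then show "integrable (lebesgue_on U) (\<lambda>y. \<bar>h y * (\<integral>x. F x * \<rho> (x - y) \<partial>lebesgue_on U)\<bar>)"
      by (rule integrable_abs)
    show "integrable (lebesgue_on U) (\<lambda>y. M * \<bar>h y\<bar>)"
      using L2_integrable[OF h U] by simp
    show "\<bar>h y * (\<integral>x. F x * \<rho> (x - y) \<partial>lebesgue_on U)\<bar> \<le> M * \<bar>h y\<bar>" for y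
      using mult_left_mono[OF in_le abs_ge_zero, of "h y"] by (simp add: abs_mult mult.commute)
  qed
  finally show ?thesis by simp
qed

lemma kernel_integral_diff:
  assumes "test_fun V k" "L2 U F" "L2 U g" "L2 U p"
  shows "kernel_integral k F (\<lambda>x. g x - p x) = kernel_integral k F g - kernel_integral k F p"
  using kernel_integrable[OF assms(1,2,3)] kernel_integrable[OF assms(1,2,4)]
  unfolding kernel_integral_def by (simp add: algebra_simps)

lemma L1_le_l2norm:
  assumes "L2 U h"
  shows "(\<integral>y. \<bar>h y\<bar> \<partial>lebesgue_on U) \<le> l2norm U (\<lambda>x. 1) * l2norm U h"
proof -
  have 1: "L2 U (\<lambda>x. 1)" by (rule L2_bounded[OF U, of _ 1]) auto
  have a: "L2 U (\<lambda>x. \<bar>h x\<bar>)" using assms by (auto simp: L2_def)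
  have "l2norm U (\<lambda>x. \<bar>h x\<bar>) = l2norm U h" by (simp add: l2norm_def)
  then show ?thesis using L2_Cauchy_Schwarz[OF 1 a] by simp
qed

text \<open>Two conditions on d: below r the ball around a point of K stays in U, so the mollifier
  keeps its full mass 1; below s uniform continuity bounds the oscillation of p on the ball by e.
  Outside K the factor F vanishes.\<close>

lemma kernel_integral_approx_test:
  assumes K: "compact K" "K \<subseteq> U" and F: "L2 U F" "\<And>x. x \<notin> K \<Longrightarrow> F x = 0"
    and p: "test_fun U p" and e: "e > 0"
  obtains d0 where "d0 > 0" "\<And>d \<rho>. d \<le> d0 \<Longrightarrow> mollifier d \<rho> \<Longrightarrow>
    \<bar>kernel_integral \<rho> F p - (\<integral>x. F x * p x \<partial>lebesgue_on U)\<bar> \<le> e * (\<integral>x. \<bar>F x\<bar> \<partial>lebesgue_on U)"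
proof -
  obtain r where r: "r > 0" "(\<Union>x\<in>K. ball x r) \<subseteq> U"
    using compact_subset_open_imp_ball_epsilon_subset[OF K(1) U(1) K(2)] .
  have "compact (closure U)" using U(2) by (simp add: compact_closure)
  then have "uniformly_continuous_on (closure U) p"
    by (intro compact_uniformly_continuous smooth_fun_continuous test_funD[OF p])
  then obtain s where s: "s > 0" "\<And>x y. x \<in> closure U \<Longrightarrow> y \<in> closure U \<Longrightarrow> dist y x < s \<Longrightarrow> dist (p y) (p x) < e"
    using e unfolding uniformly_continuous_on_def by metis
  show ?thesis
  proof (rule that[of "min r s"])
    show "min r s > 0" using r s by simp
    fix d and \<rho> :: "'c \<Rightarrow> real" assume d: "d \<le> min r s" and \<rho>: "mollifier d \<rho>"
    have t: "test_fun (ball 0 d) \<rho>" and nn: "\<And>x. \<rho> x \<ge> 0" using \<rho> by (auto simp: mollifier_def)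
    have pL: "L2 U p" by (rule test_fun_L2[OF p U])
    obtain R where R: "\<And>x. \<bar>\<rho> x\<bar> \<le> R" using test_fun_bounded[OF t] by metis
    have tr: "smooth_fun (\<lambda>y. \<rho> (x + (-1) *\<^sub>R y))" for x
      by (rule smooth_fun_affine[OF test_funD(1)[OF t] bounded_linear_scaleR_right])
    have L: "L2 U (\<lambda>y. \<rho> (x - y))" for x
      using L2_bounded[OF U smooth_fun_measurable[OF tr[of x]] R] by simp
    have *: "\<bar>(\<integral>y. p y * \<rho> (x - y) \<partial>lebesgue_on U) - p x\<bar> \<le> e" if x: "x \<in> K" for x
    proof -
      have "ball x d \<subseteq> ball x r" using d by (simp add: subset_ball)
      then have bU: "ball x d \<subseteq> U" using r(2) x by blast
      have one: "(\<integral>y. \<rho> (x - y) \<partial>lebesgue_on U) = 1" by (rule mollifier_integral_eq[OF \<rho> U(1) bU])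
      have i1: "integrable (lebesgue_on U) (\<lambda>y. p y * \<rho> (x - y))" by (rule L2_mult_integrable[OF pL L])
      have i2: "integrable (lebesgue_on U) (\<lambda>y. \<rho> (x - y))" by (rule L2_integrable[OF L U])
      have "(\<integral>y. p y * \<rho> (x - y) \<partial>lebesgue_on U) - p x = (\<integral>y. (p y - p x) * \<rho> (x - y) \<partial>lebesgue_on U)"
        using i1 i2 one by (simp add: left_diff_distrib)
      also have "\<bar>\<dots>\<bar> \<le> (\<integral>y. \<bar>(p y - p x) * \<rho> (x - y)\<bar> \<partial>lebesgue_on U)"
        by (rule integral_abs_bound)
      also have "\<dots> \<le> (\<integral>y. e * \<rho> (x - y) \<partial>lebesgue_on U)"
      proof (rule integral_mono)
        show "integrable (lebesgue_on U) (\<lambda>y. \<bar>(p y - p x) * \<rho> (x - y)\<bar>)"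
          using i1 i2 by (simp add: left_diff_distrib)
        show "integrable (lebesgue_on U) (\<lambda>y. e * \<rho> (x - y))" using i2 by simp
        fix y assume "y \<in> space (lebesgue_on U)"
        then have y: "y \<in> U" by simp
        show "\<bar>(p y - p x) * \<rho> (x - y)\<bar> \<le> e * \<rho> (x - y)"
        proof (cases "x - y \<in> ball 0 d")
          case True
          then have "dist y x < s" using d by (simp add: dist_norm norm_minus_commute)
          then have "dist (p y) (p x) < e"
            using s(2) x y K(2) closure_subset[of U] by blast
          then show ?thesis
            by (simp add: abs_mult nn dist_real_def mult_right_mono)
        next
          case False
          then have "\<rho> (x - y) = 0" by (rule test_fun_eq_0[OF t])
          then show ?thesis by simp
        qed
      qed
      also have "\<dots> = e" using one by simp
      finally show ?thesis .
    qed
    have i1: "integrable (lebesgue_on U) (\<lambda>x. F x * (\<integral>y. p y * \<rho> (x - y) \<partial>lebesgue_on U))"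
      using integrable_section_snd[OF kernel_integrable[OF t F(1) pL] U(1) U(1)]
      by (simp add: mult.assoc)
    have i2: "integrable (lebesgue_on U) (\<lambda>x. F x * p x)" by (rule L2_mult_integrable[OF F(1) pL])
    have "kernel_integral \<rho> F p - (\<integral>x. F x * p x \<partial>lebesgue_on U)
      = (\<integral>x. F x * ((\<integral>y. p y * \<rho> (x - y) \<partial>lebesgue_on U) - p x) \<partial>lebesgue_on U)"
      unfolding kernel_integral_fst[OF t F(1) pL] using i1 i2 by (simp add: right_diff_distrib)
    also have "\<bar>\<dots>\<bar> \<le> (\<integral>x. \<bar>F x * ((\<integral>y. p y * \<rho> (x - y) \<partial>lebesgue_on U) - p x)\<bar> \<partial>lebesgue_on U)"
      by (rule integral_abs_bound)
    also have "\<dots> \<le> (\<integral>x. e * \<bar>F x\<bar> \<partial>lebesgue_on U)"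
    proof (rule integral_mono)
      show "integrable (lebesgue_on U) (\<lambda>x. \<bar>F x * ((\<integral>y. p y * \<rho> (x - y) \<partial>lebesgue_on U) - p x)\<bar>)"
        using i1 i2 by (simp add: right_diff_distrib)
      show "integrable (lebesgue_on U) (\<lambda>x. e * \<bar>F x\<bar>)" using L2_integrable[OF F(1) U] by simp
      show "\<bar>F x * ((\<integral>y. p y * \<rho> (x - y) \<partial>lebesgue_on U) - p x)\<bar> \<le> e * \<bar>F x\<bar>" for x
        using mult_left_mono[OF *[of x] abs_ge_zero, of "F x"] F(2)[of x]
        by (cases "x \<in> K") (auto simp: abs_mult mult.commute)
    qed
    finally show "\<bar>kernel_integral \<rho> F p - (\<integral>x. F x * p x \<partial>lebesgue_on U)\<bar> \<le> e * (\<integral>x. \<bar>F x\<bar> \<partial>lebesgue_on U)"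
      by simp
  qed
qed

lemma kernel_integral_approx:
  assumes K: "compact K" "K \<subseteq> U" and F: "L2 U F" "\<And>x. x \<notin> K \<Longrightarrow> F x = 0"
    and M: "AE x in lebesgue_on U. \<bar>F x\<bar> \<le> M"
    and g: "L2 U g" and e: "e > 0"
  obtains d0 where "d0 > 0" "\<And>d \<rho>. d \<le> d0 \<Longrightarrow> mollifier d \<rho> \<Longrightarrow>
    \<bar>kernel_integral \<rho> F g - (\<integral>x. F x * g x \<partial>lebesgue_on U)\<bar> \<le> e"
proof -
  define N where "N = max M 0"
  have N: "N \<ge> 0" "AE x in lebesgue_on U. \<bar>F x\<bar> \<le> N"
    using M by (auto simp: N_def elim: eventually_mono)
  \<comment> \<open>\<open>c\<close> collects the factors of the distance between \<open>g\<close>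
    and \<open>p\<close> in the two errors of replacing \<open>g\<close> by \<open>p\<close>, one in
    the kernel integral and one in the limit. The summand 1 here and in \<open>I\<close> only
    guarantees positive denominators.\<close>
  define c where "c = N * l2norm U (\<lambda>x. 1) + l2norm U F + 1"
  have c: "c > 0" using N by (simp add: c_def add_nonneg_pos)
  define I where "I = (\<integral>x. \<bar>F x\<bar> \<partial>lebesgue_on U) + 1"
  have I: "I > 0" by (simp add: I_def add_nonneg_pos)
  have "e / (2 * c) > 0" using e c by simp
  from bump_span_dense[OF U g this] obtain p where p: "p \<in> bump_span U" "l2norm U (\<lambda>x. g x - p x) < e / (2 * c)" .
  note pt = bump_span_test_fun[OF p(1)]
  note pL = test_fun_L2[OF pt U]
  have "e / (2 * I) > 0" using e I by simp
  from kernel_integral_approx_test[OF K F pt this] obtain d0 where d0: "d0 > 0" "\<And>d \<rho>. d \<le> d0 \<Longrightarrow> mollifier d \<rho> \<Longrightarrow>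
    \<bar>kernel_integral \<rho> F p - (\<integral>x. F x * p x \<partial>lebesgue_on U)\<bar> \<le> e / (2 * I) * (\<integral>x. \<bar>F x\<bar> \<partial>lebesgue_on U)"
    by blast
  show ?thesis
  proof (rule that[OF d0(1)])
    fix d and \<rho> :: "'c \<Rightarrow> real" assume d: "d \<le> d0" and \<rho>: "mollifier d \<rho>"
    have t: "test_fun (ball 0 d) \<rho>" using \<rho> by (auto simp: mollifier_def)
    have gp: "L2 U (\<lambda>x. g x - p x)" by (rule L2_diff[OF g pL])
    have "\<bar>kernel_integral \<rho> F g - kernel_integral \<rho> F p\<bar> \<le> N * (\<integral>x. \<bar>g x - p x\<bar> \<partial>lebesgue_on U)"
      using kernel_integral_bound[OF \<rho> F(1) N(2) N(1) gp] kernel_integral_diff[OF t F(1) g pL] by simp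
    also have "\<dots> \<le> N * (l2norm U (\<lambda>x. 1) * l2norm U (\<lambda>x. g x - p x))"
      by (intro mult_left_mono L1_le_l2norm gp N)
    finally have 1: "\<bar>kernel_integral \<rho> F g - kernel_integral \<rho> F p\<bar> \<le> N * l2norm U (\<lambda>x. 1) * l2norm U (\<lambda>x. g x - p x)"
      by (simp add: mult.assoc)
    have "(\<integral>x. F x * g x \<partial>lebesgue_on U) - (\<integral>x. F x * p x \<partial>lebesgue_on U) = (\<integral>x. F x * (g x - p x) \<partial>lebesgue_on U)"
      using L2_mult_integrable[OF F(1) g] L2_mult_integrable[OF F(1) pL] by (simp add: right_diff_distrib)
    then have 2: "\<bar>(\<integral>x. F x * g x \<partial>lebesgue_on U) - (\<integral>x. F x * p x \<partial>lebesgue_on U)\<bar> \<le> l2norm U F * l2norm U (\<lambda>x. g x - p x)"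
      using L2_Cauchy_Schwarz[OF F(1) gp] by simp
    have "(\<integral>x. \<bar>F x\<bar> \<partial>lebesgue_on U) \<le> I" by (simp add: I_def)
    then have le: "e / (2 * I) * (\<integral>x. \<bar>F x\<bar> \<partial>lebesgue_on U) \<le> e / (2 * I) * I"
      using e I by (intro mult_left_mono) auto
    have 3: "\<bar>kernel_integral \<rho> F p - (\<integral>x. F x * p x \<partial>lebesgue_on U)\<bar> \<le> e / 2"
      using order_trans[OF d0(2)[OF d \<rho>] le] I by simp
    have "N * l2norm U (\<lambda>x. 1) * l2norm U (\<lambda>x. g x - p x) + l2norm U F * l2norm U (\<lambda>x. g x - p x)
        \<le> c * l2norm U (\<lambda>x. g x - p x)"
      by (simp add: c_def distrib_right)
    also have "\<dots> \<le> e / 2" using p(2) c by (simp add: field_simps)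
    finally show "\<bar>kernel_integral \<rho> F g - (\<integral>x. F x * g x \<partial>lebesgue_on U)\<bar> \<le> e"
      using 1 2 3 by linarith
  qed
qed

text \<open>The product rule after mollification: differentiate \<open>x \<mapsto> \<rho> (x - y) * \<phi> x\<close> against \<open>a\<close> and
  \<open>y \<mapsto> \<rho> (x - y)\<close> against \<open>g\<close>; both are test functions, so no convolution has to be differentiated.\<close>
lemma kernel_integral_product_rule:
  assumes a: "weak_pderiv U e a a'" "L2 U (\<lambda>x. a x * \<phi> x)" "L2 U (\<lambda>x. a' x * \<phi> x)" "L2 U (\<lambda>x. a x * pd e \<phi> x)"
    and g: "weak_pderiv U e g g'" "L2 U g" "L2 U g'"
    and \<phi>: "test_fun U \<phi>" and K: "\<And>x. x \<in> K \<Longrightarrow> ball x d \<subseteq> U" "\<And>x. x \<notin> K \<Longrightarrow> \<phi> x = 0"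
    and t: "test_fun (ball 0 d) \<rho>"
  shows "kernel_integral \<rho> (\<lambda>x. a x * pd e \<phi> x) g + kernel_integral \<rho> (\<lambda>x. a x * \<phi> x) g'
    = - kernel_integral \<rho> (\<lambda>x. a' x * \<phi> x) g"
proof -
  note sm = test_funD(1)[OF t]
  note td = test_fun_pd[OF t, of e]
  have z: "\<rho> z = 0" if "z \<notin> ball 0 d" for z
    using test_fun_eq_0[OF t that] .
  obtain C where C: "compact C" "C \<subseteq> ball 0 d" "\<And>x. x \<notin> C \<Longrightarrow> \<rho> x = 0"
    using test_fun_support[OF t] by metis
  have aff1: "smooth_fun (\<lambda>x. \<rho> (x - y))" "pd e (\<lambda>x. \<rho> (x - y)) x = pd e \<rho> (x - y)" for y x
    using smooth_fun_affine[OF sm bounded_linear_ident, of "- y"] pd_affine[OF sm bounded_linear_ident, of e "- y" x]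
    by simp_all
  have blm: "bounded_linear (\<lambda>y::'c. - y)" by (intro bounded_linear_minus bounded_linear_ident)
  have aff2: "smooth_fun (\<lambda>y. \<rho> (x - y))" "pd e (\<lambda>y. \<rho> (x - y)) y = - pd e \<rho> (x - y)" for y x
  proof -
    show "smooth_fun (\<lambda>y. \<rho> (x - y))" using smooth_fun_affine[OF sm blm, of x] by simp
    have "pd (- e) \<rho> z = - pd e \<rho> z" for z
      using linear_neg[OF bounded_linear.linear[OF has_derivative_bounded_linear[OF smooth_has_derivative[OF sm, of z]]], of e] .
    then show "pd e (\<lambda>y. \<rho> (x - y)) y = - pd e \<rho> (x - y)"
      using pd_affine[OF sm blm, of e x y] by simp
  qed
  \<comment> \<open>The derivative in x, for each fixed y, with \<open>g\<close> as a weight in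
    y.\<close>
  have A: "kernel_integral \<rho> (\<lambda>x. a x * pd e \<phi> x) g + kernel_integral (pd e \<rho>) (\<lambda>x. a x * \<phi> x) g
      = - kernel_integral \<rho> (\<lambda>x. a' x * \<phi> x) g"
  proof -
    have tf: "test_fun U (\<lambda>x. \<rho> (x - y) * \<phi> x)" for y
      by (rule test_fun_mult_right[OF aff1(1) \<phi>])
    have pdt: "pd e (\<lambda>x. \<rho> (x - y) * \<phi> x) x = \<rho> (x - y) * pd e \<phi> x + pd e \<rho> (x - y) * \<phi> x" for x y
      using pd_mult[OF aff1(1) test_funD(1)[OF \<phi>]] by (simp add: aff1(2))
    have L: "L2 U (\<lambda>x. k (x - y))" if "test_fun V k" for k y V
    proof -
      obtain R where R: "\<And>x. \<bar>k x\<bar> \<le> R" using test_fun_bounded[OF \<open>test_fun V k\<close>] by metis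
      have "smooth_fun (\<lambda>x. k (x - y))"
        using smooth_fun_affine[OF test_funD(1)[OF that] bounded_linear_ident, of "- y"] by simp
      from L2_bounded[OF U smooth_fun_measurable[OF this] R] show ?thesis .
    qed
    have inner: "(\<integral>x. a x * pd e \<phi> x * \<rho> (x - y) \<partial>lebesgue_on U) + (\<integral>x. a x * \<phi> x * pd e \<rho> (x - y) \<partial>lebesgue_on U)
        = - (\<integral>x. a' x * \<phi> x * \<rho> (x - y) \<partial>lebesgue_on U)" for y
    proof -
      have i1: "integrable (lebesgue_on U) (\<lambda>x. a x * pd e \<phi> x * \<rho> (x - y))" by (intro L2_mult_integrable a L[OF t])
      have i2: "integrable (lebesgue_on U) (\<lambda>x. a x * \<phi> x * pd e \<rho> (x - y))" by (intro L2_mult_integrable a L[OF td])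
      have "(\<integral>x. a x * pd e \<phi> x * \<rho> (x - y) + a x * \<phi> x * pd e \<rho> (x - y) \<partial>lebesgue_on U)
          = - (\<integral>x. a' x * (\<rho> (x - y) * \<phi> x) \<partial>lebesgue_on U)"
        using weak_pderivD(3)[OF a(1) tf[of y]] unfolding pdt by (simp add: algebra_simps)
      then show ?thesis using i1 i2 by (simp add: ac_simps)
    qed
    have j: "integrable (lebesgue_on U) (\<lambda>y. g y * (\<integral>x. F x * k (x - y) \<partial>lebesgue_on U))"
      if "test_fun V k" "L2 U F" for k F V
      using integrable_section_fst[OF kernel_integrable[OF that g(2)] U(1) U(1)]
      by (simp flip: integral_mult_right_zero add: ac_simps)
    have "kernel_integral \<rho> (\<lambda>x. a x * pd e \<phi> x) g + kernel_integral (pd e \<rho>) (\<lambda>x. a x * \<phi> x) g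
      = (\<integral>y. g y * (\<integral>x. a x * pd e \<phi> x * \<rho> (x - y) \<partial>lebesgue_on U) + g y * (\<integral>x. a x * \<phi> x * pd e \<rho> (x - y) \<partial>lebesgue_on U) \<partial>lebesgue_on U)"
      unfolding kernel_integral_snd[OF t a(4) g(2)] kernel_integral_snd[OF td a(2) g(2)]
      by (rule Bochner_Integration.integral_add[symmetric]) (intro j[OF t] j[OF td] a)+
    also have "\<dots> = (\<integral>y. - (g y * (\<integral>x. a' x * \<phi> x * \<rho> (x - y) \<partial>lebesgue_on U)) \<partial>lebesgue_on U)"
      by (simp only: inner mult_minus_right flip: distrib_left)
    finally show ?thesis
      unfolding kernel_integral_snd[OF t a(3) g(2)] by simp
  qed
  \<comment> \<open>The derivative in y for fixed x. Differentiating \<rho>(x - y) in y produces a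
    minus sign, which cancels the one of the weak derivative. For x in \<open>K\<close> the ball
    lies in U and \<rho>(x - y) is a test function of y; for other x both sides vanish with
    \<phi>.\<close>
  have B: "kernel_integral (pd e \<rho>) (\<lambda>x. a x * \<phi> x) g = kernel_integral \<rho> (\<lambda>x. a x * \<phi> x) g'"
  proof -
    have "a x * \<phi> x * (\<integral>y. g y * pd e \<rho> (x - y) \<partial>lebesgue_on U) = a x * \<phi> x * (\<integral>y. g' y * \<rho> (x - y) \<partial>lebesgue_on U)" for x
    proof (cases "x \<in> K")
      case True
      have "test_fun U (\<lambda>y. \<rho> (x - y))"
      proof (rule test_funI[OF aff2(1)])
        show "compact ((\<lambda>z. x - z) ` C)"
          by (intro compact_continuous_image C continuous_intros)
        show "(\<lambda>z. x - z) ` C \<subseteq> U"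
        proof
          fix w assume "w \<in> (\<lambda>z. x - z) ` C"
          then obtain zz where "zz \<in> C" "w = x - zz" by auto
          then have "w \<in> ball x d" using C(2) by (auto simp: dist_norm)
          then show "w \<in> U" using K(1)[OF True] by blast
        qed
        show "\<rho> (x - y) = 0" if "y \<notin> (\<lambda>z. x - z) ` C" for y
        proof (rule C(3))
          show "x - y \<notin> C" using that by (metis add_diff_cancel_left' diff_add_cancel image_eqI diff_diff_eq2)
        qed
      qed
      from weak_pderivD(3)[OF g(1) this] show ?thesis by (simp add: aff2(2))
    qed (use K(2) in simp)
    then show ?thesis
      unfolding kernel_integral_fst[OF td a(2) g(2)] kernel_integral_fst[OF t a(2) g(3)] by (simp only:)
  qed
  show ?thesis using A unfolding B .
qed

text \<open>Neither factor is smooth, so the rule is taken from its mollified form by letting the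
  radius tend to 0. This is how the coefficients of A are differentiated in div(A grad u).\<close>

lemma weak_pderiv_mult:
  assumes a: "Linf U a" "Linf U a'" "weak_pderiv U e a a'"
    and g: "L2 U g" "L2 U g'" "weak_pderiv U e g g'"
  shows "weak_pderiv U e (\<lambda>x. a x * g x) (\<lambda>x. a' x * g x + a x * g' x)"
proof (rule weak_pderivI_L2[OF U])
  obtain M where M: "a \<in> borel_measurable (lebesgue_on U)" "AE x in lebesgue_on U. \<bar>a x\<bar> \<le> M"
    using a(1) by (auto simp: Linf_def)
  obtain M' where M': "a' \<in> borel_measurable (lebesgue_on U)" "AE x in lebesgue_on U. \<bar>a' x\<bar> \<le> M'"
    using a(2) by (auto simp: Linf_def)
  have L: "L2 U (\<lambda>x. a x * h x)" "L2 U (\<lambda>x. a' x * h x)" if "L2 U h" for h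
    using L2_bounded_mult(1)[OF that M] L2_bounded_mult(1)[OF that M'] by auto
  show "L2 U (\<lambda>x. a x * g x)" "L2 U (\<lambda>x. a' x * g x + a x * g' x)"
    by (intro L2_add L g)+
  fix \<phi> assume \<phi>: "test_fun U \<phi>"
  note \<phi>L = test_fun_L2[OF \<phi> U] and d\<phi>L = test_fun_L2[OF test_fun_pd[OF \<phi>, of e] U]
  obtain K where K: "compact K" "K \<subseteq> U" "\<And>x. x \<notin> K \<Longrightarrow> \<phi> x = 0" "\<And>e x. x \<notin> K \<Longrightarrow> pd e \<phi> x = 0"
    using test_fun_support[OF \<phi>] by metis
  obtain R where R: "\<And>x. \<bar>\<phi> x\<bar> \<le> R" using test_fun_bounded[OF \<phi>] by metis
  obtain R' where R': "\<And>x. \<bar>pd e \<phi> x\<bar> \<le> R'" using test_fun_bounded[OF test_fun_pd[OF \<phi>]] by metis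
  have bd: "AE x in lebesgue_on U. \<bar>b x * f x\<bar> \<le> B * r"
    if "AE x in lebesgue_on U. \<bar>b x\<bar> \<le> B" "\<And>x. \<bar>f x\<bar> \<le> r" for b f :: "'c \<Rightarrow> real" and B r
    using that(1)
  proof eventually_elim
    case (elim x)
    then show ?case unfolding abs_mult using that(2)[of x] by (intro mult_mono) auto
  qed
  obtain r where r: "r > 0" "(\<Union>x\<in>K. ball x r) \<subseteq> U"
    using compact_subset_open_imp_ball_epsilon_subset[OF K(1) U(1) K(2)] .
  define X where "X = (\<integral>x. a x * pd e \<phi> x * g x \<partial>lebesgue_on U)"
  define Y where "Y = (\<integral>x. a x * \<phi> x * g' x \<partial>lebesgue_on U)"
  define Z where "Z = (\<integral>x. a' x * \<phi> x * g x \<partial>lebesgue_on U)"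
  \<comment> \<open>\<open>X + Y + Z\<close> is the claimed identity with all terms on one side. The
    corresponding mollified sum is exactly 0, so three approximations within e' / 3 suffice.\<close>
  have "\<bar>X + Y + Z\<bar> \<le> e'" if "e' > 0" for e'
  proof -
    have e3: "e' / 3 > 0" using that by simp
    obtain d1 where d1: "d1 > 0" "\<And>d \<rho>. d \<le> d1 \<Longrightarrow> mollifier d \<rho> \<Longrightarrow> \<bar>kernel_integral \<rho> (\<lambda>x. a x * pd e \<phi> x) g - X\<bar> \<le> e' / 3"
      using kernel_integral_approx[OF K(1,2) L(1)[OF d\<phi>L] _ bd[OF M(2) R'] g(1) e3] K(4) unfolding X_def by auto
    obtain d2 where d2: "d2 > 0" "\<And>d \<rho>. d \<le> d2 \<Longrightarrow> mollifier d \<rho> \<Longrightarrow> \<bar>kernel_integral \<rho> (\<lambda>x. a x * \<phi> x) g' - Y\<bar> \<le> e' / 3"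
      using kernel_integral_approx[OF K(1,2) L(1)[OF \<phi>L] _ bd[OF M(2) R] g(2) e3] K(3) unfolding Y_def by auto
    obtain d3 where d3: "d3 > 0" "\<And>d \<rho>. d \<le> d3 \<Longrightarrow> mollifier d \<rho> \<Longrightarrow> \<bar>kernel_integral \<rho> (\<lambda>x. a' x * \<phi> x) g - Z\<bar> \<le> e' / 3"
      using kernel_integral_approx[OF K(1,2) L(2)[OF \<phi>L] _ bd[OF M'(2) R] g(1) e3] K(3) unfolding Z_def by auto
    define d where "d = Min {d1, d2, d3, r}"
    have d: "d > 0" "d \<le> d1" "d \<le> d2" "d \<le> d3" "d \<le> r" using d1 d2 d3 r by (auto simp: d_def)
    obtain \<rho> :: "'c \<Rightarrow> real" where \<rho>: "mollifier d \<rho>" using mollifier_exists[OF d(1)] .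
    have KU: "ball x d \<subseteq> U" if "x \<in> K" for x
      using r(2) subset_ball[OF d(5), of x] that by blast
    have "kernel_integral \<rho> (\<lambda>x. a x * pd e \<phi> x) g + kernel_integral \<rho> (\<lambda>x. a x * \<phi> x) g'
        = - kernel_integral \<rho> (\<lambda>x. a' x * \<phi> x) g"
      by (rule kernel_integral_product_rule[OF a(3) L(1)[OF \<phi>L] L(2)[OF \<phi>L] L(1)[OF d\<phi>L] g(3,1,2) \<phi> KU K(3)])
         (use \<rho> in \<open>auto simp: mollifier_def\<close>)
    then show ?thesis
      using d1(2)[OF d(2) \<rho>] d2(2)[OF d(3) \<rho>] d3(2)[OF d(4) \<rho>] by linarith
  qed
  then have "\<bar>X + Y + Z\<bar> \<le> 0" by (rule field_le_epsilon[of _ 0, simplified])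
  then have "X = - (Z + Y)" by simp
  moreover have "(\<integral>x. a x * g x * pd e \<phi> x \<partial>lebesgue_on U) = X" by (simp add: X_def ac_simps)
  moreover have "(\<integral>x. (a' x * g x + a x * g' x) * \<phi> x \<partial>lebesgue_on U) = Z + Y"
    using L2_mult_integrable[OF L(2)[OF \<phi>L] g(1)] L2_mult_integrable[OF L(1)[OF \<phi>L] g(2)]
    by (simp add: Z_def Y_def algebra_simps flip: Bochner_Integration.integral_add)
  ultimately show "(\<integral>x. a x * g x * pd e \<phi> x \<partial>lebesgue_on U) = - (\<integral>x. (a' x * g x + a x * g' x) * \<phi> x \<partial>lebesgue_on U)"
    by simp
qed

end

subsection \<open>Comparison of contraction semigroups\<close>

abbreviation l2dist :: "'c::euclidean_space set \<Rightarrow> ('c \<Rightarrow> real) \<Rightarrow> ('c \<Rightarrow> real) \<Rightarrow> real" where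
  "l2dist U u v \<equiv> l2norm U (\<lambda>x. u x - v x)"

text \<open>With slope K + e, the points s of [0, t] where d s is at most (K + e) s form a compact
  set containing 0. If its largest element were below t, the step hypothesis would produce a larger
  one.\<close>

lemma Dini_bound:
  fixes d :: "real \<Rightarrow> real"
  assumes cont: "continuous_on {0..} d" and "d 0 \<le> 0"
    and step: "\<And>t e. t \<ge> 0 \<Longrightarrow> e > 0 \<Longrightarrow> \<exists>\<delta>>0. \<forall>h. 0 < h \<and> h < \<delta> \<longrightarrow> d (t + h) \<le> d t + h * (K + e)"
    and "t \<ge> 0"
  shows "d t \<le> K * t"
proof (rule field_le_epsilon)
  fix e' :: real assume "e' > 0"
  \<comment> \<open>The extra error e * t stays below \<open>e'\<close>, and the denominator is
    positive also for t = 0.\<close>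
  define e where "e = e' / (t + 1)"
  have e: "e > 0" using \<open>e' > 0\<close> \<open>t \<ge> 0\<close> by (simp add: e_def)
  let ?A = "{s\<in>{0..t}. d s - (K + e) * s \<in> {..0}}"
  have "continuous_on {0..t} (\<lambda>s. d s - (K + e) * s)"
    by (intro continuous_intros continuous_on_subset[OF cont]) auto
  then have "closed ?A"
    using continuous_closed_preimage[of "{0..t}" "\<lambda>s. d s - (K + e) * s" "{..0}"]
    by (simp add: vimage_def Int_def)
  moreover have "bounded ?A"
    by (rule bounded_subset[OF bounded_closed_interval[of 0 t]]) auto
  ultimately have "compact ?A" by (simp add: compact_eq_bounded_closed)
  moreover have "0 \<in> ?A" using assms(2,4) by simp
  ultimately obtain s where s: "s \<in> ?A" "\<And>r. r \<in> ?A \<Longrightarrow> r \<le> s"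
    using compact_attains_sup[of ?A] by blast
  have "s = t"
  proof (rule ccontr)
    assume "s \<noteq> t"
    then have "s < t" using s(1) by simp
    obtain \<delta> where \<delta>: "\<delta> > 0" "\<And>h. 0 < h \<Longrightarrow> h < \<delta> \<Longrightarrow> d (s + h) \<le> d s + h * (K + e)"
      using step[of s e] s(1) e by auto
    define h where "h = min (\<delta> / 2) (t - s)"
    have h: "0 < h" "h < \<delta>" "s + h \<le> t" using \<delta>(1) \<open>s < t\<close> by (auto simp: h_def min_def)
    have "d (s + h) - (K + e) * (s + h) \<le> d s - (K + e) * s"
      using \<delta>(2)[OF h(1,2)] by (simp add: algebra_simps)
    then have "s + h \<in> ?A" using s(1) h by auto
    from s(2)[OF this] h(1) show False by simp
  qed
  with s(1) have "d t \<le> K * t + e * t" by (simp add: algebra_simps)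
  also have "e * t \<le> e'" using \<open>t \<ge> 0\<close> \<open>e' > 0\<close> by (simp add: e_def field_simps)
  finally show "d t \<le> K * t + e'" by simp
qed

section \<open>Orbits and generator of a contraction semigroup\<close>

context
  fixes U :: "'c::euclidean_space set" and S Op
  assumes S: "C0_contraction_semigroup U S Op"
begin

lemma semigroup_L2: "t \<ge> 0 \<Longrightarrow> L2 U u \<Longrightarrow> L2 U (S t u)"
  using S[unfolded C0_contraction_semigroup_def, THEN conjunct1] by blast

lemma semigroup_linear:
  assumes "t \<ge> 0" "L2 U u" "L2 U v"
  shows "l2dist U (S t (\<lambda>y. a * u y + b * v y)) (\<lambda>x. a * S t u x + b * S t v x) = 0"
  using S[unfolded C0_contraction_semigroup_def, THEN conjunct2, THEN conjunct1] assms by blast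

lemma semigroup_contraction: "t \<ge> 0 \<Longrightarrow> L2 U u \<Longrightarrow> l2norm U (S t u) \<le> l2norm U u"
  using S[unfolded C0_contraction_semigroup_def, THEN conjunct2, THEN conjunct2, THEN conjunct1] by blast

lemma semigroup_0: "L2 U u \<Longrightarrow> l2dist U (S 0 u) u = 0"
  using S[unfolded C0_contraction_semigroup_def, THEN conjunct2, THEN conjunct2, THEN conjunct2, THEN conjunct1] by blast

lemma semigroup_plus: "t \<ge> 0 \<Longrightarrow> s \<ge> 0 \<Longrightarrow> L2 U u \<Longrightarrow> l2dist U (S (t + s) u) (S t (S s u)) = 0"
  using S[unfolded C0_contraction_semigroup_def, THEN conjunct2, THEN conjunct2, THEN conjunct2, THEN conjunct2, THEN conjunct1] by blast

lemma semigroup_continuous: "L2 U u \<Longrightarrow> ((\<lambda>t. l2dist U (S t u) u) \<longlongrightarrow> 0) (at_right 0)"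
  using S[unfolded C0_contraction_semigroup_def, THEN conjunct2, THEN conjunct2, THEN conjunct2, THEN conjunct2, THEN conjunct2, THEN conjunct1] by blast

lemma semigroup_generator_iff:
  "Op u f \<longleftrightarrow> L2 U u \<and> L2 U f \<and> ((\<lambda>h. l2norm U (\<lambda>x. (S h u x - u x) / h - f x)) \<longlongrightarrow> 0) (at_right 0)"
  using S[unfolded C0_contraction_semigroup_def, THEN conjunct2, THEN conjunct2, THEN conjunct2, THEN conjunct2, THEN conjunct2, THEN conjunct2] by blast

lemma semigroup_dist:
  assumes "t \<ge> 0" "L2 U u" "L2 U v"
  shows "l2dist U (S t u) (S t v) \<le> l2dist U u v"
proof -
  have "l2dist U (S t (\<lambda>y. u y - v y)) (\<lambda>x. S t u x - S t v x) = 0"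
    using semigroup_linear[OF assms, of 1 "-1"] by simp
  then have "l2dist U (S t u) (S t v) \<le> l2norm U (S t (\<lambda>y. u y - v y))"
    using l2norm_le_diff[of U "\<lambda>x. S t u x - S t v x" "S t (\<lambda>y. u y - v y)"] assms
    by (simp add: L2_diff semigroup_L2 l2norm_minus_commute[of _ "\<lambda>x. S t u x - S t v x"])
  also have "\<dots> \<le> l2dist U u v" by (rule semigroup_contraction[OF assms(1) L2_diff[OF assms(2,3)]])
  finally show ?thesis .
qed

lemma semigroup_orbit_dist:
  assumes "0 \<le> s" "s \<le> t" "L2 U u"
  shows "l2dist U (S t u) (S s u) \<le> l2dist U (S (t - s) u) u"
proof -
  have L: "L2 U (S t u)" "L2 U (S s u)" "L2 U (S (t - s) u)" "L2 U (S s (S (t - s) u))"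
    using assms by (simp_all add: semigroup_L2)
  have "l2dist U (S t u) (S s u) \<le> l2dist U (S t u) (S s (S (t - s) u)) + l2dist U (S s (S (t - s) u)) (S s u)"
    by (rule l2norm_triangle_diff[OF L(1,4,2)])
  also have "l2dist U (S t u) (S s (S (t - s) u)) = 0"
    using semigroup_plus[of s "t - s" u] assms by simp
  also have "l2dist U (S s (S (t - s) u)) (S s u) \<le> l2dist U (S (t - s) u) u"
    by (rule semigroup_dist[OF assms(1) L(3) assms(3)])
  finally show ?thesis by simp
qed

text \<open>By the semigroup law and contractivity the distance of two orbit points is at most the
  distance after the time difference from the start. Right continuity at 0 thus gives uniform
  continuity on the half-line.\<close>

lemma semigroup_orbit_continuous:
  assumes "L2 U u" "e > 0"
  obtains \<delta> where "\<delta> > 0" "\<And>s t. 0 \<le> s \<Longrightarrow> 0 \<le> t \<Longrightarrow> \<bar>s - t\<bar> < \<delta> \<Longrightarrow> l2dist U (S s u) (S t u) < e"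
proof -
  have "\<forall>\<^sub>F h in at_right 0. l2dist U (S h u) u < e"
    using semigroup_continuous[OF assms(1)] assms(2) by (rule order_tendstoD(2))
  then obtain \<delta> where \<delta>: "\<delta> > 0" "\<And>h. 0 < h \<Longrightarrow> h < \<delta> \<Longrightarrow> l2dist U (S h u) u < e"
    by (auto simp: eventually_at_right_field)
  have *: "l2dist U (S t u) (S s u) < e" if "0 \<le> s" "s \<le> t" "t - s < \<delta>" for s t
  proof (cases "s = t")
    case False
    then show ?thesis
      using semigroup_orbit_dist[OF that(1,2) assms(1)] \<delta>(2)[of "t - s"] that by simp
  qed (use assms(2) in simp)
  show ?thesis
  proof (rule that[OF \<delta>(1)])
    fix s t :: real assume st: "0 \<le> s" "0 \<le> t" "\<bar>s - t\<bar> < \<delta>"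
    show "l2dist U (S s u) (S t u) < e"
      using *[of s t] *[of t s] st l2norm_minus_commute[of U "S s u" "S t u"] by (cases "s \<le> t") auto
  qed
qed

lemma generator_L2: "Op u f \<Longrightarrow> L2 U u" "Op u f \<Longrightarrow> L2 U f"
  by (auto simp: semigroup_generator_iff)

lemma generator_step:
  assumes "Op u f" "e > 0"
  obtains \<delta> where "\<delta> > 0" "\<And>h. 0 < h \<Longrightarrow> h < \<delta> \<Longrightarrow> l2dist U (S h u) (\<lambda>x. u x + h * f x) \<le> h * e"
proof -
  have "((\<lambda>h. l2norm U (\<lambda>x. (S h u x - u x) / h - f x)) \<longlongrightarrow> 0) (at_right 0)"
    using assms(1) by (simp add: semigroup_generator_iff)
  then have "\<forall>\<^sub>F h in at_right 0. l2norm U (\<lambda>x. (S h u x - u x) / h - f x) < e"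
    using assms(2) by (rule order_tendstoD(2))
  then obtain \<delta> where \<delta>: "\<delta> > 0" "\<And>h. 0 < h \<Longrightarrow> h < \<delta> \<Longrightarrow> l2norm U (\<lambda>x. (S h u x - u x) / h - f x) < e"
    by (auto simp: eventually_at_right_field)
  show ?thesis
  proof (rule that[OF \<delta>(1)])
    fix h :: real assume h: "0 < h" "h < \<delta>"
    have "(\<lambda>x. S h u x - (u x + h * f x)) = (\<lambda>x. h * ((S h u x - u x) / h - f x))"
      using h by (auto simp: field_simps)
    then have "l2dist U (S h u) (\<lambda>x. u x + h * f x) = h * l2norm U (\<lambda>x. (S h u x - u x) / h - f x)"
      using l2norm_cmult[of U h] h by simp
    also have "\<dots> \<le> h * e" using \<delta>(2)[OF h] h by (intro mult_left_mono) auto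
    finally show "l2dist U (S h u) (\<lambda>x. u x + h * f x) \<le> h * e" .
  qed
qed

text \<open>\<open>S t\<close> commutes with the difference quotients and contracts them. The
  operators respect linearity and the semigroup law only up to null sets, so the commutation is
  assembled as an almost-everywhere identity.\<close>

lemma semigroup_generator:
  assumes "Op u f" "t \<ge> 0"
  shows "Op (S t u) (S t f)"
proof -
  note L = generator_L2[OF assms(1)]
  have LS: "L2 U (S t u)" "L2 U (S t f)" using L assms(2) by (simp_all add: semigroup_L2)
  have le: "l2norm U (\<lambda>x. (S h (S t u) x - S t u x) / h - S t f x) \<le> l2norm U (\<lambda>x. (S h u x - u x) / h - f x)"
    if h: "h > 0" for h
  proof -
    have Lh: "L2 U (S h u)" using L h by (simp add: semigroup_L2)
    have Lt: "L2 U (S t (S h u))" "L2 U (S h (S t u))" "L2 U (S (t + h) u)"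
      using L LS Lh h assms(2) by (simp_all add: semigroup_L2)
    define v where "v y = (1 / h) * (S h u y - u y) + (-1) * f y" for y
    have vL: "L2 U v" unfolding v_def[abs_def] by (intro L2_add L2_cmult L2_diff Lh L)
    have d1: "l2dist U (S t v) (\<lambda>x. (1 / h) * S t (\<lambda>y. S h u y - u y) x + (-1) * S t f x) = 0"
      unfolding v_def[abs_def] by (rule semigroup_linear[OF assms(2) L2_diff[OF Lh L(1)] L(2)])
    have d2: "l2dist U (S t (\<lambda>y. S h u y - u y)) (\<lambda>x. S t (S h u) x - S t u x) = 0"
      using semigroup_linear[OF assms(2) Lh L(1), of 1 "-1"] by simp
    have "l2dist U (S (h + t) u) (S h (S t u)) = 0" "l2dist U (S (t + h) u) (S t (S h u)) = 0"
      using semigroup_plus L h assms(2) by simp_all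
    then have "AE x in lebesgue_on U. S (h + t) u x - S h (S t u) x = 0" "AE x in lebesgue_on U. S (h + t) u x - S t (S h u) x = 0"
      using Lt by (auto simp: l2norm_eq_0_iff L2_diff add.commute)
    moreover have "AE x in lebesgue_on U. S t v x - ((1 / h) * S t (\<lambda>y. S h u y - u y) x + (-1) * S t f x) = 0"
      using d1 assms(2) vL Lh L by (subst (asm) l2norm_eq_0_iff) (auto intro!: L2_intros semigroup_L2)
    moreover have "AE x in lebesgue_on U. S t (\<lambda>y. S h u y - u y) x - (S t (S h u) x - S t u x) = 0"
      using d2 assms(2) vL Lh L by (subst (asm) l2norm_eq_0_iff) (auto intro!: L2_intros semigroup_L2)
    ultimately have ae: "AE x in lebesgue_on U. (S h (S t u) x - S t u x) / h - S t f x = S t v x"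
      by eventually_elim (simp add: field_simps)
    have "l2norm U (\<lambda>x. (S h (S t u) x - S t u x) / h - S t f x) = l2norm U (S t v)"
      by (rule l2norm_cong_AE[OF _ _ ae]) (use Lt LS vL assms(2) in \<open>auto intro!: L2_intros semigroup_L2\<close>)
    also have "\<dots> \<le> l2norm U v" by (rule semigroup_contraction[OF assms(2) vL])
    also have "v = (\<lambda>x. (S h u x - u x) / h - f x)" by (auto simp: v_def)
    finally show ?thesis .
  qed
  have "((\<lambda>h. l2norm U (\<lambda>x. (S h (S t u) x - S t u x) / h - S t f x)) \<longlongrightarrow> 0) (at_right 0)"
  proof (rule Lim_null_comparison)
    show "((\<lambda>h. l2norm U (\<lambda>x. (S h u x - u x) / h - f x)) \<longlongrightarrow> 0) (at_right 0)"
      using assms(1) by (simp add: semigroup_generator_iff)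
    show "\<forall>\<^sub>F h in at_right 0. norm (l2norm U (\<lambda>x. (S h (S t u) x - S t u x) / h - S t f x)) \<le> l2norm U (\<lambda>x. (S h u x - u x) / h - f x)"
      using eventually_at_right_less[of "0::real"] by eventually_elim (use le in simp)
  qed
  then show ?thesis using LS by (simp add: semigroup_generator_iff)
qed

end

text \<open>The upper right Dini derivative of \<open>\<lambda>t. l2dist U (S1 t (Q g)) (Q (S2 t g))\<close> is at most \<open>K\<close>,
  because \<open>S1 (t + h) (Q g)\<close> and \<open>Q (S2 (t + h) g)\<close> are compared through \<open>S1 h (Q (S2 t g))\<close>. This replaces
  the variation of constants formula and avoids vector-valued integrals.\<close>
lemma semigroup_comparison:
  assumes S1: "C0_contraction_semigroup U S1 Op1" and S2: "C0_contraction_semigroup U S2 Op2"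
    and QL: "\<And>u. L2 U u \<Longrightarrow> L2 U (Q u)"
    and Qlin: "\<And>u v a b. L2 U u \<Longrightarrow> L2 U v \<Longrightarrow>
      l2dist U (Q (\<lambda>x. a * u x + b * v x)) (\<lambda>x. a * Q u x + b * Q v x) = 0"
    and Qle: "\<And>u. L2 U u \<Longrightarrow> l2norm U (Q u) \<le> c * l2norm U u" and c: "c \<ge> 0"
    and g: "L2 U g"
    and gen: "\<And>t. t \<ge> 0 \<Longrightarrow> \<exists>w w1 f1 f2. l2dist U w (S2 t g) = 0 \<and> l2dist U w1 (Q w) = 0 \<and>
      Op1 w1 f1 \<and> Op2 w f2 \<and> l2dist U f1 (Q f2) \<le> K"
    and "t \<ge> 0"
  shows "l2dist U (S1 t (Q g)) (Q (S2 t g)) \<le> K * t"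
proof -
  note L1 = semigroup_L2[OF S1] and L2' = semigroup_L2[OF S2]
  have Qdist: "l2dist U (Q u) (Q v) \<le> c * l2dist U u v" if "L2 U u" "L2 U v" for u v
  proof -
    have "l2dist U (Q (\<lambda>x. u x - v x)) (\<lambda>x. Q u x - Q v x) = 0"
      using Qlin[OF that, of 1 "-1"] by simp
    then have "l2dist U (Q u) (Q v) \<le> l2norm U (Q (\<lambda>x. u x - v x))"
      using l2norm_le_diff[of U "\<lambda>x. Q u x - Q v x" "Q (\<lambda>x. u x - v x)"] that
      by (simp add: L2_diff QL l2norm_minus_commute[of _ "\<lambda>x. Q u x - Q v x"])
    also have "\<dots> \<le> c * l2dist U u v" by (intro Qle L2_diff that)
    finally show ?thesis .
  qed
  \<comment> \<open>The bound \<open>c\<close> of \<open>Q\<close> may be 0, so tolerances are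
    divided by c + 1.\<close>
  have c_cancel: "(c + 1) * (e / (2 * (c + 1))) = e / 2" for e :: real
    using mult_divide_mult_cancel_left[of "c + 1" e 2] c by (simp add: mult.commute)
  define d where "d t = l2dist U (S1 t (Q g)) (Q (S2 t g))" for t
  have Qg: "L2 U (Q g)" by (rule QL[OF g])
  have "continuous_on {0..} d"
    unfolding continuous_on_iff
  proof (intro ballI allI impI)
    fix t e :: real assume t: "t \<in> {0..}" and e: "e > 0"
    have e1: "e / 2 > 0" and e2: "e / (2 * (c + 1)) > 0" using e c by simp_all
    obtain \<delta>1 where \<delta>1: "\<delta>1 > 0" "\<And>s t. 0 \<le> s \<Longrightarrow> 0 \<le> t \<Longrightarrow> \<bar>s - t\<bar> < \<delta>1 \<Longrightarrow> l2dist U (S1 s (Q g)) (S1 t (Q g)) < e / 2"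
      using semigroup_orbit_continuous[OF S1 Qg e1] by blast
    obtain \<delta>2 where \<delta>2: "\<delta>2 > 0" "\<And>s t. 0 \<le> s \<Longrightarrow> 0 \<le> t \<Longrightarrow> \<bar>s - t\<bar> < \<delta>2 \<Longrightarrow> l2dist U (S2 s g) (S2 t g) < e / (2 * (c + 1))"
      using semigroup_orbit_continuous[OF S2 g e2] by blast
    have *: "d s < d r + e" if "0 \<le> s" "0 \<le> r" "\<bar>s - r\<bar> < min \<delta>1 \<delta>2" for s r
    proof -
      have L: "L2 U (S1 s (Q g))" "L2 U (S1 r (Q g))" "L2 U (Q (S2 s g))" "L2 U (Q (S2 r g))" "L2 U (S2 s g)" "L2 U (S2 r g)"
        using that g Qg by (simp_all add: L1 L2' QL)
      have "d s \<le> l2dist U (S1 s (Q g)) (S1 r (Q g)) + l2dist U (S1 r (Q g)) (Q (S2 s g))"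
        unfolding d_def by (intro l2norm_triangle_diff L)
      also have "l2dist U (S1 r (Q g)) (Q (S2 s g)) \<le> d r + l2dist U (Q (S2 r g)) (Q (S2 s g))"
        unfolding d_def by (intro l2norm_triangle_diff L)
      also have "l2dist U (Q (S2 r g)) (Q (S2 s g)) \<le> c * l2dist U (S2 r g) (S2 s g)"
        by (intro Qdist L)
      also have "\<dots> \<le> (c + 1) * l2dist U (S2 r g) (S2 s g)" by (intro mult_right_mono) auto
      also have "\<dots> \<le> (c + 1) * (e / (2 * (c + 1)))"
        using \<delta>2(2)[of r s] that c by (intro mult_left_mono) (auto simp: abs_minus_commute)
      also have "\<dots> = e / 2" by (rule c_cancel)
      finally show ?thesis using \<delta>1(2)[of s r] that by simp
    qed
    show "\<exists>\<delta>>0. \<forall>s\<in>{0..}. dist s t < \<delta> \<longrightarrow> dist (d s) (d t) < e"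
    proof (intro exI[of _ "min \<delta>1 \<delta>2"] conjI ballI impI)
      fix s assume "s \<in> {0::real..}" "dist s t < min \<delta>1 \<delta>2"
      then show "dist (d s) (d t) < e"
        using *[of s t] *[of t s] t by (auto simp: dist_real_def abs_minus_commute)
    qed (use \<delta>1 \<delta>2 in auto)
  qed
  moreover have "d 0 \<le> 0"
  proof -
    have L: "L2 U (S1 0 (Q g))" "L2 U (Q (S2 0 g))" "L2 U (S2 0 g)"
      using g Qg by (simp_all add: L1 L2' QL)
    have "d 0 \<le> l2dist U (S1 0 (Q g)) (Q g) + l2dist U (Q g) (Q (S2 0 g))"
      unfolding d_def by (intro l2norm_triangle_diff L Qg)
    also have "\<dots> \<le> 0 + c * l2dist U g (S2 0 g)"
      using semigroup_0[OF S1 Qg] Qdist[OF g L(3)] by simp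
    also have "\<dots> = 0" using semigroup_0[OF S2 g] by (simp add: l2norm_minus_commute[of _ g])
    finally show ?thesis .
  qed
  moreover have "\<exists>\<delta>>0. \<forall>h. 0 < h \<and> h < \<delta> \<longrightarrow> d (t + h) \<le> d t + h * (K + e)" if t: "t \<ge> 0" and e: "e > 0" for t e
  proof -
    \<comment> \<open>The generators are evaluated at \<open>w\<close> and \<open>w1\<close>, which
      agree almost everywhere with \<open>S2 t g\<close> and \<open>Q w\<close>. This leaves the
      choice of convenient representatives to the application.\<close>
    obtain w w1 f1 f2 where w: "l2dist U w (S2 t g) = 0" "l2dist U w1 (Q w) = 0"
      "Op1 w1 f1" "Op2 w f2" "l2dist U f1 (Q f2) \<le> K"
      using gen[OF t] by (elim exE conjE) (rule that; assumption)
    note LL = generator_L2(1)[OF S1, OF w(3)] generator_L2(2)[OF S1, OF w(3)] generator_L2(1)[OF S2, OF w(4)] generator_L2(2)[OF S2, OF w(4)]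
    have e1: "e / 2 > 0" and e2: "e / (2 * (c + 1)) > 0" using e c by simp_all
    obtain \<delta>1 where \<delta>1: "\<delta>1 > 0" "\<And>h. 0 < h \<Longrightarrow> h < \<delta>1 \<Longrightarrow> l2dist U (S1 h w1) (\<lambda>x. w1 x + h * f1 x) \<le> h * (e / 2)"
      by (rule generator_step[OF S1, OF w(3) e1]) (rule that; assumption)
    obtain \<delta>2 where \<delta>2: "\<delta>2 > 0" "\<And>h. 0 < h \<Longrightarrow> h < \<delta>2 \<Longrightarrow> l2dist U (S2 h w) (\<lambda>x. w x + h * f2 x) \<le> h * (e / (2 * (c + 1)))"
      by (rule generator_step[OF S2, OF w(4) e2]) (rule that; assumption)
    have "d (t + h) \<le> d t + h * (K + e)" if h: "0 < h" "h < min \<delta>1 \<delta>2" for h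
    proof -
      have h0: "h \<ge> 0" "t + h \<ge> 0" "h + t \<ge> 0" using h t by auto
      have L: "L2 U (S2 t g)" "L2 U (Q (S2 t g))" "L2 U (S1 t (Q g))" "L2 U (S1 h (S1 t (Q g)))"
        "L2 U (S1 (h + t) (Q g))" "L2 U (S2 (h + t) g)" "L2 U (S1 h (Q (S2 t g)))" "L2 U (S1 h w1)"
        "L2 U (Q w)" "L2 U (Q f2)" "L2 U (S2 h w)" "L2 U (Q (S2 h w))" "L2 U (Q (S2 (h + t) g))"
        "L2 U (S2 h (S2 t g))" "L2 U (\<lambda>x. w1 x + h * f1 x)" "L2 U (\<lambda>x. Q w x + h * Q f2 x)" "L2 U (\<lambda>x. w x + h * f2 x)"
        "L2 U (Q (\<lambda>x. w x + h * f2 x))"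
        using g Qg LL h0 t by (simp_all add: L1 L2' QL L2_add L2_cmult)
      have z1: "l2dist U (S1 (h + t) (Q g)) (S1 h (S1 t (Q g))) = 0"
        by (rule semigroup_plus[OF S1 h0(1) t Qg])
      have z2: "l2dist U (S1 h (S1 t (Q g))) (S1 h (Q (S2 t g))) \<le> d t"
        unfolding d_def by (rule semigroup_dist[OF S1 h0(1) L(3,2)])
      have "l2dist U (Q (S2 t g)) w1 \<le> l2dist U (Q (S2 t g)) (Q w) + l2dist U (Q w) w1"
        by (intro l2norm_triangle_diff L LL)
      also have "\<dots> \<le> c * l2dist U (S2 t g) w + 0"
        using Qdist[OF L(1) LL(3)] w(2) by (simp add: l2norm_minus_commute[of _ w1])
      also have "\<dots> = 0" using w(1) by (simp add: l2norm_minus_commute[of _ w])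
      finally have z3: "l2dist U (S1 h (Q (S2 t g))) (S1 h w1) \<le> 0"
        using semigroup_dist[OF S1 h0(1) L(2) LL(1)] by simp
      have z4: "l2dist U (S1 h w1) (\<lambda>x. w1 x + h * f1 x) \<le> h * (e / 2)"
        using \<delta>1(2) h by simp
      have "l2dist U (\<lambda>x. w1 x + h * f1 x) (\<lambda>x. Q w x + h * Q f2 x)
          \<le> l2dist U w1 (Q w) + l2norm U (\<lambda>x. h * (f1 x - Q f2 x))"
        using l2norm_triangle[of U "\<lambda>x. w1 x - Q w x" "\<lambda>x. h * (f1 x - Q f2 x)"] L LL
        by (simp add: L2_diff L2_cmult algebra_simps)
      also have "\<dots> \<le> h * K" using w(2,5) h by (simp add: l2norm_cmult)
      finally have z5: "l2dist U (\<lambda>x. w1 x + h * f1 x) (\<lambda>x. Q w x + h * Q f2 x) \<le> h * K" .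
      have z6: "l2dist U (\<lambda>x. Q w x + h * Q f2 x) (Q (\<lambda>x. w x + h * f2 x)) = 0"
        using Qlin[OF LL(3,4), of 1 h] by (simp add: l2norm_minus_commute)
      have "l2dist U (Q (\<lambda>x. w x + h * f2 x)) (Q (S2 h w)) \<le> c * l2dist U (\<lambda>x. w x + h * f2 x) (S2 h w)"
        by (intro Qdist L)
      also have "\<dots> \<le> (c + 1) * (h * (e / (2 * (c + 1))))"
        using \<delta>2(2)[of h] h c by (intro mult_mono) (auto simp: l2norm_minus_commute[of _ "\<lambda>x. w x + h * f2 x"])
      also have "\<dots> = h * (e / 2)" using c_cancel[of e] by (simp only: mult.left_commute[of "c + 1" h])
      finally have z7: "l2dist U (Q (\<lambda>x. w x + h * f2 x)) (Q (S2 h w)) \<le> h * (e / 2)" .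
      have "l2dist U (S2 h w) (S2 (h + t) g) \<le> l2dist U (S2 h w) (S2 h (S2 t g)) + l2dist U (S2 h (S2 t g)) (S2 (h + t) g)"
        by (intro l2norm_triangle_diff L)
      also have "\<dots> \<le> l2dist U w (S2 t g) + 0"
        using semigroup_dist[OF S2 h0(1) LL(3) L(1)] semigroup_plus[OF S2 h0(1) t g]
        by (simp add: l2norm_minus_commute[of _ "S2 h (S2 t g)"])
      finally have "l2dist U (S2 h w) (S2 (h + t) g) = 0" using w(1) l2norm_nonneg by (simp add: order_antisym)
      then have z8: "l2dist U (Q (S2 h w)) (Q (S2 (h + t) g)) \<le> 0"
        using Qdist[OF L(11,6)] by simp
      \<comment> \<open>Of the eight links, \<open>z2\<close> contributes \<open>d t\<close>,
        \<open>z5\<close> contributes h K, and the two first-order expansions \<open>z4\<close> and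
        \<open>z7\<close> contribute h e / 2 each; the others contribute 0.\<close>
      have "d (h + t) \<le> l2dist U (S1 (h + t) (Q g)) (S1 h (S1 t (Q g))) + l2dist U (S1 h (S1 t (Q g))) (Q (S2 (h + t) g))"
        unfolding d_def by (intro l2norm_triangle_diff L)
      moreover have "l2dist U (S1 h (S1 t (Q g))) (Q (S2 (h + t) g)) \<le> l2dist U (S1 h (S1 t (Q g))) (S1 h (Q (S2 t g))) + l2dist U (S1 h (Q (S2 t g))) (Q (S2 (h + t) g))"
        by (intro l2norm_triangle_diff L)
      moreover have "l2dist U (S1 h (Q (S2 t g))) (Q (S2 (h + t) g)) \<le> l2dist U (S1 h (Q (S2 t g))) (S1 h w1) + l2dist U (S1 h w1) (Q (S2 (h + t) g))"
        by (intro l2norm_triangle_diff L)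
      moreover have "l2dist U (S1 h w1) (Q (S2 (h + t) g)) \<le> l2dist U (S1 h w1) (\<lambda>x. w1 x + h * f1 x) + l2dist U (\<lambda>x. w1 x + h * f1 x) (Q (S2 (h + t) g))"
        by (intro l2norm_triangle_diff L)
      moreover have "l2dist U (\<lambda>x. w1 x + h * f1 x) (Q (S2 (h + t) g)) \<le> l2dist U (\<lambda>x. w1 x + h * f1 x) (\<lambda>x. Q w x + h * Q f2 x) + l2dist U (\<lambda>x. Q w x + h * Q f2 x) (Q (S2 (h + t) g))"
        by (intro l2norm_triangle_diff L)
      moreover have "l2dist U (\<lambda>x. Q w x + h * Q f2 x) (Q (S2 (h + t) g)) \<le> l2dist U (\<lambda>x. Q w x + h * Q f2 x) (Q (\<lambda>x. w x + h * f2 x)) + l2dist U (Q (\<lambda>x. w x + h * f2 x)) (Q (S2 (h + t) g))"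
        by (intro l2norm_triangle_diff L)
      moreover have "l2dist U (Q (\<lambda>x. w x + h * f2 x)) (Q (S2 (h + t) g)) \<le> l2dist U (Q (\<lambda>x. w x + h * f2 x)) (Q (S2 h w)) + l2dist U (Q (S2 h w)) (Q (S2 (h + t) g))"
        by (intro l2norm_triangle_diff L)
      ultimately have "d (h + t) \<le> d t + (h * (e / 2) + h * K + h * (e / 2))"
        using z1 z2 z3 z4 z5 z6 z7 z8 by linarith
      then show ?thesis by (simp add: algebra_simps)
    qed
    moreover have "min \<delta>1 \<delta>2 > 0" using \<delta>1 \<delta>2 by simp
    ultimately show ?thesis by blast
  qed
  ultimately have "d t \<le> K * t" using \<open>t \<ge> 0\<close> by (rule Dini_bound)
  then show ?thesis by (simp add: d_def)
qed

subsection \<open>The space H01\<close>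

text \<open>Difference quotients of \<theta> have integral 0 by translation invariance, and they
  converge to the derivative under a common integrable bound.\<close>

lemma integral_pd_test_fun:
  assumes "test_fun U \<theta>"
  shows "(\<integral>x. pd e \<theta> x \<partial>lebesgue) = 0"
proof -
  note sm = test_funD(1)[OF assms]
  obtain K where K: "compact K" "K \<subseteq> U" "\<And>x. x \<notin> K \<Longrightarrow> \<theta> x = 0"
    using test_fun_support[OF assms] by metis
  obtain R where R: "\<And>x. \<bar>pd e \<theta> x\<bar> \<le> R" using test_fun_bounded[OF test_fun_pd[OF assms]] by metis
  have R0: "R \<ge> 0" using R[of 0] by linarith
  obtain r where r: "\<And>x. x \<in> K \<Longrightarrow> norm x \<le> r"
    using compact_imp_bounded[OF K(1)] by (auto simp: bounded_iff)
  \<comment> \<open>The steps \<open>h n\<close> are at most 1, so this ball contains the supports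
    of all difference quotients. On it the mean value theorem bounds them by
    \<open>R\<close>.\<close>
  define B where "B = cball (0::'a) (r + norm e)"
  define h where "h n = inverse (real (Suc n))" for n
  have h: "h n > 0" "h n \<le> 1" for n by (auto simp: h_def inverse_le_1_iff)
  have hl: "h \<longlonglongrightarrow> 0" unfolding h_def by (rule LIMSEQ_inverse_real_of_nat)
  have deriv: "((\<lambda>t. \<theta> (x + t *\<^sub>R e)) has_real_derivative pd e \<theta> (x + t *\<^sub>R e)) (at t)" for x t
  proof -
    have "((\<lambda>t. \<theta> (x + t *\<^sub>R e)) has_derivative (\<lambda>s. pd (s *\<^sub>R e) \<theta> (x + t *\<^sub>R e))) (at t)"
      by (rule has_derivative_compose[OF _ smooth_has_derivative[OF sm]]) (auto intro!: derivative_eq_intros)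
    moreover have "pd (s *\<^sub>R e) \<theta> (x + t *\<^sub>R e) = pd e \<theta> (x + t *\<^sub>R e) * s" for s
      using linear_cmul[OF bounded_linear.linear[OF has_derivative_bounded_linear[OF smooth_has_derivative[OF sm]]]]
      by simp
    ultimately show ?thesis by (simp add: has_field_derivative_def)
  qed
  define q where "q n x = (\<theta> (x + h n *\<^sub>R e) - \<theta> x) / h n" for n x
  have qR: "\<bar>q n x\<bar> \<le> R * indicator B x" for n x
  proof (cases "x \<in> B")
    case True
    obtain z where "\<theta> (x + h n *\<^sub>R e) - \<theta> (x + 0 *\<^sub>R e) = (h n - 0) * pd e \<theta> (x + z *\<^sub>R e)"
      using MVT2[of 0 "h n" "\<lambda>t. \<theta> (x + t *\<^sub>R e)" "\<lambda>t. pd e \<theta> (x + t *\<^sub>R e)"] h(1) deriv by blast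
    then have "q n x = pd e \<theta> (x + z *\<^sub>R e)" using h(1)[of n] by (simp add: q_def)
    then show ?thesis using R True by simp
  next
    case False
    then have "norm x > r + norm e" by (simp add: B_def not_le)
    moreover have "norm (h n *\<^sub>R e) \<le> norm e" using h[of n] by (simp add: mult_left_le_one_le)
    ultimately have "norm (x + h n *\<^sub>R e) > r" "norm x > r"
      using norm_diff_ineq[of x "h n *\<^sub>R e"] norm_ge_zero[of e] by linarith+
    then have "\<theta> (x + h n *\<^sub>R e) = 0" "\<theta> x = 0" using r K(3) by force+
    then show ?thesis using R0 by (simp add: q_def)
  qed
  have cm: "\<theta> \<in> borel_measurable borel" by (rule smooth_fun_borel[OF sm])
  have cm': "(\<lambda>x. \<theta> (x + c)) \<in> borel_measurable borel" for c
    using measurable_compose[OF _ cm, of "\<lambda>x. x + c" borel] by simp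
  have i\<theta>: "integrable lborel \<theta>"
  proof -
    have "integrable lborel (\<lambda>x. indicator K x *\<^sub>R \<theta> x)"
      by (rule borel_integrable_compact[OF K(1) smooth_fun_continuous[OF sm]])
    also have "(\<lambda>x. indicator K x *\<^sub>R \<theta> x) = \<theta>" using K(3) by (force simp: indicator_def)
    finally show ?thesis .
  qed
  have d: "distr lborel borel (\<lambda>x. c + 1 *\<^sub>R x) = (lborel :: 'a measure)" for c
    by (rule lborel_distr_isometric_affine) simp
  have i\<theta>': "integrable lborel (\<lambda>x. \<theta> (x + c))" and e\<theta>: "(\<integral>x. \<theta> (x + c) \<partial>lborel) = (\<integral>x. \<theta> x \<partial>lborel)" for c
  proof -
    have "integrable (distr lborel borel (\<lambda>x. c + 1 *\<^sub>R x)) \<theta>" unfolding d by (rule i\<theta>)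
    then have "integrable lborel (\<lambda>x. \<theta> (c + 1 *\<^sub>R x))" by (rule integrable_distr[rotated]) simp
    then show "integrable lborel (\<lambda>x. \<theta> (x + c))" by (simp add: add.commute)
    have "(\<integral>x. \<theta> x \<partial>distr lborel borel (\<lambda>x. c + 1 *\<^sub>R x)) = (\<integral>x. \<theta> (c + 1 *\<^sub>R x) \<partial>lborel)"
      by (rule integral_distr) (use cm in auto)
    then show "(\<integral>x. \<theta> (x + c) \<partial>lborel) = (\<integral>x. \<theta> x \<partial>lborel)" unfolding d by (simp add: add.commute)
  qed
  have "(\<lambda>n. \<integral>x. q n x \<partial>lborel) \<longlonglongrightarrow> (\<integral>x. pd e \<theta> x \<partial>lborel)"
  proof (rule integral_dominated_convergence[where w = "\<lambda>x. R * indicator B x"])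
    show "pd e \<theta> \<in> borel_measurable lborel"
      using smooth_fun_borel[OF smooth_fun_pd[OF sm, of e]] by simp
    show "q n \<in> borel_measurable lborel" for n
      unfolding q_def[abs_def] using cm cm' by simp
    show "integrable lborel (\<lambda>x. R * indicator B x)"
      using emeasure_lborel_cball_finite[of "0::'a" "r + norm e"] by (simp add: B_def integrable_indicator_iff)
    show "AE x in lborel. (\<lambda>n. q n x) \<longlonglongrightarrow> pd e \<theta> x"
    proof (rule AE_I2)
      fix x
      have "((\<lambda>t. (\<theta> (x + t *\<^sub>R e) - \<theta> x) / t) \<longlongrightarrow> pd e \<theta> x) (at 0)"
        using deriv[of x 0] by (simp add: has_field_derivative_iff)
      moreover have "filterlim h (at 0) sequentially"
        using hl h(1) by (simp add: filterlim_at less_imp_neq[symmetric] eventually_sequentiallyI order_less_imp_not_eq2)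
      ultimately show "(\<lambda>n. q n x) \<longlonglongrightarrow> pd e \<theta> x"
        unfolding q_def by (rule filterlim_compose)
    qed
    show "AE x in lborel. norm (q n x) \<le> R * indicator B x" for n using qR by simp
  qed
  moreover have "(\<integral>x. q n x \<partial>lborel) = 0" for n
    unfolding q_def using i\<theta> i\<theta>' e\<theta> by simp
  ultimately have "(\<integral>x. pd e \<theta> x \<partial>lborel) = 0" by (simp add: LIMSEQ_const_iff)
  then show ?thesis
    using smooth_fun_borel[OF smooth_fun_pd[OF sm, of e]] by (simp add: integral_completion)
qed

text \<open>The product of f and \<phi> is a test function on U, so its derivative has integral 0;
  the Leibniz rule makes this an integration by parts.\<close>

lemma weak_pderiv_test_fun:
  assumes "test_fun V f" "open U" "bounded U"
  shows "weak_pderiv U e f (pd e f)"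
proof (rule weak_pderivI_L2[OF assms(2,3)])
  note L = test_fun_L2[OF assms] test_fun_L2[OF test_fun_pd[OF assms(1)] assms(2,3)]
  show "L2 U f" "L2 U (pd e f)" by (fact L)+
  fix \<phi> assume \<phi>: "test_fun U \<phi>"
  note L\<phi> = test_fun_L2[OF \<phi> assms(2,3)] test_fun_L2[OF test_fun_pd[OF \<phi>] assms(2,3)]
  have t: "test_fun U (\<lambda>x. f x * \<phi> x)" by (rule test_fun_mult_right[OF test_funD(1)[OF assms(1)] \<phi>])
  have "indicator U x * pd e (\<lambda>x. f x * \<phi> x) x = pd e (\<lambda>x. f x * \<phi> x) x" for x
    using test_fun_eq_0[OF test_fun_pd[OF t]] by (auto simp: indicator_def)
  then have "(\<integral>x. pd e (\<lambda>x. f x * \<phi> x) x \<partial>lebesgue_on U) = 0"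
    unfolding integral_lebesgue_on[OF open_lebesgue[OF assms(2)]] using integral_pd_test_fun[OF t] by (simp only:)
  then have "(\<integral>x. f x * pd e \<phi> x + pd e f x * \<phi> x \<partial>lebesgue_on U) = 0"
    by (simp add: pd_mult[OF test_funD(1)[OF assms(1)] test_funD(1)[OF \<phi>]])
  then show "(\<integral>x. f x * pd e \<phi> x \<partial>lebesgue_on U) = - (\<integral>x. pd e f x * \<phi> x \<partial>lebesgue_on U)"
    using L2_mult_integrable[OF L(1) L\<phi>(2)] L2_mult_integrable[OF L(2) L\<phi>(1)] by simp
qed

text \<open>The space H01 with its gradient components exposed as \<open>g\<close>, and one test
  function per tolerance instead of a sequence. In this form it is easily closed under sums,
  multiples and L2 limits, while weak differentiability is a consequence.\<close>

definition H01_approx :: "'c::euclidean_space set \<Rightarrow> ('c \<Rightarrow> real) \<Rightarrow> ('c \<Rightarrow> 'c \<Rightarrow> real) \<Rightarrow> bool" where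
  "H01_approx U u g \<longleftrightarrow> L2 U u \<and> (\<forall>i\<in>Basis. L2 U (g i)) \<and>
    (\<forall>e>0. \<exists>\<phi>. test_fun U \<phi> \<and> l2dist U u \<phi> < e \<and> (\<forall>i\<in>Basis. l2dist U (g i) (pd i \<phi>) < e))"

lemma H01_approxD:
  assumes "H01_approx U u g"
  shows "L2 U u" "i \<in> Basis \<Longrightarrow> L2 U (g i)"
  using assms by (auto simp: H01_approx_def)

lemma H01_approx_sequence:
  assumes "H01_approx U u g"
  obtains \<phi> where "\<And>n. test_fun U (\<phi> n)" "(\<lambda>n. l2dist U u (\<phi> n)) \<longlonglongrightarrow> 0"
    "\<And>i. i \<in> Basis \<Longrightarrow> (\<lambda>n. l2dist U (g i) (pd i (\<phi> n))) \<longlonglongrightarrow> 0"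
proof -
  have "\<exists>\<phi>. test_fun U \<phi> \<and> l2dist U u \<phi> < inverse (real (Suc n)) \<and>
      (\<forall>i\<in>Basis. l2dist U (g i) (pd i \<phi>) < inverse (real (Suc n)))" for n
  proof -
    have "inverse (real (Suc n)) > 0" by simp
    then show ?thesis using assms unfolding H01_approx_def by blast
  qed
  then obtain \<phi> where \<phi>: "\<And>n. test_fun U (\<phi> n)" "\<And>n. l2dist U u (\<phi> n) < inverse (real (Suc n))"
    "\<And>n i. i \<in> Basis \<Longrightarrow> l2dist U (g i) (pd i (\<phi> n)) < inverse (real (Suc n))"
    by metis
  have lim: "X \<longlonglongrightarrow> 0" if "\<And>n. 0 \<le> X n" "\<And>n. X n < inverse (real (Suc n))" for X :: "nat \<Rightarrow> real"
    by (rule Lim_null_comparison[OF _ LIMSEQ_inverse_real_of_nat])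
       (use that in \<open>auto intro!: always_eventually less_imp_le simp del: of_nat_Suc\<close>)
  show ?thesis
    by (rule that[of \<phi>]) (use \<phi> in \<open>auto intro!: lim simp del: of_nat_Suc\<close>)
qed

context
  fixes U :: "'c::euclidean_space set"
  assumes U: "open U" "bounded U"
begin

text \<open>Integration by parts holds for the approximating test functions and passes to the L2
  limit on both sides.\<close>

lemma H01_approx_weak_pderiv:
  assumes "H01_approx U u g" "i \<in> Basis"
  shows "weak_pderiv U i u (g i)"
proof (rule weak_pderivI_L2[OF U])
  note L = H01_approxD[OF assms(1)]
  show "L2 U u" "L2 U (g i)" using L assms(2) by auto
  obtain \<phi> where \<phi>: "\<And>n. test_fun U (\<phi> n)" "(\<lambda>n. l2dist U u (\<phi> n)) \<longlonglongrightarrow> 0"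
    "\<And>i. i \<in> Basis \<Longrightarrow> (\<lambda>n. l2dist U (g i) (pd i (\<phi> n))) \<longlonglongrightarrow> 0"
    by (rule H01_approx_sequence[OF assms(1)]) (rule that; assumption)
  fix \<psi> assume \<psi>: "test_fun U \<psi>"
  have 1: "(\<lambda>n. \<integral>x. \<phi> n x * pd i \<psi> x \<partial>lebesgue_on U) \<longlonglongrightarrow> (\<integral>x. u x * pd i \<psi> x \<partial>lebesgue_on U)"
    by (intro l2norm_tendsto_integral test_fun_L2[OF \<phi>(1) U] test_fun_L2[OF test_fun_pd[OF \<psi>] U] L(1) \<phi>(2))
  have 2: "(\<lambda>n. \<integral>x. pd i (\<phi> n) x * \<psi> x \<partial>lebesgue_on U) \<longlonglongrightarrow> (\<integral>x. g i x * \<psi> x \<partial>lebesgue_on U)"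
    by (intro l2norm_tendsto_integral test_fun_L2[OF test_fun_pd[OF \<phi>(1)] U] test_fun_L2[OF \<psi> U] L(2) \<phi>(3) assms(2))
  have "(\<integral>x. \<phi> n x * pd i \<psi> x \<partial>lebesgue_on U) = - (\<integral>x. pd i (\<phi> n) x * \<psi> x \<partial>lebesgue_on U)" for n
    by (rule weak_pderivD(3)[OF weak_pderiv_test_fun[OF \<phi>(1) U] \<psi>])
  with 1 have "(\<lambda>n. - (\<integral>x. pd i (\<phi> n) x * \<psi> x \<partial>lebesgue_on U)) \<longlonglongrightarrow> (\<integral>x. u x * pd i \<psi> x \<partial>lebesgue_on U)"
    by simp
  from LIMSEQ_unique[OF this tendsto_minus[OF 2]]
  show "(\<integral>x. u x * pd i \<psi> x \<partial>lebesgue_on U) = - (\<integral>x. g i x * \<psi> x \<partial>lebesgue_on U)" .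
qed

lemma H01_approx_H01:
  assumes "H01_approx U u g"
  shows "H01 U u"
proof -
  define G where "G x = (\<Sum>i\<in>Basis. g i x *\<^sub>R i)" for x
  have G: "G x \<bullet> i = g i x" if "i \<in> Basis" for x i
    using that by (simp add: G_def inner_sum_left inner_Basis if_distrib sum.If_cases cong: if_cong)
  have "weak_grad U u G"
    unfolding weak_grad_def using H01_approxD[OF assms] H01_approx_weak_pderiv[OF assms] by (simp add: G)
  moreover obtain \<phi> where "\<And>n. test_fun U (\<phi> n)" "(\<lambda>n. l2dist U u (\<phi> n)) \<longlonglongrightarrow> 0"
    "\<And>i. i \<in> Basis \<Longrightarrow> (\<lambda>n. l2dist U (g i) (pd i (\<phi> n))) \<longlonglongrightarrow> 0"
    by (rule H01_approx_sequence[OF assms]) (rule that; assumption)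
  ultimately show ?thesis
    unfolding H01_def using H01_approxD(1)[OF assms] by (auto simp: G intro!: exI[of _ G] exI[of _ \<phi>])
qed

lemma H01_approx_add:
  assumes "H01_approx U u g" "H01_approx U v k"
  shows "H01_approx U (\<lambda>x. u x + v x) (\<lambda>i x. g i x + k i x)"
  unfolding H01_approx_def
proof (intro conjI ballI allI impI)
  note L = H01_approxD[OF assms(1)] H01_approxD[OF assms(2)]
  show "L2 U (\<lambda>x. u x + v x)" by (intro L2_add L)
  show "L2 U (\<lambda>x. g i x + k i x)" if "i \<in> Basis" for i by (intro L2_add L that)
  fix e :: real assume "e > 0"
  then have e: "e / 2 > 0" by simp
  obtain \<phi> where \<phi>: "test_fun U \<phi>" "l2dist U u \<phi> < e / 2" "\<And>i. i \<in> Basis \<Longrightarrow> l2dist U (g i) (pd i \<phi>) < e / 2"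
    using assms(1) e unfolding H01_approx_def by blast
  obtain \<psi> where \<psi>: "test_fun U \<psi>" "l2dist U v \<psi> < e / 2" "\<And>i. i \<in> Basis \<Longrightarrow> l2dist U (k i) (pd i \<psi>) < e / 2"
    using assms(2) e unfolding H01_approx_def by blast
  have *: "l2dist U (\<lambda>x. f1 x + f2 x) (\<lambda>x. h1 x + h2 x) \<le> l2dist U f1 h1 + l2dist U f2 h2"
    if "L2 U f1" "L2 U f2" "L2 U h1" "L2 U h2" for f1 f2 h1 h2
    using l2norm_triangle[OF L2_diff[OF that(1,3)] L2_diff[OF that(2,4)]] by (simp add: algebra_simps)
  show "\<exists>\<phi>. test_fun U \<phi> \<and> l2dist U (\<lambda>x. u x + v x) \<phi> < e \<and> (\<forall>i\<in>Basis. l2dist U (\<lambda>x. g i x + k i x) (pd i \<phi>) < e)"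
  proof (intro exI[of _ "\<lambda>x. \<phi> x + \<psi> x"] conjI ballI)
    show "test_fun U (\<lambda>x. \<phi> x + \<psi> x)" by (intro test_fun_add \<phi> \<psi>)
    show "l2dist U (\<lambda>x. u x + v x) (\<lambda>x. \<phi> x + \<psi> x) < e"
      using *[OF L(1,3) test_fun_L2[OF \<phi>(1) U] test_fun_L2[OF \<psi>(1) U]] \<phi>(2) \<psi>(2) by simp
    fix i :: 'c assume i: "i \<in> Basis"
    show "l2dist U (\<lambda>x. g i x + k i x) (pd i (\<lambda>x. \<phi> x + \<psi> x)) < e"
      using *[OF L(2)[OF i] L(4)[OF i] test_fun_L2[OF test_fun_pd[OF \<phi>(1)] U] test_fun_L2[OF test_fun_pd[OF \<psi>(1)] U], of i i]
        \<phi>(3)[OF i] \<psi>(3)[OF i] by (simp add: pd_add test_funD(1)[OF \<phi>(1)] test_funD(1)[OF \<psi>(1)])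
  qed
qed

lemma H01_approx_cmult:
  assumes "H01_approx U u g"
  shows "H01_approx U (\<lambda>x. c * u x) (\<lambda>i x. c * g i x)"
  unfolding H01_approx_def
proof (intro conjI ballI allI impI)
  note L = H01_approxD[OF assms(1)]
  show "L2 U (\<lambda>x. c * u x)" by (intro L2_cmult L)
  show "L2 U (\<lambda>x. c * g i x)" if "i \<in> Basis" for i by (intro L2_cmult L that)
  fix e :: real assume "e > 0"
  then have e: "e / (\<bar>c\<bar> + 1) > 0" by simp
  obtain \<phi> where \<phi>: "test_fun U \<phi>" "l2dist U u \<phi> < e / (\<bar>c\<bar> + 1)" "\<And>i. i \<in> Basis \<Longrightarrow> l2dist U (g i) (pd i \<phi>) < e / (\<bar>c\<bar> + 1)"
    using assms(1) e unfolding H01_approx_def by blast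
  have *: "l2norm U (\<lambda>x. c * h x - c * h' x) < e" if "l2norm U (\<lambda>x. h x - h' x) < e / (\<bar>c\<bar> + 1)" for h h'
  proof -
    have "l2norm U (\<lambda>x. c * h x - c * h' x) = \<bar>c\<bar> * l2norm U (\<lambda>x. h x - h' x)"
      using l2norm_cmult[of U c "\<lambda>x. h x - h' x"] by (simp add: right_diff_distrib)
    also have "\<dots> \<le> \<bar>c\<bar> * (e / (\<bar>c\<bar> + 1))" using that by (intro mult_left_mono) auto
    also have "\<dots> < e" using \<open>e > 0\<close> by (simp add: field_simps)
    finally show ?thesis .
  qed
  show "\<exists>\<phi>. test_fun U \<phi> \<and> l2dist U (\<lambda>x. c * u x) \<phi> < e \<and> (\<forall>i\<in>Basis. l2dist U (\<lambda>x. c * g i x) (pd i \<phi>) < e)"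
    using \<phi> * by (intro exI[of _ "\<lambda>x. c * \<phi> x"]) (auto intro: test_fun_cmult simp: pd_cmult test_funD(1)[OF \<phi>(1)])
qed

lemma H01_approx_zero: "H01_approx U (\<lambda>x. 0) (\<lambda>i x. 0)"
proof -
  have "pd i (\<lambda>x::'c. 0::real) = (\<lambda>x. 0)" for i
    by (rule ext, rule pd_eqI) simp
  then show ?thesis
    unfolding H01_approx_def by (auto intro!: exI[of _ "\<lambda>x. 0"])
qed

lemma H01_approx_sum:
  "(\<And>k. k \<in> I \<Longrightarrow> H01_approx U (u k) (g k)) \<Longrightarrow> H01_approx U (\<lambda>x. \<Sum>k\<in>I. u k x) (\<lambda>i x. \<Sum>k\<in>I. g k i x)"
  by (induction I rule: infinite_finite_induct) (auto intro: H01_approx_add H01_approx_zero)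

lemma H01_approx_limit:
  assumes "L2 U u" "\<And>i. i \<in> Basis \<Longrightarrow> L2 U (g i)"
    and "\<And>e. e > 0 \<Longrightarrow> \<exists>v k. H01_approx U v k \<and> l2dist U u v < e \<and> (\<forall>i\<in>Basis. l2dist U (g i) (k i) < e)"
  shows "H01_approx U u g"
  unfolding H01_approx_def
proof (intro conjI ballI allI impI)
  fix e :: real assume "e > 0"
  then have e: "e / 2 > 0" by simp
  obtain v k where v: "H01_approx U v k" "l2dist U u v < e / 2" "\<And>i. i \<in> Basis \<Longrightarrow> l2dist U (g i) (k i) < e / 2"
    using assms(3)[OF e] by blast
  note L = H01_approxD[OF v(1)]
  obtain \<phi> where \<phi>: "test_fun U \<phi>" "l2dist U v \<phi> < e / 2" "\<And>i. i \<in> Basis \<Longrightarrow> l2dist U (k i) (pd i \<phi>) < e / 2"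
    using v(1) e unfolding H01_approx_def by blast
  have "l2dist U u \<phi> < e"
    using l2norm_triangle_diff[OF assms(1) L(1) test_fun_L2[OF \<phi>(1) U]] v(2) \<phi>(2) by simp
  moreover have "l2dist U (g i) (pd i \<phi>) < e" if "i \<in> Basis" for i
    using l2norm_triangle_diff[OF assms(2) L(2) test_fun_L2[OF test_fun_pd[OF \<phi>(1)] U], of i i i] v(3) \<phi>(3) that by fastforce
  ultimately show "\<exists>\<phi>. test_fun U \<phi> \<and> l2dist U u \<phi> < e \<and> (\<forall>i\<in>Basis. l2dist U (g i) (pd i \<phi>) < e)"
    using \<phi>(1) by blast
qed (use assms in auto)

lemma H01_approx_test_fun: "test_fun U \<phi> \<Longrightarrow> H01_approx U \<phi> (\<lambda>i. pd i \<phi>)"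
  unfolding H01_approx_def using test_fun_L2[OF _ U] test_fun_pd[of U \<phi>] by (auto intro!: exI[of _ \<phi>])

lemma H01_obtain_approx:
  assumes "H01 U u"
  obtains g where "H01_approx U u g"
proof -
  obtain G \<phi> where G: "weak_grad U u G" and \<phi>: "\<And>n. test_fun U (\<phi> n)"
    "(\<lambda>n. l2norm U (\<lambda>x. u x - \<phi> n x)) \<longlonglongrightarrow> 0"
    "\<And>e. e \<in> Basis \<Longrightarrow> (\<lambda>n. l2norm U (\<lambda>x. G x \<bullet> e - pd e (\<phi> n) x)) \<longlonglongrightarrow> 0"
    and L: "L2 U u"
    using assms unfolding H01_def by blast
  have "H01_approx U u (\<lambda>i x. G x \<bullet> i)"
  proof (rule H01_approx_limit[OF L])
    show "L2 U (\<lambda>x. G x \<bullet> i)" if "i \<in> Basis" for i using G that by (simp add: weak_grad_def)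
    fix e :: real assume e: "e > 0"
    have "\<forall>\<^sub>F n in sequentially. l2norm U (\<lambda>x. u x - \<phi> n x) < e \<and> (\<forall>i\<in>Basis. l2norm U (\<lambda>x. G x \<bullet> i - pd i (\<phi> n) x) < e)"
      using e by (intro eventually_conj eventually_ball_finite ballI order_tendstoD(2)[OF \<phi>(2)] order_tendstoD(2)[OF \<phi>(3)]) auto
    then obtain n where "l2norm U (\<lambda>x. u x - \<phi> n x) < e" "\<forall>i\<in>Basis. l2norm U (\<lambda>x. G x \<bullet> i - pd i (\<phi> n) x) < e"
      by (auto simp: eventually_sequentially)
    then show "\<exists>v k. H01_approx U v k \<and> l2dist U u v < e \<and> (\<forall>i\<in>Basis. l2dist U (\<lambda>x. G x \<bullet> i) (k i) < e)"
      using H01_approx_test_fun[OF \<phi>(1)[of n]] by blast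
  qed
  then show ?thesis by (rule that)
qed

lemma H01_approx_cong_grad:
  assumes "H01_approx U u g" "\<And>i. i \<in> Basis \<Longrightarrow> L2 U (k i)"
    and "\<And>i. i \<in> Basis \<Longrightarrow> AE x in lebesgue_on U. g i x = k i x"
  shows "H01_approx U u k"
proof (rule H01_approx_limit)
  fix e :: real assume e: "e > 0"
  have "l2dist U (k i) (g i) < e" if "i \<in> Basis" for i
  proof -
    have "l2dist U (k i) (g i) = 0"
      using assms(3)[OF that] assms(2) H01_approxD(2)[OF assms(1) that] that
      by (subst l2norm_eq_0_iff) (auto intro: L2_diff elim: eventually_mono)
    then show ?thesis using e by simp
  qed
  then show "\<exists>v g. H01_approx U v g \<and> l2dist U u v < e \<and> (\<forall>i\<in>Basis. l2dist U (k i) (g i) < e)"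
    using assms(1) e by (intro exI[of _ u] exI[of _ g]) auto
qed (use assms H01_approxD in auto)

end

text \<open>A basis vector of the product space has exactly one zero component, so the
  \<open>of_bool\<close> factors keep exactly one term of the Leibniz rule. Tensors of approximating
  test functions converge because the L2 norm of a tensor is the product of the norms.\<close>

lemma H01_approx_tensor:
  assumes S: "open S" "bounded S" and T: "open T" "bounded T"
    and u: "H01_approx S u g" and v: "H01_approx T v k"
  shows "H01_approx (S \<times> T) (\<lambda>z. u (fst z) * v (snd z))
    (\<lambda>i z. g (fst i) (fst z) * v (snd z) * of_bool (snd i = 0) + u (fst z) * k (snd i) (snd z) * of_bool (fst i = 0))"
proof -
  note ST = open_Times[OF S(1) T(1)] bounded_Times[OF S(2) T(2)]
  note Lu = H01_approxD[OF u] and Lv = H01_approxD[OF v]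
  obtain \<phi> where \<phi>: "\<And>n. test_fun S (\<phi> n)" "(\<lambda>n. l2dist S u (\<phi> n)) \<longlonglongrightarrow> 0"
    "\<And>i. i \<in> Basis \<Longrightarrow> (\<lambda>n. l2dist S (g i) (pd i (\<phi> n))) \<longlonglongrightarrow> 0"
    by (rule H01_approx_sequence[OF u]) (rule that; assumption)
  obtain \<psi> where \<psi>: "\<And>n. test_fun T (\<psi> n)" "(\<lambda>n. l2dist T v (\<psi> n)) \<longlonglongrightarrow> 0"
    "\<And>i. i \<in> Basis \<Longrightarrow> (\<lambda>n. l2dist T (k i) (pd i (\<psi> n))) \<longlonglongrightarrow> 0"
    by (rule H01_approx_sequence[OF v]) (rule that; assumption)
  have lim: "(\<lambda>n. l2dist (S \<times> T) (\<lambda>z. a (fst z) * b (snd z)) (\<lambda>z. a' n (fst z) * b' n (snd z))) \<longlonglongrightarrow> 0"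
    if a: "L2 S a" "\<And>n. L2 S (a' n)" "(\<lambda>n. l2dist S a (a' n)) \<longlonglongrightarrow> 0"
      and b: "L2 T b" "\<And>n. L2 T (b' n)" "(\<lambda>n. l2dist T b (b' n)) \<longlonglongrightarrow> 0" for a a' b b'
  proof (rule Lim_null_comparison)
    have "l2dist (S \<times> T) (\<lambda>z. a (fst z) * b (snd z)) (\<lambda>z. a' n (fst z) * b' n (snd z))
      \<le> l2dist S a (a' n) * l2norm T b + (l2norm S a + l2dist S a (a' n)) * l2dist T b (b' n)" for n
    proof -
      have "l2dist (S \<times> T) (\<lambda>z. a (fst z) * b (snd z)) (\<lambda>z. a' n (fst z) * b' n (snd z))
        = l2norm (S \<times> T) (\<lambda>z. (a (fst z) - a' n (fst z)) * b (snd z) + a' n (fst z) * (b (snd z) - b' n (snd z)))"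
        by (simp add: algebra_simps)
      also have "\<dots> \<le> l2norm (S \<times> T) (\<lambda>z. (a (fst z) - a' n (fst z)) * b (snd z))
          + l2norm (S \<times> T) (\<lambda>z. a' n (fst z) * (b (snd z) - b' n (snd z)))"
        using L2_tensor[OF L2_diff[OF a(1) a(2)[of n]] b(1) S(1) T(1)] L2_tensor[OF a(2)[of n] L2_diff[OF b(1) b(2)[of n]] S(1) T(1)]
        by (rule l2norm_triangle)
      also have "\<dots> = l2dist S a (a' n) * l2norm T b + l2norm S (a' n) * l2dist T b (b' n)"
        using l2norm_tensor[OF L2_diff[OF a(1) a(2)[of n]] b(1) S(1) T(1)] l2norm_tensor[OF a(2)[of n] L2_diff[OF b(1) b(2)[of n]] S(1) T(1)]
        by simp
      also have "l2norm S (a' n) \<le> l2norm S a + l2dist S a (a' n)"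
        using l2norm_le_diff[OF a(2)[of n] a(1)] by (simp add: l2norm_minus_commute[of S a])
      finally show ?thesis by (simp add: mult_right_mono)
    qed
    then show "\<forall>\<^sub>F n in sequentially. norm (l2dist (S \<times> T) (\<lambda>z. a (fst z) * b (snd z)) (\<lambda>z. a' n (fst z) * b' n (snd z)))
      \<le> l2dist S a (a' n) * l2norm T b + (l2norm S a + l2dist S a (a' n)) * l2dist T b (b' n)"
      by simp
    have "(\<lambda>n. l2dist S a (a' n) * l2norm T b + (l2norm S a + l2dist S a (a' n)) * l2dist T b (b' n)) \<longlonglongrightarrow>
      0 * l2norm T b + (l2norm S a + 0) * 0"
      by (intro tendsto_intros a b)
    then show "(\<lambda>n. l2dist S a (a' n) * l2norm T b + (l2norm S a + l2dist S a (a' n)) * l2dist T b (b' n)) \<longlonglongrightarrow> 0"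
      by simp
  qed
  have L\<phi>: "L2 S (\<phi> n)" "L2 S (pd i (\<phi> n))" for n i
    using test_fun_L2[OF \<phi>(1) S] test_fun_L2[OF test_fun_pd[OF \<phi>(1)] S] by auto
  have L\<psi>: "L2 T (\<psi> n)" "L2 T (pd i (\<psi> n))" for n i
    using test_fun_L2[OF \<psi>(1) T] test_fun_L2[OF test_fun_pd[OF \<psi>(1)] T] by auto
  define G where "G i z = g (fst i) (fst z) * v (snd z) * of_bool (snd i = 0) + u (fst z) * k (snd i) (snd z) * of_bool (fst i = 0)" for i z
  define \<theta> where "\<theta> n z = \<phi> n (fst z) * \<psi> n (snd z)" for n z
  have t\<theta>: "test_fun (S \<times> T) (\<theta> n)" for n
    unfolding \<theta>_def[abs_def] by (rule test_fun_tensor[OF \<phi>(1) \<psi>(1)])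
  have B: "(i \<in> Basis \<and> fst i \<in> Basis \<and> snd i = 0 \<and> fst i \<noteq> 0) \<or> (snd i \<in> Basis \<and> fst i = 0 \<and> snd i \<noteq> 0)"
    if "i \<in> Basis" for i :: "'a \<times> 'b"
    using that by (auto simp: Basis_prod_def)
  have conv: "L2 (S \<times> T) (G i) \<and> (\<lambda>n. l2dist (S \<times> T) (G i) (pd i (\<theta> n))) \<longlonglongrightarrow> 0" if "i \<in> Basis" for i
    using B[OF that]
  proof (elim disjE conjE)
    assume i: "fst i \<in> Basis" "snd i = 0" "fst i \<noteq> 0"
    have Gi: "G i = (\<lambda>z. g (fst i) (fst z) * v (snd z))" by (auto simp: G_def i fun_eq_iff)
    have pi: "pd i (\<theta> n) = (\<lambda>z. pd (fst i) (\<phi> n) (fst z) * \<psi> n (snd z))" for n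
      unfolding \<theta>_def[abs_def] using i
      by (auto simp: fun_eq_iff pd_tensor test_funD(1)[OF \<phi>(1)] test_funD(1)[OF \<psi>(1)])
    show ?thesis
      unfolding Gi pi by (intro conjI lim L2_tensor Lu Lv \<phi> \<psi> S T L\<phi> L\<psi> i)
  next
    assume i: "snd i \<in> Basis" "fst i = 0" "snd i \<noteq> 0"
    have Gi: "G i = (\<lambda>z. u (fst z) * k (snd i) (snd z))" by (auto simp: G_def i fun_eq_iff)
    have pi: "pd i (\<theta> n) = (\<lambda>z. \<phi> n (fst z) * pd (snd i) (\<psi> n) (snd z))" for n
      unfolding \<theta>_def[abs_def] using i
      by (auto simp: fun_eq_iff pd_tensor test_funD(1)[OF \<phi>(1)] test_funD(1)[OF \<psi>(1)])
    show ?thesis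
      unfolding Gi pi by (intro conjI lim L2_tensor Lu Lv \<phi> \<psi> S T L\<phi> L\<psi> i)
  qed
  have "H01_approx (S \<times> T) (\<lambda>z. u (fst z) * v (snd z)) G"
  proof (rule H01_approx_limit[OF ST])
    show "L2 (S \<times> T) (\<lambda>z. u (fst z) * v (snd z))" by (intro L2_tensor Lu Lv S T)
    show "L2 (S \<times> T) (G i)" if "i \<in> Basis" for i using conv[OF that] by simp
    fix e :: real assume e: "e > 0"
    have l0: "(\<lambda>n. l2dist (S \<times> T) (\<lambda>z. u (fst z) * v (snd z)) (\<theta> n)) \<longlonglongrightarrow> 0"
      unfolding \<theta>_def[abs_def] by (intro lim Lu Lv \<phi> \<psi> L\<phi> L\<psi>)
    have "\<forall>\<^sub>F n in sequentially. l2dist (S \<times> T) (\<lambda>z. u (fst z) * v (snd z)) (\<theta> n) < e \<and> (\<forall>i\<in>Basis. l2dist (S \<times> T) (G i) (pd i (\<theta> n)) < e)"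
      using e conv by (intro eventually_conj eventually_ball_finite ballI order_tendstoD(2)[OF l0]) (auto dest!: order_tendstoD(2))
    then obtain n where "l2dist (S \<times> T) (\<lambda>z. u (fst z) * v (snd z)) (\<theta> n) < e" "\<forall>i\<in>Basis. l2dist (S \<times> T) (G i) (pd i (\<theta> n)) < e"
      by (auto simp: eventually_sequentially)
    then show "\<exists>w k. H01_approx (S \<times> T) w k \<and> l2dist (S \<times> T) (\<lambda>z. u (fst z) * v (snd z)) w < e \<and> (\<forall>i\<in>Basis. l2dist (S \<times> T) (G i) (k i) < e)"
      using H01_approx_test_fun[OF ST t\<theta>[of n]] by blast
  qed
  then show ?thesis by (simp add: G_def[abs_def])
qed

subsection \<open>Averages over one factor\<close>

context
  fixes S :: "'a::euclidean_space set" and T :: "'b::euclidean_space set"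
  assumes S: "open S" "bounded S" and T: "open T" "bounded T"
begin

lemmas ST = open_Times[OF S(1) T(1)] bounded_Times[OF S(2) T(2)]

lemma L2_const: "L2 S (\<lambda>x. c)" "L2 T (\<lambda>x. c)"
  by (rule L2_bounded[OF S, of _ "\<bar>c\<bar>"] L2_bounded[OF T, of _ "\<bar>c\<bar>"]; simp)+

lemma L2_lift_fst: "L2 S u \<Longrightarrow> L2 (S \<times> T) (\<lambda>z. u (fst z))"
  and L2_lift_snd: "L2 T v \<Longrightarrow> L2 (S \<times> T) (\<lambda>z. v (snd z))"
  using L2_tensor[OF _ L2_const(2)[of 1] S(1) T(1), of u] L2_tensor[OF L2_const(1)[of 1] _ S(1) T(1), of v]
  by auto

text \<open>Applying Fubini to the square gives square integrability of the sections; applying it to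
  \<open>h\<close> itself, integrable on the bounded domain, gives their measurability.\<close>

lemma AE_L2_section_snd:
  assumes "L2 (S \<times> T) h"
  shows "AE x in lebesgue_on S. L2 T (\<lambda>y. h (x, y))"
  using AE_integrable_section_snd[OF L2_sq_integrable[OF assms] S(1) T(1)]
    AE_integrable_section_snd[OF L2_integrable[OF assms ST] S(1) T(1)]
  by eventually_elim (auto simp: L2_def)

lemma AE_L2_section_fst:
  assumes "L2 (S \<times> T) h"
  shows "AE y in lebesgue_on T. L2 S (\<lambda>x. h (x, y))"
  using AE_integrable_section_fst[OF L2_sq_integrable[OF assms] S(1) T(1)]
    AE_integrable_section_fst[OF L2_integrable[OF assms ST] S(1) T(1)]
  by eventually_elim (auto simp: L2_def)

lemma L2_integral_snd:
  assumes h: "L2 (S \<times> T) h" and v: "L2 T v"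
  shows "L2 S (\<lambda>x. \<integral>y. h (x, y) * v y \<partial>lebesgue_on T)"
proof -
  let ?F = "\<lambda>x. \<integral>y. h (x, y) * v y \<partial>lebesgue_on T"
  have i: "integrable (lebesgue_on (S \<times> T)) (\<lambda>z. h z * v (snd z))"
    by (rule L2_mult_integrable[OF h L2_lift_snd[OF v]])
  from integrable_section_snd[OF i S(1) T(1)] have m: "?F \<in> borel_measurable (lebesgue_on S)" by auto
  have le: "AE x in lebesgue_on S. (?F x)\<^sup>2 \<le> (l2norm T v)\<^sup>2 * (\<integral>y. (h (x, y))\<^sup>2 \<partial>lebesgue_on T)"
    using AE_L2_section_snd[OF h]
  proof eventually_elim
    case (elim x)
    from power_mono[OF L2_Cauchy_Schwarz[OF this v] abs_ge_zero, of 2] show ?case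
      by (simp add: power_mult_distrib l2norm_sq mult.commute)
  qed
  have i2: "integrable (lebesgue_on S) (\<lambda>x. (l2norm T v)\<^sup>2 * (\<integral>y. (h (x, y))\<^sup>2 \<partial>lebesgue_on T))"
    using integrable_section_snd[OF L2_sq_integrable[OF h] S(1) T(1)] by simp
  have "integrable (lebesgue_on S) (\<lambda>x. (?F x)\<^sup>2)"
    by (rule Bochner_Integration.integrable_bound[OF i2]) (use m le in auto)
  then show "L2 S ?F" using m by (simp add: L2_def)
qed

lemma
  assumes h: "L2 (S \<times> T) h" and u: "L2 S u"
  shows L2_integral_fst: "L2 T (\<lambda>y. \<integral>x. h (x, y) * u x \<partial>lebesgue_on S)"
    and l2norm_integral_fst: "l2norm T (\<lambda>y. \<integral>x. h (x, y) * u x \<partial>lebesgue_on S) \<le> l2norm (S \<times> T) h * l2norm S u"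
proof -
  let ?F = "\<lambda>y. \<integral>x. h (x, y) * u x \<partial>lebesgue_on S"
  have i: "integrable (lebesgue_on (S \<times> T)) (\<lambda>z. h z * u (fst z))"
    by (rule L2_mult_integrable[OF h L2_lift_fst[OF u]])
  from integrable_section_fst[OF i S(1) T(1)] have m: "?F \<in> borel_measurable (lebesgue_on T)" by auto
  have le: "AE y in lebesgue_on T. (?F y)\<^sup>2 \<le> (l2norm S u)\<^sup>2 * (\<integral>x. (h (x, y))\<^sup>2 \<partial>lebesgue_on S)"
    using AE_L2_section_fst[OF h]
  proof eventually_elim
    case (elim y)
    from power_mono[OF L2_Cauchy_Schwarz[OF this u] abs_ge_zero, of 2] show ?case
      by (simp add: power_mult_distrib l2norm_sq mult.commute)
  qed
  have i2: "integrable (lebesgue_on T) (\<lambda>y. (l2norm S u)\<^sup>2 * (\<integral>x. (h (x, y))\<^sup>2 \<partial>lebesgue_on S))"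
    using integrable_section_fst[OF L2_sq_integrable[OF h] S(1) T(1)] by simp
  have "integrable (lebesgue_on T) (\<lambda>y. (?F y)\<^sup>2)"
    by (rule Bochner_Integration.integrable_bound[OF i2]) (use m le in auto)
  then show L: "L2 T ?F" using m by (simp add: L2_def)
  have "(l2norm T ?F)\<^sup>2 = (\<integral>x. (?F x)\<^sup>2 \<partial>lebesgue_on T)" by (rule l2norm_sq)
  also have "\<dots> \<le> (\<integral>y. (l2norm S u)\<^sup>2 * (\<integral>x. (h (x, y))\<^sup>2 \<partial>lebesgue_on S) \<partial>lebesgue_on T)"
    by (rule integral_mono_AE[OF L2_sq_integrable[OF L] i2 le])
  also have "\<dots> = (l2norm (S \<times> T) h * l2norm S u)\<^sup>2"
    using integral_section_fst[OF L2_sq_integrable[OF h] S(1) T(1)] by (simp add: power_mult_distrib l2norm_sq)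
  finally show "l2norm T ?F \<le> l2norm (S \<times> T) h * l2norm S u"
    by (rule power2_le_imp_le) simp
qed

section \<open>Finite averages of sections\<close>

lemma measure_S_pos:
  assumes "S \<noteq> {}"
  shows "measure (lebesgue_on S) S > 0"
proof -
  have "emeasure lborel S \<noteq> 0"
    using open_not_negligible[OF S(1) assms] S(1) by (auto simp: negligible_iff_emeasure0 null_sets_def)
  have "emeasure (lebesgue_on S) S = emeasure lborel S"
    using S(1) by (simp add: emeasure_restrict_space)
  moreover have "emeasure (lebesgue_on S) S < \<infinity>"
    using finite_measure.emeasure_finite[OF finite_measure_lebesgue_on_bounded[OF S], of S] by (simp add: top.not_eq_extremum)
  ultimately show ?thesis
    using \<open>emeasure lborel S \<noteq> 0\<close> by (simp add: measure_def enn2real_positive_iff zero_less_iff_neq_zero)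
qed

text \<open>A derandomised law of large numbers: since \<open>H c\<close> has mean zero over \<open>S\<close>, the sample points can be
  chosen one after the other so that the squared norm of the sum grows at most by the variance.\<close>
lemma greedy_samples:
  fixes H :: "'c \<Rightarrow> 'a \<times> 'b \<Rightarrow> real"
  assumes ne: "S \<noteq> {}" and fin: "finite C" and H: "\<And>c. c \<in> C \<Longrightarrow> L2 (S \<times> T) (H c)"
    and mean0: "\<And>c s. c \<in> C \<Longrightarrow> L2 T s \<Longrightarrow> (\<integral>z. s (snd z) * H c z \<partial>lebesgue_on (S \<times> T)) = 0"
    and Q: "AE y in lebesgue_on S. Q y"
  shows "\<exists>ys :: nat \<Rightarrow> 'a. (\<forall>k<N. Q (ys k) \<and> (\<forall>c\<in>C. L2 T (\<lambda>x. H c (ys k, x)))) \<and>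
    (\<Sum>c\<in>C. (l2norm T (\<lambda>x. \<Sum>k<N. H c (ys k, x)))\<^sup>2)
      \<le> real N * ((\<Sum>c\<in>C. (l2norm (S \<times> T) (H c))\<^sup>2) / measure (lebesgue_on S) S)"
proof (induction N)
  case 0
  then show ?case by simp
next
  case (Suc N)
  define \<mu> where "\<mu> = measure (lebesgue_on S) S"
  have \<mu>: "\<mu> > 0" unfolding \<mu>_def by (rule measure_S_pos[OF ne])
  define V where "V = (\<Sum>c\<in>C. (l2norm (S \<times> T) (H c))\<^sup>2) / \<mu>"
  obtain ys where ys: "\<And>k. k < N \<Longrightarrow> Q (ys k)" "\<And>k c. k < N \<Longrightarrow> c \<in> C \<Longrightarrow> L2 T (\<lambda>x. H c (ys k, x))"
    "(\<Sum>c\<in>C. (l2norm T (\<lambda>x. \<Sum>k<N. H c (ys k, x)))\<^sup>2) \<le> real N * V"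
    using Suc.IH unfolding V_def \<mu>_def by blast
  define s where "s c x = (\<Sum>k<N. H c (ys k, x))" for c x
  have s: "L2 T (s c)" if "c \<in> C" for c
    unfolding s_def[abs_def] using ys(2) that by (intro L2_sum) auto
  \<comment> \<open>\<open>m\<close> is the mean over \<open>S\<close> of the function
    \<open>k\<close> defined below: the cross terms vanish by \<open>mean0\<close>, and
    \<open>V\<close> is the mean of the added squares.\<close>
  define m where "m = (\<Sum>c\<in>C. (l2norm T (s c))\<^sup>2) + V"
  define f where "f z = (\<Sum>c\<in>C. (s c (snd z) + H c z)\<^sup>2)" for z
  have Ls: "L2 (S \<times> T) (\<lambda>z. s c (snd z) + H c z)" if "c \<in> C" for c
    by (intro L2_add L2_lift_snd s H that)
  have if': "integrable (lebesgue_on (S \<times> T)) f"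
    unfolding f_def[abs_def] by (intro Bochner_Integration.integrable_sum L2_sq_integrable Ls)
  have "integral\<^sup>L (lebesgue_on (S \<times> T)) f = (\<Sum>c\<in>C. \<integral>z. (s c (snd z) + H c z)\<^sup>2 \<partial>lebesgue_on (S \<times> T))"
    unfolding f_def by (rule Bochner_Integration.integral_sum) (intro L2_sq_integrable Ls)
  also have "\<dots> = (\<Sum>c\<in>C. \<mu> * (l2norm T (s c))\<^sup>2 + (l2norm (S \<times> T) (H c))\<^sup>2)"
  proof (rule sum.cong[OF refl])
    fix c assume c: "c \<in> C"
    have "(\<integral>z. (s c (snd z) + H c z)\<^sup>2 \<partial>lebesgue_on (S \<times> T))
      = (\<integral>z. (s c (snd z))\<^sup>2 \<partial>lebesgue_on (S \<times> T)) + (\<integral>z. (H c z)\<^sup>2 \<partial>lebesgue_on (S \<times> T)) + 2 * (\<integral>z. s c (snd z) * H c z \<partial>lebesgue_on (S \<times> T))"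
      using L2_sq_integrable[OF L2_lift_snd[OF s[OF c]]] L2_sq_integrable[OF H[OF c]] L2_mult_integrable[OF L2_lift_snd[OF s[OF c]] H[OF c]]
      unfolding power2_sum by (simp add: mult.assoc)
    also have "(\<integral>z. (s c (snd z))\<^sup>2 \<partial>lebesgue_on (S \<times> T)) = \<mu> * (l2norm T (s c))\<^sup>2"
      using integral_section_snd[OF L2_sq_integrable[OF L2_lift_snd[OF s[OF c]]] S(1) T(1)]
      by (simp add: \<mu>_def l2norm_sq)
    finally show "(\<integral>z. (s c (snd z) + H c z)\<^sup>2 \<partial>lebesgue_on (S \<times> T)) = \<mu> * (l2norm T (s c))\<^sup>2 + (l2norm (S \<times> T) (H c))\<^sup>2"
      using mean0[OF c s[OF c]] by (simp add: l2norm_sq)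
  qed
  also have "\<dots> = \<mu> * m"
    using \<mu> by (simp add: m_def V_def sum.distrib distrib_left flip: sum_distrib_left)
  finally have If: "integral\<^sup>L (lebesgue_on (S \<times> T)) f = \<mu> * m" .
  define k where "k y = (\<integral>x. f (y, x) \<partial>lebesgue_on T)" for y
  have ik: "integrable (lebesgue_on S) k"
    unfolding k_def by (rule integrable_section_snd[OF if' S(1) T(1)])
  interpret finite_measure "lebesgue_on S" by (rule finite_measure_lebesgue_on_bounded[OF S])
  have "(\<integral>y. k y \<partial>lebesgue_on S) = \<mu> * m"
    unfolding k_def integral_section_snd[OF if' S(1) T(1), symmetric] by (rule If)
  then have Ik: "(\<integral>y. k y - m \<partial>lebesgue_on S) = 0"
    using ik by (simp add: \<mu>_def)
  have good: "AE y in lebesgue_on S. Q y \<and> (\<forall>c\<in>C. L2 T (\<lambda>x. H c (y, x)))"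
    using Q AE_L2_section_snd[OF H] fin by (auto simp: AE_finite_all)
  \<comment> \<open>On a set of positive measure a function cannot exceed its mean almost
    everywhere, so some y outside the exceptional null set satisfies k y \<le> m.\<close>
  have "\<exists>y. Q y \<and> (\<forall>c\<in>C. L2 T (\<lambda>x. H c (y, x))) \<and> k y \<le> m"
  proof (rule ccontr)
    assume no: "\<not> ?thesis"
    have gt: "AE y in lebesgue_on S. k y - m > 0"
      using good by eventually_elim (use no in force)
    then have "AE y in lebesgue_on S. 0 \<le> k y - m" by eventually_elim simp
    with Ik ik have "AE y in lebesgue_on S. k y - m = 0"
      by (subst (asm) integral_nonneg_eq_0_iff_AE) auto
    with gt have "AE y in lebesgue_on S. False" by eventually_elim simp
    then have "emeasure (lebesgue_on S) (space (lebesgue_on S)) = 0"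
      by (simp add: AE_iff_null null_sets_def)
    then show False using \<mu> by (simp add: \<mu>_def measure_def)
  qed
  then obtain y where y: "Q y" "\<And>c. c \<in> C \<Longrightarrow> L2 T (\<lambda>x. H c (y, x))" "k y \<le> m" by blast
  define ys' where "ys' = ys(N := y)"
  have sum': "(\<Sum>k<Suc N. H c (ys' k, x)) = s c x + H c (y, x)" for c x
    by (simp add: s_def ys'_def)
  have "(\<Sum>c\<in>C. (l2norm T (\<lambda>x. \<Sum>k<Suc N. H c (ys' k, x)))\<^sup>2) = (\<Sum>c\<in>C. \<integral>x. (s c x + H c (y, x))\<^sup>2 \<partial>lebesgue_on T)"
    unfolding sum' l2norm_sq ..
  also have "\<dots> = k y"
    unfolding k_def f_def using y(2) s
    by (subst Bochner_Integration.integral_sum) (auto intro!: L2_sq_integrable L2_add)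
  also have "\<dots> \<le> real (Suc N) * V" using y(3) ys(3) by (simp add: m_def s_def[abs_def] algebra_simps)
  finally have "(\<Sum>c\<in>C. (l2norm T (\<lambda>x. \<Sum>k<Suc N. H c (ys' k, x)))\<^sup>2) \<le> real (Suc N) * V" .
  moreover have "\<forall>k<Suc N. Q (ys' k) \<and> (\<forall>c\<in>C. L2 T (\<lambda>x. H c (ys' k, x)))"
    using ys y by (auto simp: ys'_def less_Suc_eq)
  ultimately show ?case unfolding V_def \<mu>_def by blast
qed

text \<open>Countably many test functions, so that the exceptional null set does not depend on \<open>\<phi>\<close>; they still
  determine weak derivatives by density.\<close>
lemma AE_section_weak_pderiv:
  assumes w: "L2 (S \<times> T) w" and g: "L2 (S \<times> T) g" and wd: "weak_pderiv (S \<times> T) (0, e) w g"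
  shows "AE y in lebesgue_on S. \<forall>\<phi>\<in>bumps T.
    (\<integral>x. w (y, x) * pd e \<phi> x \<partial>lebesgue_on T) = - (\<integral>x. g (y, x) * \<phi> x \<partial>lebesgue_on T)"
  unfolding AE_ball_countable[OF countable_bumps]
proof
  fix \<phi> assume "\<phi> \<in> bumps T"
  then have \<phi>: "test_fun T \<phi>" by (rule bumps_test_fun)
  note L\<phi> = test_fun_L2[OF \<phi> T] test_fun_L2[OF test_fun_pd[OF \<phi>, of e] T]
  let ?F = "\<lambda>y. (\<integral>x. w (y, x) * pd e \<phi> x \<partial>lebesgue_on T) + (\<integral>x. g (y, x) * \<phi> x \<partial>lebesgue_on T)"
  have "AE y in lebesgue_on S. ?F y = 0"
  \<comment> \<open>By Fubini, orthogonality of \<open>?F\<close> to \<beta> is the weak identity on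
    the product, tested with \<beta> \<otimes> \<phi>.\<close>
  proof (rule AE_zero_if_orthogonal_bumps[OF S])
    show "L2 S ?F" by (intro L2_add L2_integral_snd w g L\<phi>)
    fix \<beta> assume "\<beta> \<in> bumps S"
    then have \<beta>: "test_fun S \<beta>" by (rule bumps_test_fun)
    note L\<beta> = test_fun_L2[OF \<beta> S]
    have t: "test_fun (S \<times> T) (\<lambda>z. \<beta> (fst z) * \<phi> (snd z))" by (rule test_fun_tensor[OF \<beta> \<phi>])
    have pdt: "pd (0, e) (\<lambda>z. \<beta> (fst z) * \<phi> (snd z)) z = \<beta> (fst z) * pd e \<phi> (snd z)" for z
      by (simp add: pd_tensor test_funD(1)[OF \<beta>] test_funD(1)[OF \<phi>])
    have i1: "integrable (lebesgue_on (S \<times> T)) (\<lambda>z. w z * (\<beta> (fst z) * pd e \<phi> (snd z)))"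
      by (intro L2_mult_integrable w L2_tensor L\<beta> L\<phi> S T)
    have i2: "integrable (lebesgue_on (S \<times> T)) (\<lambda>z. g z * (\<beta> (fst z) * \<phi> (snd z)))"
      by (intro L2_mult_integrable g L2_tensor L\<beta> L\<phi> S T)
    have e1: "(\<integral>z. w z * (\<beta> (fst z) * pd e \<phi> (snd z)) \<partial>lebesgue_on (S \<times> T)) = (\<integral>y. (\<integral>x. w (y, x) * pd e \<phi> x \<partial>lebesgue_on T) * \<beta> y \<partial>lebesgue_on S)"
      unfolding integral_section_snd[OF i1 S(1) T(1)] by (simp flip: integral_mult_left_zero add: ac_simps)
    have e2: "(\<integral>z. g z * (\<beta> (fst z) * \<phi> (snd z)) \<partial>lebesgue_on (S \<times> T)) = (\<integral>y. (\<integral>x. g (y, x) * \<phi> x \<partial>lebesgue_on T) * \<beta> y \<partial>lebesgue_on S)"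
      unfolding integral_section_snd[OF i2 S(1) T(1)] by (simp flip: integral_mult_left_zero add: ac_simps)
    have "(\<integral>z. w z * (\<beta> (fst z) * pd e \<phi> (snd z)) \<partial>lebesgue_on (S \<times> T)) = - (\<integral>z. g z * (\<beta> (fst z) * \<phi> (snd z)) \<partial>lebesgue_on (S \<times> T))"
      using weak_pderivD(3)[OF wd t] unfolding pdt .
    then show "(\<integral>y. ?F y * \<beta> y \<partial>lebesgue_on S) = 0"
      unfolding e1 e2 using L2_mult_integrable[OF L2_integral_snd[OF w L\<phi>(2)] L\<beta>] L2_mult_integrable[OF L2_integral_snd[OF g L\<phi>(1)] L\<beta>]
      by (simp add: distrib_right)
  qed
  then show "AE y in lebesgue_on S. (\<integral>x. w (y, x) * pd e \<phi> x \<partial>lebesgue_on T) = - (\<integral>x. g (y, x) * \<phi> x \<partial>lebesgue_on T)"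
    by eventually_elim simp
qed

text \<open>The H01 hypothesis gives each section some gradient \<open>k\<close>, unrelated to the
  others. Both \<open>k\<close> and the section of \<open>g\<close> satisfy the same identities
  against all bumps, so they agree almost everywhere and the jointly defined \<open>g\<close> may be
  used.\<close>

lemma AE_section_H01_approx:
  assumes w: "L2 (S \<times> T) w" and g: "\<And>i. i \<in> Basis \<Longrightarrow> L2 (S \<times> T) (g i)"
    and wd: "\<And>i. i \<in> Basis \<Longrightarrow> weak_pderiv (S \<times> T) (0, i) w (g i)"
    and H: "AE y in lebesgue_on S. H01 T (\<lambda>x. w (y, x))"
  shows "AE y in lebesgue_on S. H01_approx T (\<lambda>x. w (y, x)) (\<lambda>i x. g i (y, x))"
proof -
  have "AE y in lebesgue_on S. \<forall>i\<in>Basis. L2 T (\<lambda>x. g i (y, x))"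
    using AE_L2_section_snd[OF g] by (simp add: AE_finite_all)
  moreover have "AE y in lebesgue_on S. \<forall>i\<in>Basis. \<forall>\<phi>\<in>bumps T.
    (\<integral>x. w (y, x) * pd i \<phi> x \<partial>lebesgue_on T) = - (\<integral>x. g i (y, x) * \<phi> x \<partial>lebesgue_on T)"
    using AE_section_weak_pderiv[OF w g wd] by (simp add: AE_finite_all)
  ultimately show ?thesis using H
  proof eventually_elim
    case (elim y)
    obtain k where k: "H01_approx T (\<lambda>x. w (y, x)) k"
      using H01_obtain_approx[OF T elim(3)] by blast
    show ?case
    proof (rule H01_approx_cong_grad[OF T k])
      fix i :: 'b assume i: "i \<in> Basis"
      show "L2 T (\<lambda>x. g i (y, x))" using elim(1) i by blast
      then show "AE x in lebesgue_on T. k i x = g i (y, x)"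
      proof (rule AE_eq_if_weak_pderiv_bumps[OF T H01_approxD(2)[OF k i]])
        fix \<phi> assume \<phi>: "\<phi> \<in> bumps T"
        show "(\<integral>x. k i x * \<phi> x \<partial>lebesgue_on T) = (\<integral>x. g i (y, x) * \<phi> x \<partial>lebesgue_on T)"
          using weak_pderivD(3)[OF H01_approx_weak_pderiv[OF T k i] bumps_test_fun[OF \<phi>]] elim(2) i \<phi> by auto
      qed
    qed
  qed
qed

text \<open>Finite weighted sums of good sections belong to H01. Sample points for which they are
  close to the integral, together with all derivatives, come from \<open>greedy_samples\<close>;
  closedness of H01 under such limits finishes.\<close>

lemma average_H01_approx:
  assumes ne: "S \<noteq> {}" and w: "L2 (S \<times> T) w" and g: "\<And>i. i \<in> Basis \<Longrightarrow> L2 (S \<times> T) (g i)"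
    and wd: "\<And>i. i \<in> Basis \<Longrightarrow> weak_pderiv (S \<times> T) (0, i) w (g i)"
    and H01: "AE y in lebesgue_on S. H01 T (\<lambda>x. w (y, x))" and b: "test_fun S b"
  shows "H01_approx T (\<lambda>x. \<integral>y. w (y, x) * b y \<partial>lebesgue_on S) (\<lambda>i x. \<integral>y. g i (y, x) * b y \<partial>lebesgue_on S)"
proof -
  note Lb = test_fun_L2[OF b S]
  define \<mu> where "\<mu> = measure (lebesgue_on S) S"
  have \<mu>: "\<mu> > 0" unfolding \<mu>_def by (rule measure_S_pos[OF ne])
  \<comment> \<open>The index 0, which is no basis vector, stands for the function itself. One
    choice of sample points must serve the function and all its partial derivatives
    simultaneously.\<close>
  define C where "C = insert 0 (Basis :: 'b set)"
  define W where "W c = (if c = 0 then w else g c)" for c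
  have LW: "L2 (S \<times> T) (W c)" if "c \<in> C" for c
    using that w g by (auto simp: W_def C_def)
  define p where "p c x = (\<integral>y. W c (y, x) * b y \<partial>lebesgue_on S)" for c x
  have Lp: "L2 T (p c)" if "c \<in> C" for c
    unfolding p_def[abs_def] by (rule L2_integral_fst[OF LW[OF that] Lb])
  \<comment> \<open>Subtracting p / \<mu> centres the samples: its integral over \<open>S\<close> is
    p, the same as that of b W.\<close>
  define H where "H c z = b (fst z) * W c z - p c (snd z) / \<mu>" for c z
  have LbW: "L2 (S \<times> T) (\<lambda>z. b (fst z) * W c z)" if "c \<in> C" for c
  proof -
    obtain M where M: "\<And>x. \<bar>b x\<bar> \<le> M" using test_fun_bounded[OF b] by metis
    have "(\<lambda>z. b (fst z)) \<in> borel_measurable (lebesgue_on (S \<times> T))"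
      by (rule L2_measurable[OF L2_lift_fst[OF Lb]])
    from L2_bounded_mult(1)[OF LW[OF that] this] M show ?thesis by auto
  qed
  have LH: "L2 (S \<times> T) (H c)" if "c \<in> C" for c
    unfolding H_def[abs_def] by (intro L2_diff LbW L2_divide L2_lift_snd Lp that)
  have mean0: "(\<integral>z. s (snd z) * H c z \<partial>lebesgue_on (S \<times> T)) = 0" if c: "c \<in> C" and s: "L2 T s" for c s
  proof -
    have i1: "integrable (lebesgue_on (S \<times> T)) (\<lambda>z. s (snd z) * (b (fst z) * W c z))"
      by (intro L2_mult_integrable L2_lift_snd LbW c s)
    have i2: "integrable (lebesgue_on (S \<times> T)) (\<lambda>z. s (snd z) * p c (snd z))"
      by (intro L2_mult_integrable L2_lift_snd Lp c s)
    have "(\<integral>z. s (snd z) * H c z \<partial>lebesgue_on (S \<times> T))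
      = (\<integral>z. s (snd z) * (b (fst z) * W c z) \<partial>lebesgue_on (S \<times> T)) - (\<integral>z. s (snd z) * p c (snd z) \<partial>lebesgue_on (S \<times> T)) / \<mu>"
      using i1 i2 by (simp add: H_def right_diff_distrib)
    also have "(\<integral>z. s (snd z) * (b (fst z) * W c z) \<partial>lebesgue_on (S \<times> T)) = (\<integral>x. s x * p c x \<partial>lebesgue_on T)"
      unfolding integral_section_fst[OF i1 S(1) T(1)] p_def by (simp add: mult.commute)
    also have "(\<integral>z. s (snd z) * p c (snd z) \<partial>lebesgue_on (S \<times> T)) = \<mu> * (\<integral>x. s x * p c x \<partial>lebesgue_on T)"
      unfolding integral_section_snd[OF i2 S(1) T(1)] by (simp add: \<mu>_def)
    finally show ?thesis using \<mu> by simp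
  qed
  have Q: "AE y in lebesgue_on S. H01_approx T (\<lambda>x. w (y, x)) (\<lambda>i x. g i (y, x))"
    by (rule AE_section_H01_approx[OF w g wd H01])
  define V where "V = (\<Sum>c\<in>C. (l2norm (S \<times> T) (H c))\<^sup>2) / \<mu>"
  have V: "V \<ge> 0" using \<mu> by (auto simp: V_def intro!: divide_nonneg_pos sum_nonneg)
  have fC: "finite C" by (simp add: C_def)
  have "H01_approx T (p 0) p"
  proof (rule H01_approx_limit[OF T])
    show "L2 T (p 0)" "\<And>i. i \<in> Basis \<Longrightarrow> L2 T (p i)" using Lp by (auto simp: C_def)
    fix e :: real assume e: "e > 0"
    \<comment> \<open>The squared error of the averages will be at most \<mu>^2 V / N; passing to a
      successor keeps N positive.\<close>
    obtain N :: nat where N: "N > 0" "\<mu>\<^sup>2 * V < real N * e\<^sup>2"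
    proof -
      obtain n :: nat where "\<mu>\<^sup>2 * V / e\<^sup>2 < real n" using reals_Archimedean2 by blast
      then have "\<mu>\<^sup>2 * V < real n * e\<^sup>2" using e by (simp add: field_simps)
      moreover have "real n * e\<^sup>2 \<le> real (Suc n) * e\<^sup>2" by (intro mult_right_mono) auto
      ultimately show ?thesis using that[of "Suc n"] by simp
    qed
    obtain ys where ys: "\<And>k. k < N \<Longrightarrow> H01_approx T (\<lambda>x. w (ys k, x)) (\<lambda>i x. g i (ys k, x))"
      "\<And>k c. k < N \<Longrightarrow> c \<in> C \<Longrightarrow> L2 T (\<lambda>x. H c (ys k, x))"
      "(\<Sum>c\<in>C. (l2norm T (\<lambda>x. \<Sum>k<N. H c (ys k, x)))\<^sup>2) \<le> real N * V"
      using greedy_samples[where H = H and C = C and N = N, OF ne fC LH mean0 Q] unfolding V_def \<mu>_def by blast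
    \<comment> \<open>The equal-weight quadrature for the integral of b W over \<open>S\<close>, a
      set of measure \<mu>, at the points \<open>ys k\<close>.\<close>
    define v where "v c x = (\<Sum>k<N. (\<mu> / real N * b (ys k)) * W c (ys k, x))" for c x
    have "H01_approx T (\<lambda>x. \<Sum>k<N. (\<mu> / real N * b (ys k)) * w (ys k, x)) (\<lambda>i x. \<Sum>k<N. (\<mu> / real N * b (ys k)) * g i (ys k, x))"
      using ys(1) by (intro H01_approx_sum[OF T] H01_approx_cmult[OF T]) auto
    moreover have "(\<lambda>x. \<Sum>k<N. (\<mu> / real N * b (ys k)) * w (ys k, x)) = v 0" by (auto simp: v_def W_def fun_eq_iff)
    ultimately have Hv: "H01_approx T (v 0) (\<lambda>i x. \<Sum>k<N. (\<mu> / real N * b (ys k)) * g i (ys k, x))" by simp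
    have vg: "(\<Sum>k<N. (\<mu> / real N * b (ys k)) * g i (ys k, x)) = v i x" if "i \<in> Basis" for i x
      using that by (auto simp: v_def W_def)
    have close: "l2dist T (p c) (v c) < e" if c: "c \<in> C" for c
    proof -
      have "v c x - p c x = \<mu> / real N * (\<Sum>k<N. H c (ys k, x))" for x
      proof -
        have "\<mu> / real N * (\<Sum>k<N. H c (ys k, x)) = (\<Sum>k<N. \<mu> / real N * b (ys k) * W c (ys k, x) - p c x / real N)"
          unfolding sum_distrib_left by (rule sum.cong[OF refl]) (use \<mu> in \<open>simp add: H_def right_diff_distrib\<close>)
        also have "\<dots> = v c x - p c x" using N(1) by (simp add: sum_subtractf v_def)
        finally show ?thesis ..
      qed
      then have "l2dist T (v c) (p c) = l2norm T (\<lambda>x. \<mu> / real N * (\<Sum>k<N. H c (ys k, x)))" by (simp only:)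
      then have "l2dist T (p c) (v c) = \<mu> / real N * l2norm T (\<lambda>x. \<Sum>k<N. H c (ys k, x))"
        using \<mu> unfolding l2norm_cmult l2norm_minus_commute[of T "p c"] by simp
      moreover have "(l2norm T (\<lambda>x. \<Sum>k<N. H c (ys k, x)))\<^sup>2 \<le> real N * V"
        using member_le_sum[OF c, of "\<lambda>c. (l2norm T (\<lambda>x. \<Sum>k<N. H c (ys k, x)))\<^sup>2"] fC ys(3) by simp
      ultimately have "(l2dist T (p c) (v c))\<^sup>2 \<le> (\<mu> / real N)\<^sup>2 * (real N * V)"
        by (simp only: power_mult_distrib mult_left_mono zero_le_power2)
      also have "\<dots> = \<mu>\<^sup>2 * V / real N" using N(1) by (simp add: power2_eq_square)
      also have "\<dots> < e\<^sup>2" using N by (simp add: field_simps)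
      finally show ?thesis using e by (intro power2_less_imp_less[of _ e]) auto
    qed
    show "\<exists>v k. H01_approx T v k \<and> l2dist T (p 0) v < e \<and> (\<forall>i\<in>Basis. l2dist T (p i) (k i) < e)"
    proof (intro exI conjI ballI)
      show "H01_approx T (v 0) (\<lambda>i x. \<Sum>k<N. (\<mu> / real N * b (ys k)) * g i (ys k, x))" by (rule Hv)
      show "l2dist T (p 0) (v 0) < e" by (rule close) (simp add: C_def)
      fix i :: 'b assume i: "i \<in> Basis"
      show "l2dist T (p i) (\<lambda>x. \<Sum>k<N. (\<mu> / real N * b (ys k)) * g i (ys k, x)) < e"
        unfolding vg[OF i] by (rule close) (use i in \<open>simp add: C_def\<close>)
    qed
  qed
  moreover have "p 0 = (\<lambda>x. \<integral>y. w (y, x) * b y \<partial>lebesgue_on S)" by (simp add: p_def[abs_def] W_def)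
  ultimately have "H01_approx T (\<lambda>x. \<integral>y. w (y, x) * b y \<partial>lebesgue_on S) p" by simp
  then show ?thesis
    by (rule H01_approx_cong_grad[OF T]) (use Lp in \<open>auto simp: p_def W_def C_def L2_integral_fst[OF g Lb]\<close>)
qed

end

subsection \<open>The limit operator\<close>

lemma sum_Basis_prod:
  fixes f :: "'a::euclidean_space \<times> 'b::euclidean_space \<Rightarrow> real"
  shows "(\<Sum>i\<in>Basis. f i) = (\<Sum>i\<in>Basis. f (i, 0)) + (\<Sum>i\<in>Basis. f (0, i))"
  unfolding Basis_prod_def by (subst sum.union_disjoint) (auto simp: sum.reindex inj_on_def)

lemma linear_inner_expand:
  fixes L :: "'c::euclidean_space \<Rightarrow> 'c"
  assumes "linear L"
  shows "L \<xi> \<bullet> \<eta> = (\<Sum>i\<in>Basis. \<Sum>j\<in>Basis. (L j \<bullet> i) * (\<xi> \<bullet> j) * (\<eta> \<bullet> i))"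
proof -
  have "L \<xi> = (\<Sum>j\<in>Basis. (\<xi> \<bullet> j) *\<^sub>R L j)"
    using linear_sum[OF assms, of "\<lambda>j. (\<xi> \<bullet> j) *\<^sub>R j" Basis] by (simp add: euclidean_representation linear_scale[OF assms])
  then have "L \<xi> \<bullet> i = (\<Sum>j\<in>Basis. (L j \<bullet> i) * (\<xi> \<bullet> j))" for i
    by (simp add: inner_sum_left mult.commute)
  then show ?thesis
    unfolding euclidean_inner[of "L \<xi>" \<eta>] by (simp add: sum_distrib_right)
qed

lemma grad_inner: "i \<in> Basis \<Longrightarrow> grad \<phi> z \<bullet> i = pd i \<phi> z"
  by (simp add: grad_def inner_sum_left inner_Basis if_distrib sum.If_cases cong: if_cong)

lemma grad2_inner: "i \<in> Basis \<Longrightarrow> grad2 \<phi> z \<bullet> i = pd (0, i) \<phi> z"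
  by (simp add: grad2_def inner_sum_left inner_Basis if_distrib sum.If_cases cong: if_cong)

lemma vector_of_components:
  "i \<in> Basis \<Longrightarrow> (\<Sum>j\<in>Basis. c j *\<^sub>R j) \<bullet> i = c i"
  by (simp add: inner_sum_left inner_Basis if_distrib sum.If_cases cong: if_cong)

locale anisotropic_operator =
  fixes S :: "'a::euclidean_space set" and T :: "'b::euclidean_space set"
    and A :: "'a \<times> 'b \<Rightarrow> 'a \<times> 'b \<Rightarrow> 'a \<times> 'b" and lam :: real
  assumes S: "open S" "bounded S" and T: "open T" "bounded T" and ne: "S \<noteq> {}"
    and lin: "\<And>z. linear (A z)" and lam_pos: "lam > 0"
    and ellip: "AE z in lebesgue_on (S \<times> T). \<forall>\<xi>. A z \<xi> \<bullet> \<xi> \<ge> lam * (norm \<xi>)\<^sup>2"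
    and Linf_A: "\<And>i j. i \<in> Basis \<Longrightarrow> j \<in> Basis \<Longrightarrow> Linf (S \<times> T) (entry A i j)"
    and A22_X2: "\<And>x y. x \<in> S \<times> T \<Longrightarrow> y \<in> S \<times> T \<Longrightarrow> snd x = snd y \<Longrightarrow> A22 A x = A22 A y"
    and W1: "\<And>i j e. i \<in> Basis \<Longrightarrow> j \<in> Basis \<Longrightarrow> e \<in> Basis \<Longrightarrow>
      \<exists>w. Linf (S \<times> T) w \<and> weak_pderiv (S \<times> T) e (entry A i j) w"
begin

lemmas ST' = ST[OF S T]

lemma Basis_snd: "j \<in> Basis \<Longrightarrow> (0, j) \<in> (Basis :: ('a \<times> 'b) set)"
  by (auto simp: Basis_prod_def)

lemma entry_mult_L2:
  assumes "i \<in> Basis" "j \<in> Basis" "L2 (S \<times> T) h"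
  shows "L2 (S \<times> T) (\<lambda>z. entry A i j z * h z)"
  using Linf_A[OF assms(1,2)] L2_bounded_mult(1)[OF assms(3)] by (auto simp: Linf_def)

lemma A22_expand:
  "A22 A z \<xi> \<bullet> \<eta> = (\<Sum>i\<in>Basis. \<Sum>j\<in>Basis. entry A (0, i) (0, j) z * (\<xi> \<bullet> j) * (\<eta> \<bullet> i))"
proof -
  have "A22 A z \<xi> \<bullet> \<eta> = A z (0, \<xi>) \<bullet> (0, \<eta>)"
    by (simp add: A22_def inner_prod_def)
  also have "\<dots> = (\<Sum>i\<in>Basis. \<Sum>j\<in>Basis. (A z j \<bullet> i) * ((0, \<xi>) \<bullet> j) * ((0, \<eta>) \<bullet> i))"
    by (rule linear_inner_expand[OF lin])
  also have "\<dots> = (\<Sum>i\<in>Basis. \<Sum>j\<in>Basis. entry A (0, i) (0, j) z * (\<xi> \<bullet> j) * (\<eta> \<bullet> i))"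
    unfolding sum_Basis_prod by (simp add: entry_def)
  finally show ?thesis .
qed

lemma A22_entry: "entry A (0, i) (0, j) z = A22 A z j \<bullet> i"
  by (simp add: entry_def A22_def inner_prod_def)

text \<open>If \<open>g\<close> consists of the partial derivatives of \<open>w\<close> in the directions of the second factor, this is the weak
  form of \<open>A0 w = f\<close>.\<close>
definition weak_eq :: "('b \<Rightarrow> 'a \<times> 'b \<Rightarrow> real) \<Rightarrow> ('a \<times> 'b \<Rightarrow> real) \<Rightarrow> bool" where
  "weak_eq g f \<longleftrightarrow> (\<forall>\<phi>. test_fun (S \<times> T) \<phi> \<longrightarrow>
    (\<Sum>i\<in>Basis. \<Sum>j\<in>Basis. \<integral>z. entry A (0, i) (0, j) z * g j z * pd (0, i) \<phi> z \<partial>lebesgue_on (S \<times> T))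
      = - (\<integral>z. f z * \<phi> z \<partial>lebesgue_on (S \<times> T)))"

lemma weak_term_integrable:
  assumes "i \<in> Basis" "j \<in> Basis" "L2 (S \<times> T) g" "L2 (S \<times> T) h"
  shows "integrable (lebesgue_on (S \<times> T)) (\<lambda>z. entry A i j z * g z * h z)"
  by (intro L2_mult_integrable entry_mult_L2 assms)

lemma test_L2: "test_fun (S \<times> T) \<phi> \<Longrightarrow> L2 (S \<times> T) \<phi>" "test_fun (S \<times> T) \<phi> \<Longrightarrow> L2 (S \<times> T) (pd e \<phi>)"
  by (intro test_fun_L2[OF _ ST'] test_fun_pd; assumption)+

lemma A22_integral:
  assumes "\<And>j. j \<in> Basis \<Longrightarrow> L2 (S \<times> T) (\<lambda>z. G z \<bullet> j)" "test_fun (S \<times> T) \<phi>"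
  shows "integrable (lebesgue_on (S \<times> T)) (\<lambda>z. A22 A z (G z) \<bullet> grad2 \<phi> z)"
    and "(\<integral>z. A22 A z (G z) \<bullet> grad2 \<phi> z \<partial>lebesgue_on (S \<times> T))
      = (\<Sum>i\<in>Basis. \<Sum>j\<in>Basis. \<integral>z. entry A (0, i) (0, j) z * (G z \<bullet> j) * pd (0, i) \<phi> z \<partial>lebesgue_on (S \<times> T))"
proof -
  have eq: "A22 A z (G z) \<bullet> grad2 \<phi> z = (\<Sum>i\<in>Basis. \<Sum>j\<in>Basis. entry A (0, i) (0, j) z * (G z \<bullet> j) * pd (0, i) \<phi> z)" for z
    unfolding A22_expand by (intro sum.cong refl) (simp add: grad2_inner)
  have i: "integrable (lebesgue_on (S \<times> T)) (\<lambda>z. entry A (0, i) (0, j) z * (G z \<bullet> j) * pd (0, i) \<phi> z)"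
    if "i \<in> Basis" "j \<in> Basis" for i j
    by (intro weak_term_integrable Basis_snd that assms(1) test_L2 assms(2))
  show "integrable (lebesgue_on (S \<times> T)) (\<lambda>z. A22 A z (G z) \<bullet> grad2 \<phi> z)"
    unfolding eq by (intro Bochner_Integration.integrable_sum i)
  show "(\<integral>z. A22 A z (G z) \<bullet> grad2 \<phi> z \<partial>lebesgue_on (S \<times> T))
      = (\<Sum>i\<in>Basis. \<Sum>j\<in>Basis. \<integral>z. entry A (0, i) (0, j) z * (G z \<bullet> j) * pd (0, i) \<phi> z \<partial>lebesgue_on (S \<times> T))"
    unfolding eq
  proof (subst Bochner_Integration.integral_sum)
    show "(\<Sum>i\<in>Basis. \<integral>z. (\<Sum>j\<in>Basis. entry A (0, i) (0, j) z * (G z \<bullet> j) * pd (0, i) \<phi> z) \<partial>lebesgue_on (S \<times> T))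
      = (\<Sum>i\<in>Basis. \<Sum>j\<in>Basis. \<integral>z. entry A (0, i) (0, j) z * (G z \<bullet> j) * pd (0, i) \<phi> z \<partial>lebesgue_on (S \<times> T))"
      by (intro sum.cong refl Bochner_Integration.integral_sum i)
  qed (intro Bochner_Integration.integrable_sum i)
qed

section \<open>The limit operator in components\<close>

lemma gen0I:
  assumes w: "L2 (S \<times> T) w" and g: "\<And>j. j \<in> Basis \<Longrightarrow> L2 (S \<times> T) (g j)"
    and wd: "\<And>j. j \<in> Basis \<Longrightarrow> weak_pderiv (S \<times> T) (0, j) w (g j)"
    and H: "AE y in lebesgue_on S. H01 T (\<lambda>x. w (y, x))" and f: "L2 (S \<times> T) f" and eq: "weak_eq g f"
  shows "gen0 S T A w f"
proof -
  define G where "G z = (\<Sum>j\<in>Basis. g j z *\<^sub>R j)" for z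
  have G: "G z \<bullet> j = g j z" if "j \<in> Basis" for z j
    unfolding G_def by (rule vector_of_components[OF that])
  have GL: "L2 (S \<times> T) (\<lambda>z. G z \<bullet> j)" if "j \<in> Basis" for j using g[OF that] by (simp add: G that)
  have wG: "weak_grad2 (S \<times> T) w G"
    unfolding weak_grad2_def using g wd by (simp add: G)
  show ?thesis
    unfolding gen0_def H01_partial_def
  proof (intro conjI exI[of _ G] allI impI)
    fix \<phi> assume \<phi>: "test_fun (S \<times> T) \<phi>"
    show "integrable (lebesgue_on (S \<times> T)) (\<lambda>z. A22 A z (G z) \<bullet> grad2 \<phi> z)" by (rule A22_integral(1)[OF GL \<phi>])
    show "integrable (lebesgue_on (S \<times> T)) (\<lambda>z. f z * \<phi> z)" by (intro L2_mult_integrable f test_L2 \<phi>)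
    show "(\<integral>z. A22 A z (G z) \<bullet> grad2 \<phi> z \<partial>lebesgue_on (S \<times> T)) = - (\<integral>z. f z * \<phi> z \<partial>lebesgue_on (S \<times> T))"
    proof -
      have "(\<Sum>i\<in>Basis. \<Sum>j\<in>Basis. \<integral>z. entry A (0, i) (0, j) z * (G z \<bullet> j) * pd (0, i) \<phi> z \<partial>lebesgue_on (S \<times> T))
        = (\<Sum>i\<in>Basis. \<Sum>j\<in>Basis. \<integral>z. entry A (0, i) (0, j) z * g j z * pd (0, i) \<phi> z \<partial>lebesgue_on (S \<times> T))"
        by (intro sum.cong refl) (simp add: G)
      then show ?thesis
        using eq \<phi> A22_integral(2)[OF GL \<phi>] unfolding weak_eq_def by simp
    qed
  qed (use w f wG H in auto)
qed

lemma gen0D: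
  assumes "gen0 S T A w f"
  shows "L2 (S \<times> T) w" "L2 (S \<times> T) f" "AE y in lebesgue_on S. H01 T (\<lambda>x. w (y, x))"
    "\<exists>g. (\<forall>j\<in>Basis. L2 (S \<times> T) (g j) \<and> weak_pderiv (S \<times> T) (0, j) w (g j)) \<and> weak_eq g f"
proof -
  show "L2 (S \<times> T) w" "L2 (S \<times> T) f" "AE y in lebesgue_on S. H01 T (\<lambda>x. w (y, x))"
    using assms unfolding gen0_def H01_partial_def by auto
  obtain G where G: "weak_grad2 (S \<times> T) w G" and eq: "\<And>\<phi>. test_fun (S \<times> T) \<phi> \<Longrightarrow>
      (\<integral>z. A22 A z (G z) \<bullet> grad2 \<phi> z \<partial>lebesgue_on (S \<times> T)) = - (\<integral>z. f z * \<phi> z \<partial>lebesgue_on (S \<times> T))"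
    using assms unfolding gen0_def by blast
  have GL: "L2 (S \<times> T) (\<lambda>z. G z \<bullet> j)" if "j \<in> Basis" for j using G that by (simp add: weak_grad2_def)
  have "weak_eq (\<lambda>j z. G z \<bullet> j) f"
    unfolding weak_eq_def
  proof (intro allI impI)
    fix \<phi> assume \<phi>: "test_fun (S \<times> T) \<phi>"
    show "(\<Sum>i\<in>Basis. \<Sum>j\<in>Basis. \<integral>z. entry A (0, i) (0, j) z * (G z \<bullet> j) * pd (0, i) \<phi> z \<partial>lebesgue_on (S \<times> T))
      = - (\<integral>z. f z * \<phi> z \<partial>lebesgue_on (S \<times> T))"
      using eq[OF \<phi>] A22_integral(2)[OF GL \<phi>] by simp
  qed
  then show "\<exists>g. (\<forall>j\<in>Basis. L2 (S \<times> T) (g j) \<and> weak_pderiv (S \<times> T) (0, j) w (g j)) \<and> weak_eq g f"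
    using G by (intro exI[of _ "\<lambda>j z. G z \<bullet> j"]) (simp add: weak_grad2_def)
qed

text \<open>The operator only asserts that some gradient satisfies the equation. Weak derivatives in
  L2 are unique up to null sets, so a gradient with known structure can be inserted.\<close>

lemma gen0_weak_eq:
  assumes "gen0 S T A w f" "\<And>j. j \<in> Basis \<Longrightarrow> L2 (S \<times> T) (g j)"
    and "\<And>j. j \<in> Basis \<Longrightarrow> weak_pderiv (S \<times> T) (0, j) w (g j)"
  shows "weak_eq g f"
proof -
  obtain k where k: "\<And>j. j \<in> Basis \<Longrightarrow> L2 (S \<times> T) (k j)"
    "\<And>j. j \<in> Basis \<Longrightarrow> weak_pderiv (S \<times> T) (0, j) w (k j)" "weak_eq k f"
    using gen0D(4)[OF assms(1)] by blast
  have "(\<integral>z. entry A (0, i) (0, j) z * g j z * pd (0, i) \<phi> z \<partial>lebesgue_on (S \<times> T))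
      = (\<integral>z. entry A (0, i) (0, j) z * k j z * pd (0, i) \<phi> z \<partial>lebesgue_on (S \<times> T))"
    if "i \<in> Basis" "j \<in> Basis" "test_fun (S \<times> T) \<phi>" for i j \<phi>
  proof (rule integral_cong_AE)
    show "AE z in lebesgue_on (S \<times> T). entry A (0, i) (0, j) z * g j z * pd (0, i) \<phi> z
        = entry A (0, i) (0, j) z * k j z * pd (0, i) \<phi> z"
      using weak_pderiv_unique[OF ST' assms(3)[OF that(2)] k(2)[OF that(2)] assms(2)[OF that(2)] k(1)[OF that(2)]]
      by eventually_elim simp
  qed (intro borel_measurable_integrable weak_term_integrable Basis_snd that assms(2) k(1) test_L2)+
  then show ?thesis using k(3) unfolding weak_eq_def by simp
qed

text \<open>In div(A grad u) the entry (i, j) is differentiated only in direction i, so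
  \<open>a'\<close> has two indices. The finitely many essential bounds are merged into a single
  M.\<close>

lemma coefficients:
  obtains a' M where "M \<ge> 0"
    "\<And>i j. i \<in> Basis \<Longrightarrow> j \<in> Basis \<Longrightarrow> Linf (S \<times> T) (a' i j)"
    "\<And>i j. i \<in> Basis \<Longrightarrow> j \<in> Basis \<Longrightarrow> weak_pderiv (S \<times> T) i (entry A i j) (a' i j)"
    "\<And>i j. i \<in> Basis \<Longrightarrow> j \<in> Basis \<Longrightarrow> AE z in lebesgue_on (S \<times> T). \<bar>entry A i j z\<bar> \<le> M"
    "\<And>i j. i \<in> Basis \<Longrightarrow> j \<in> Basis \<Longrightarrow> AE z in lebesgue_on (S \<times> T). \<bar>a' i j z\<bar> \<le> M"
proof -
  have "\<forall>i j. \<exists>w. i \<in> Basis \<longrightarrow> j \<in> Basis \<longrightarrow> Linf (S \<times> T) w \<and> weak_pderiv (S \<times> T) i (entry A i j) w"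
    using W1 by metis
  then obtain a' where a': "\<And>i j. i \<in> Basis \<Longrightarrow> j \<in> Basis \<Longrightarrow> Linf (S \<times> T) (a' i j)"
    "\<And>i j. i \<in> Basis \<Longrightarrow> j \<in> Basis \<Longrightarrow> weak_pderiv (S \<times> T) i (entry A i j) (a' i j)"
    by metis
  have "\<forall>i j. \<exists>m. i \<in> Basis \<longrightarrow> j \<in> Basis \<longrightarrow>
      (AE z in lebesgue_on (S \<times> T). \<bar>entry A i j z\<bar> \<le> m) \<and> (AE z in lebesgue_on (S \<times> T). \<bar>a' i j z\<bar> \<le> m)"
  proof (intro allI)
    fix i j
    show "\<exists>m. i \<in> Basis \<longrightarrow> j \<in> Basis \<longrightarrow>
      (AE z in lebesgue_on (S \<times> T). \<bar>entry A i j z\<bar> \<le> m) \<and> (AE z in lebesgue_on (S \<times> T). \<bar>a' i j z\<bar> \<le> m)"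
    proof (cases "i \<in> Basis \<and> j \<in> Basis")
      case True
      obtain m1 m2 where "AE z in lebesgue_on (S \<times> T). \<bar>entry A i j z\<bar> \<le> m1" "AE z in lebesgue_on (S \<times> T). \<bar>a' i j z\<bar> \<le> m2"
        using Linf_A[of i j] a'(1)[of i j] True unfolding Linf_def by blast
      then have "AE z in lebesgue_on (S \<times> T). \<bar>entry A i j z\<bar> \<le> max m1 m2" "AE z in lebesgue_on (S \<times> T). \<bar>a' i j z\<bar> \<le> max m1 m2"
        by (auto elim: eventually_mono)
      then show ?thesis by blast
    qed auto
  qed
  then obtain m where m: "\<And>i j. i \<in> Basis \<Longrightarrow> j \<in> Basis \<Longrightarrow>
      (AE z in lebesgue_on (S \<times> T). \<bar>entry A i j z\<bar> \<le> m i j) \<and> (AE z in lebesgue_on (S \<times> T). \<bar>a' i j z\<bar> \<le> m i j)"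
    by metis
  define M where "M = (\<Sum>i\<in>Basis. \<Sum>j\<in>Basis. \<bar>m i j\<bar>)"
  have le: "m i j \<le> M" if "i \<in> Basis" "j \<in> Basis" for i j
  proof -
    have "\<bar>m i j\<bar> \<le> (\<Sum>j\<in>Basis. \<bar>m i j\<bar>)" by (rule member_le_sum) (use that in auto)
    also have "\<dots> \<le> M" unfolding M_def
      by (rule member_le_sum[of i Basis "\<lambda>i. \<Sum>j\<in>Basis. \<bar>m i j\<bar>"]) (use that in \<open>auto intro: sum_nonneg\<close>)
    finally show ?thesis by simp
  qed
  show ?thesis
  proof (rule that[of M a'])
    show "M \<ge> 0" by (simp add: M_def sum_nonneg)
    fix i j :: "'a \<times> 'b" assume ij: "i \<in> Basis" "j \<in> Basis"
    show "AE z in lebesgue_on (S \<times> T). \<bar>entry A i j z\<bar> \<le> M" "AE z in lebesgue_on (S \<times> T). \<bar>a' i j z\<bar> \<le> M"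
      by (rule eventually_mono[OF conjunct1[OF m[OF ij]]] eventually_mono[OF conjunct2[OF m[OF ij]]], use le[OF ij] in linarith)+
  qed (use a' in auto)
qed

text \<open>With second derivatives of v in L2 and bounded derivatives of the coefficients, the
  product rule turns every term of the divergence into an L2 function. The variable x1 enters only
  as a parameter, so u may be any L2 function.\<close>

lemma gen0_tensor_domain:
  assumes u: "L2 S u" and v: "H01_approx T v k"
    and k2: "\<And>i j. i \<in> Basis \<Longrightarrow> j \<in> Basis \<Longrightarrow> L2 T (k2 i j) \<and> weak_pderiv T i (k j) (k2 i j)"
  obtains f where "gen0 S T A (\<lambda>z. u (fst z) * v (snd z)) f"
proof -
  obtain a' M where M: "\<And>i j. i \<in> Basis \<Longrightarrow> j \<in> Basis \<Longrightarrow> Linf (S \<times> T) (a' i j)"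
    "\<And>i j. i \<in> Basis \<Longrightarrow> j \<in> Basis \<Longrightarrow> weak_pderiv (S \<times> T) i (entry A i j) (a' i j)"
    using coefficients by metis
  note Lv = H01_approxD[OF v]
  define g where "g j z = u (fst z) * k j (snd z)" for j z
  have g: "L2 (S \<times> T) (g j)" if "j \<in> Basis" for j
    unfolding g_def[abs_def] by (intro L2_tensor u Lv that S T)
  define r where "r i j z = a' (0, i) (0, j) z * g j z + entry A (0, i) (0, j) z * (u (fst z) * k2 i j (snd z))" for i j z
  have u2: "L2 (S \<times> T) (\<lambda>z. u (fst z) * k2 i j (snd z))" if "i \<in> Basis" "j \<in> Basis" for i j
    using k2[OF that] by (intro L2_tensor u S T) auto
  have r: "weak_pderiv (S \<times> T) (0, i) (\<lambda>z. entry A (0, i) (0, j) z * g j z) (r i j)"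
    "L2 (S \<times> T) (r i j)" if ij: "i \<in> Basis" "j \<in> Basis" for i j
  proof -
    note B = Basis_snd[OF ij(1)] Basis_snd[OF ij(2)]
    have "weak_pderiv (S \<times> T) (0, i) (g j) (\<lambda>z. u (fst z) * k2 i j (snd z))"
      unfolding g_def[abs_def] using k2[OF ij] by (intro weak_pderiv_tensor_snd S T u Lv ij) auto
    from weak_pderiv_mult[OF ST' Linf_A[OF B] M(1)[OF B] M(2)[OF B] g[OF ij(2)] u2[OF ij] this]
    show "weak_pderiv (S \<times> T) (0, i) (\<lambda>z. entry A (0, i) (0, j) z * g j z) (r i j)"
      unfolding r_def[abs_def] .
    have "L2 (S \<times> T) (\<lambda>z. a' (0, i) (0, j) z * g j z)"
      using M(1)[OF B] L2_bounded_mult(1)[OF g[OF ij(2)]] by (auto simp: Linf_def)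
    then show "L2 (S \<times> T) (r i j)"
      unfolding r_def[abs_def] by (intro L2_add entry_mult_L2 B u2 ij)
  qed
  have "gen0 S T A (\<lambda>z. u (fst z) * v (snd z)) (\<lambda>z. \<Sum>i\<in>Basis. \<Sum>j\<in>Basis. r i j z)"
  proof (rule gen0I[OF _ g])
    show "L2 (S \<times> T) (\<lambda>z. u (fst z) * v (snd z))" by (intro L2_tensor u Lv S T)
    show "weak_pderiv (S \<times> T) (0, j) (\<lambda>z. u (fst z) * v (snd z)) (g j)" if "j \<in> Basis" for j
      unfolding g_def[abs_def]
      by (intro weak_pderiv_tensor_snd S T u Lv that H01_approx_weak_pderiv[OF T v])
    show "AE y in lebesgue_on S. H01 T (\<lambda>x. u (fst (y, x)) * v (snd (y, x)))"
      using H01_approx_H01[OF T H01_approx_cmult[OF T v]] by (intro AE_I2) simp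
    show "L2 (S \<times> T) (\<lambda>z. \<Sum>i\<in>Basis. \<Sum>j\<in>Basis. r i j z)" by (intro L2_sum r)
    show "weak_eq g (\<lambda>z. \<Sum>i\<in>Basis. \<Sum>j\<in>Basis. r i j z)"
      unfolding weak_eq_def
    proof (intro allI impI)
      fix \<phi> assume \<phi>: "test_fun (S \<times> T) \<phi>"
      have i: "integrable (lebesgue_on (S \<times> T)) (\<lambda>z. r i j z * \<phi> z)" if "i \<in> Basis" "j \<in> Basis" for i j
        by (intro L2_mult_integrable r that test_L2 \<phi>)
      have "(\<integral>z. (\<Sum>i\<in>Basis. \<Sum>j\<in>Basis. r i j z) * \<phi> z \<partial>lebesgue_on (S \<times> T))
          = (\<Sum>i\<in>Basis. \<integral>z. (\<Sum>j\<in>Basis. r i j z * \<phi> z) \<partial>lebesgue_on (S \<times> T))"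
        unfolding sum_distrib_right by (rule Bochner_Integration.integral_sum) (intro Bochner_Integration.integrable_sum i)
      also have "\<dots> = (\<Sum>i\<in>Basis. \<Sum>j\<in>Basis. \<integral>z. r i j z * \<phi> z \<partial>lebesgue_on (S \<times> T))"
        by (intro sum.cong refl Bochner_Integration.integral_sum i)
      finally have I: "(\<integral>z. (\<Sum>i\<in>Basis. \<Sum>j\<in>Basis. r i j z) * \<phi> z \<partial>lebesgue_on (S \<times> T))
        = (\<Sum>i\<in>Basis. \<Sum>j\<in>Basis. \<integral>z. r i j z * \<phi> z \<partial>lebesgue_on (S \<times> T))" .
      show "(\<Sum>i\<in>Basis. \<Sum>j\<in>Basis. \<integral>z. entry A (0, i) (0, j) z * g j z * pd (0, i) \<phi> z \<partial>lebesgue_on (S \<times> T))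
        = - (\<integral>z. (\<Sum>i\<in>Basis. \<Sum>j\<in>Basis. r i j z) * \<phi> z \<partial>lebesgue_on (S \<times> T))"
        unfolding I sum_negf[symmetric] by (intro sum.cong refl weak_pderivD(3)[OF r(1) \<phi>])
    qed
  qed
  then show ?thesis by (rule that)
qed

text \<open>If the integral of u b is 1, this is a projection onto the tensors with first factor u.
  Averaging against a test function b lets b serve as the first factor of a test function on the
  product.\<close>

definition proj :: "('a \<Rightarrow> real) \<Rightarrow> ('a \<Rightarrow> real) \<Rightarrow> ('a \<times> 'b \<Rightarrow> real) \<Rightarrow> 'a \<times> 'b \<Rightarrow> real" where
  "proj u b h z = u (fst z) * (\<integral>y. h (y, snd z) * b y \<partial>lebesgue_on S)"

lemma proj_L2: "L2 S u \<Longrightarrow> L2 S b \<Longrightarrow> L2 (S \<times> T) h \<Longrightarrow> L2 (S \<times> T) (proj u b h)"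
  unfolding proj_def[abs_def] by (intro L2_tensor L2_integral_fst[OF S T] S T)

lemma proj_bound:
  assumes "L2 S u" "L2 S b" "L2 (S \<times> T) h"
  shows "l2norm (S \<times> T) (proj u b h) \<le> (l2norm S u * l2norm S b) * l2norm (S \<times> T) h"
proof -
  have "l2norm (S \<times> T) (proj u b h) = l2norm S u * l2norm T (\<lambda>x. \<integral>y. h (y, x) * b y \<partial>lebesgue_on S)"
    unfolding proj_def[abs_def] by (intro l2norm_tensor L2_integral_fst[OF S T] assms S T)
  also have "\<dots> \<le> l2norm S u * (l2norm (S \<times> T) h * l2norm S b)"
    by (intro mult_left_mono l2norm_integral_fst[OF S T] assms) simp
  finally show ?thesis by (simp add: ac_simps)
qed

lemma proj_linear:
  assumes "L2 S u" "L2 S b" "L2 (S \<times> T) h" "L2 (S \<times> T) k"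
  shows "l2dist (S \<times> T) (proj u b (\<lambda>z. \<alpha> * h z + \<beta> * k z)) (\<lambda>z. \<alpha> * proj u b h z + \<beta> * proj u b k z) = 0"
proof -
  \<comment> \<open>Linearity of the averages can fail at those x whose sections are not in L2; the
    defect \<open>D\<close> is therefore shown to vanish almost everywhere only.\<close>
  define D where "D x = (\<integral>y. (\<alpha> * h (y, x) + \<beta> * k (y, x)) * b y \<partial>lebesgue_on S)
      - (\<alpha> * (\<integral>y. h (y, x) * b y \<partial>lebesgue_on S) + \<beta> * (\<integral>y. k (y, x) * b y \<partial>lebesgue_on S))" for x
  have L: "L2 T D"
    unfolding D_def[abs_def]
    using L2_integral_fst[OF S T L2_add[OF L2_cmult[OF assms(3), of \<alpha>] L2_cmult[OF assms(4), of \<beta>]] assms(2)]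
    by (intro L2_diff L2_add L2_cmult L2_integral_fst[OF S T] assms)
  have "AE x in lebesgue_on T. D x = 0"
    using AE_L2_section_fst[OF S T assms(3)] AE_L2_section_fst[OF S T assms(4)]
  proof eventually_elim
    case (elim x)
    have "(\<integral>y. (\<alpha> * h (y, x) + \<beta> * k (y, x)) * b y \<partial>lebesgue_on S) = (\<integral>y. \<alpha> * (h (y, x) * b y) + \<beta> * (k (y, x) * b y) \<partial>lebesgue_on S)"
      by (simp add: algebra_simps)
    also have "\<dots> = \<alpha> * (\<integral>y. h (y, x) * b y \<partial>lebesgue_on S) + \<beta> * (\<integral>y. k (y, x) * b y \<partial>lebesgue_on S)"
      using L2_mult_integrable[OF elim(1) assms(2)] L2_mult_integrable[OF elim(2) assms(2)] by simp
    finally show ?case by (simp add: D_def)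
  qed
  then have "l2norm T D = 0" by (simp add: l2norm_eq_0_iff[OF L])
  moreover have "(\<lambda>z. proj u b (\<lambda>z. \<alpha> * h z + \<beta> * k z) z - (\<alpha> * proj u b h z + \<beta> * proj u b k z)) = (\<lambda>z. u (fst z) * D (snd z))"
    by (auto simp: proj_def D_def algebra_simps)
  ultimately show ?thesis using l2norm_tensor[OF assms(1) L S(1) T(1)] by simp
qed

text \<open>Here the hypothesis that \<open>A22\<close> does not depend on the first factor enters: for fixed \<open>x1\<close> the equation for
  \<open>w\<close> is tested with \<open>b \<otimes> \<phi> (x1, \<cdot>)\<close>.\<close>
lemma gen0_proj:
  assumes u: "L2 S u" and b: "test_fun S b" and gen: "gen0 S T A w f"
    and g: "\<And>j. j \<in> Basis \<Longrightarrow> L2 (S \<times> T) (g j)" "\<And>j. j \<in> Basis \<Longrightarrow> weak_pderiv (S \<times> T) (0, j) w (g j)"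
  shows "H01_approx T (\<lambda>x. \<integral>y. w (y, x) * b y \<partial>lebesgue_on S) (\<lambda>j x. \<integral>y. g j (y, x) * b y \<partial>lebesgue_on S)"
    and "gen0 S T A (proj u b w) (proj u b f)"
proof -
  note D = gen0D(1-3)[OF gen]
  note Lb = test_fun_L2[OF b S]
  have eq: "weak_eq g f" by (rule gen0_weak_eq[OF gen g])
  define q where "q j x = (\<integral>y. g j (y, x) * b y \<partial>lebesgue_on S)" for j x
  have q: "L2 T (q j)" if "j \<in> Basis" for j
    unfolding q_def[abs_def] by (intro L2_integral_fst[OF S T] g Lb that)
  define F where "F x = (\<integral>y. f (y, x) * b y \<partial>lebesgue_on S)" for x
  have F: "L2 T F" unfolding F_def[abs_def] by (intro L2_integral_fst[OF S T] D Lb)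
  define p where "p x = (\<integral>y. w (y, x) * b y \<partial>lebesgue_on S)" for x
  have H: "H01_approx T p q"
    unfolding p_def[abs_def] q_def[abs_def] by (rule average_H01_approx[OF S T ne D(1) g D(3) b])
  then show "H01_approx T (\<lambda>x. \<integral>y. w (y, x) * b y \<partial>lebesgue_on S) (\<lambda>j x. \<integral>y. g j (y, x) * b y \<partial>lebesgue_on S)"
    by (simp add: p_def[abs_def] q_def[abs_def])
  note Lp = H01_approxD(1)[OF H]
  have Pw: "proj u b w = (\<lambda>z. u (fst z) * p (snd z))" by (auto simp: proj_def p_def)
  have Pf: "proj u b f = (\<lambda>z. u (fst z) * F (snd z))" by (auto simp: proj_def F_def)
  define a where "a i j = entry A (0, i) (0, j)" for i j
  have a_const: "a i j (y, x) = a i j (y', x)" if "y \<in> S" "y' \<in> S" "x \<in> T" for i j y y' x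
    unfolding a_def A22_entry using A22_X2[of "(y, x)" "(y', x)"] that by simp
  have sect: "(\<Sum>i\<in>Basis. \<Sum>j\<in>Basis. \<integral>x. a i j (x1, x) * q j x * pd (0, i) \<phi> (x1, x) \<partial>lebesgue_on T)
      = - (\<integral>x. F x * \<phi> (x1, x) \<partial>lebesgue_on T)" if \<phi>: "test_fun (S \<times> T) \<phi>" and x1: "x1 \<in> S" for \<phi> x1
  proof -
    note \<phi>s = test_fun_section_snd[OF \<phi>, of x1]
    define \<theta> where "\<theta> z = b (fst z) * \<phi> (x1, snd z)" for z
    have \<theta>: "test_fun (S \<times> T) \<theta>" unfolding \<theta>_def[abs_def] by (rule test_fun_tensor[OF b \<phi>s])
    have pd\<theta>: "pd (0, i) \<theta> z = b (fst z) * pd (0, i) \<phi> (x1, snd z)" for i z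
      unfolding \<theta>_def[abs_def]
      by (simp add: pd_tensor[OF test_funD(1)[OF b] test_funD(1)[OF \<phi>s]] test_funD(1)[OF b] pd_section_snd[OF \<phi>])
    have t: "(\<integral>z. a i j z * g j z * pd (0, i) \<theta> z \<partial>lebesgue_on (S \<times> T)) = (\<integral>x. a i j (x1, x) * q j x * pd (0, i) \<phi> (x1, x) \<partial>lebesgue_on T)"
      if ij: "i \<in> Basis" "j \<in> Basis" for i j
    proof -
      have i: "integrable (lebesgue_on (S \<times> T)) (\<lambda>z. a i j z * g j z * pd (0, i) \<theta> z)"
        unfolding a_def by (intro weak_term_integrable Basis_snd g test_L2 \<theta> ij)
      show ?thesis
        unfolding integral_section_fst[OF i S(1) T(1)]
      proof (rule Bochner_Integration.integral_cong[OF refl])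
        fix x assume "x \<in> space (lebesgue_on T)"
        then have x: "x \<in> T" by simp
        have "(\<integral>y. a i j (y, x) * g j (y, x) * pd (0, i) \<theta> (y, x) \<partial>lebesgue_on S)
          = (\<integral>y. a i j (x1, x) * pd (0, i) \<phi> (x1, x) * (g j (y, x) * b y) \<partial>lebesgue_on S)"
        proof (rule Bochner_Integration.integral_cong[OF refl])
          fix y assume "y \<in> space (lebesgue_on S)"
          then have "a i j (y, x) = a i j (x1, x)" by (intro a_const x1 x) simp
          then show "a i j (y, x) * g j (y, x) * pd (0, i) \<theta> (y, x) = a i j (x1, x) * pd (0, i) \<phi> (x1, x) * (g j (y, x) * b y)"
            by (simp add: pd\<theta> ac_simps)
        qed
        then show "(\<integral>y. a i j (y, x) * g j (y, x) * pd (0, i) \<theta> (y, x) \<partial>lebesgue_on S) = a i j (x1, x) * q j x * pd (0, i) \<phi> (x1, x)"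
          by (simp add: q_def)
      qed
    qed
    have i: "integrable (lebesgue_on (S \<times> T)) (\<lambda>z. f z * \<theta> z)" by (intro L2_mult_integrable D test_L2 \<theta>)
    have "(\<integral>y. f (y, x) * \<theta> (y, x) \<partial>lebesgue_on S) = F x * \<phi> (x1, x)" for x
    proof -
      have "(\<integral>y. f (y, x) * \<theta> (y, x) \<partial>lebesgue_on S) = (\<integral>y. f (y, x) * b y * \<phi> (x1, x) \<partial>lebesgue_on S)"
        by (simp add: \<theta>_def mult.assoc)
      then show ?thesis by (simp only: integral_mult_left_zero F_def)
    qed
    then have "(\<integral>z. f z * \<theta> z \<partial>lebesgue_on (S \<times> T)) = (\<integral>x. F x * \<phi> (x1, x) \<partial>lebesgue_on T)"
      unfolding integral_section_fst[OF i S(1) T(1)] by (simp only:)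
    moreover have "(\<Sum>i\<in>Basis. \<Sum>j\<in>Basis. \<integral>z. a i j z * g j z * pd (0, i) \<theta> z \<partial>lebesgue_on (S \<times> T))
        = - (\<integral>z. f z * \<theta> z \<partial>lebesgue_on (S \<times> T))"
      using eq \<theta> unfolding weak_eq_def a_def by blast
    moreover have "(\<Sum>i\<in>Basis. \<Sum>j\<in>Basis. \<integral>z. a i j z * g j z * pd (0, i) \<theta> z \<partial>lebesgue_on (S \<times> T))
        = (\<Sum>i\<in>Basis. \<Sum>j\<in>Basis. \<integral>x. a i j (x1, x) * q j x * pd (0, i) \<phi> (x1, x) \<partial>lebesgue_on T)"
      by (intro sum.cong refl t)
    ultimately show ?thesis by simp
  qed
  show "gen0 S T A (proj u b w) (proj u b f)"
    unfolding Pw Pf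
  proof (rule gen0I[where g = "\<lambda>j z. u (fst z) * q j (snd z)"])
    show "L2 (S \<times> T) (\<lambda>z. u (fst z) * p (snd z))" "L2 (S \<times> T) (\<lambda>z. u (fst z) * F (snd z))"
      by (intro L2_tensor u Lp F S T)+
    show g': "L2 (S \<times> T) (\<lambda>z. u (fst z) * q j (snd z))" if "j \<in> Basis" for j
      by (intro L2_tensor u q S T that)
    show "weak_pderiv (S \<times> T) (0, j) (\<lambda>z. u (fst z) * p (snd z)) (\<lambda>z. u (fst z) * q j (snd z))" if "j \<in> Basis" for j
      by (intro weak_pderiv_tensor_snd S T u Lp q that H01_approx_weak_pderiv[OF T H])
    show "AE y in lebesgue_on S. H01 T (\<lambda>x. u (fst (y, x)) * p (snd (y, x)))"
      using H01_approx_H01[OF T H01_approx_cmult[OF T H]] by (intro AE_I2) simp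
    show "weak_eq (\<lambda>j z. u (fst z) * q j (snd z)) (\<lambda>z. u (fst z) * F (snd z))"
      unfolding weak_eq_def a_def[symmetric]
    proof (intro allI impI)
      fix \<phi> assume \<phi>: "test_fun (S \<times> T) \<phi>"
      \<comment> \<open>The inner integral of the weak form with the weight u x1 pulled out. For
        each x1 the section identity \<open>sect\<close> evaluates the sum over i and j; integrating
        over x1 restores the equation on the product.\<close>
      define I where "I i j x1 = u x1 * (\<integral>x. a i j (x1, x) * q j x * pd (0, i) \<phi> (x1, x) \<partial>lebesgue_on T)" for i j x1
      have int: "integrable (lebesgue_on (S \<times> T)) (\<lambda>z. a i j z * (u (fst z) * q j (snd z)) * pd (0, i) \<phi> z)"
        if "i \<in> Basis" "j \<in> Basis" for i j
        unfolding a_def by (intro weak_term_integrable Basis_snd g' test_L2 \<phi> that)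
      have I1: "(\<integral>x. a i j (x1, x) * (u (fst (x1, x)) * q j (snd (x1, x))) * pd (0, i) \<phi> (x1, x) \<partial>lebesgue_on T) = I i j x1" for i j x1
        unfolding I_def integral_mult_right_zero[symmetric] by (simp add: ac_simps)
      have iI: "integrable (lebesgue_on S) (I i j)" if "i \<in> Basis" "j \<in> Basis" for i j
        using integrable_section_snd[OF int[OF that] S(1) T(1)] unfolding I1 by simp
      have "(\<Sum>i\<in>Basis. \<Sum>j\<in>Basis. \<integral>z. a i j z * (u (fst z) * q j (snd z)) * pd (0, i) \<phi> z \<partial>lebesgue_on (S \<times> T))
          = (\<Sum>i\<in>Basis. \<Sum>j\<in>Basis. \<integral>x1. I i j x1 \<partial>lebesgue_on S)"
        by (intro sum.cong refl) (simp only: integral_section_snd[OF int S(1) T(1)] I1)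
      also have "\<dots> = (\<Sum>i\<in>Basis. \<integral>x1. (\<Sum>j\<in>Basis. I i j x1) \<partial>lebesgue_on S)"
        by (intro sum.cong refl Bochner_Integration.integral_sum[symmetric] iI)
      also have "\<dots> = (\<integral>x1. (\<Sum>i\<in>Basis. \<Sum>j\<in>Basis. I i j x1) \<partial>lebesgue_on S)"
        by (intro Bochner_Integration.integral_sum[symmetric] Bochner_Integration.integrable_sum iI)
      also have "\<dots> = (\<integral>x1. - (\<integral>x. u x1 * F x * \<phi> (x1, x) \<partial>lebesgue_on T) \<partial>lebesgue_on S)"
      proof (rule Bochner_Integration.integral_cong[OF refl])
        fix x1 assume "x1 \<in> space (lebesgue_on S)"
        then have "x1 \<in> S" by simp
        from sect[OF \<phi> this] show "(\<Sum>i\<in>Basis. \<Sum>j\<in>Basis. I i j x1) = - (\<integral>x. u x1 * F x * \<phi> (x1, x) \<partial>lebesgue_on T)"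
          unfolding I_def sum_distrib_left[symmetric] by (simp add: mult.assoc)
      qed
      also have "\<dots> = - (\<integral>z. u (fst z) * F (snd z) * \<phi> z \<partial>lebesgue_on (S \<times> T))"
      proof -
        have i: "integrable (lebesgue_on (S \<times> T)) (\<lambda>z. u (fst z) * F (snd z) * \<phi> z)"
          by (intro L2_mult_integrable L2_tensor u F S T test_L2 \<phi>)
        show ?thesis unfolding integral_section_snd[OF i S(1) T(1)] by simp
      qed
      finally show "(\<Sum>i\<in>Basis. \<Sum>j\<in>Basis. \<integral>z. a i j z * (u (fst z) * q j (snd z)) * pd (0, i) \<phi> z \<partial>lebesgue_on (S \<times> T))
          = - (\<integral>z. u (fst z) * F (snd z) * \<phi> z \<partial>lebesgue_on (S \<times> T))" .
    qed
  qed
qed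

text \<open>The equation is tested with approximations of the solution itself.\<close>
lemma gen0_energy:
  assumes u: "H01_approx S u k" and p: "H01_approx T p q" and gen: "gen0 S T A (\<lambda>z. u (fst z) * p (snd z)) f"
  shows "lam * (l2norm S u)\<^sup>2 * (\<Sum>j\<in>Basis. (l2norm T (q j))\<^sup>2) \<le> l2norm (S \<times> T) f * (l2norm S u * l2norm T p)"
proof -
  note Lu = H01_approxD[OF u] and Lp = H01_approxD[OF p]
  define g where "g j z = u (fst z) * q j (snd z)" for j z
  have g: "L2 (S \<times> T) (g j)" if "j \<in> Basis" for j
    unfolding g_def[abs_def] by (intro L2_tensor Lu Lp S T that)
  have wd: "weak_pderiv (S \<times> T) (0, j) (\<lambda>z. u (fst z) * p (snd z)) (g j)" if "j \<in> Basis" for j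
    unfolding g_def[abs_def]
    by (intro weak_pderiv_tensor_snd S T Lu Lp that H01_approx_weak_pderiv[OF T p])
  have eq: "weak_eq g f" by (rule gen0_weak_eq[OF gen g wd])
  have Lw: "L2 (S \<times> T) (\<lambda>z. u (fst z) * p (snd z))" and Lf: "L2 (S \<times> T) f"
    using gen0D(1,2)[OF gen] .
  obtain \<theta> where \<theta>: "\<And>n. test_fun (S \<times> T) (\<theta> n)"
    "(\<lambda>n. l2dist (S \<times> T) (\<lambda>z. u (fst z) * p (snd z)) (\<theta> n)) \<longlonglongrightarrow> 0"
    "\<And>i. i \<in> Basis \<Longrightarrow> (\<lambda>n. l2dist (S \<times> T) (\<lambda>z. k (fst i) (fst z) * p (snd z) * of_bool (snd i = 0)
        + u (fst z) * q (snd i) (snd z) * of_bool (fst i = 0)) (pd i (\<theta> n))) \<longlonglongrightarrow> 0"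
    by (rule H01_approx_sequence[OF H01_approx_tensor[OF S T u p]]) (rule that; assumption)
  have \<theta>g: "(\<lambda>n. l2dist (S \<times> T) (g i) (pd (0, i) (\<theta> n))) \<longlonglongrightarrow> 0" if "i \<in> Basis" for i
  proof -
    have "i \<noteq> 0" using that by auto
    then show ?thesis using \<theta>(3)[OF Basis_snd[OF that]] by (simp add: g_def[abs_def])
  qed
  define a where "a i j = entry A (0, i) (0, j)" for i j
  have ag: "L2 (S \<times> T) (\<lambda>z. a i j z * g j z)" if "i \<in> Basis" "j \<in> Basis" for i j
    unfolding a_def by (intro entry_mult_L2 Basis_snd g that)
  have lim: "(\<lambda>n. \<integral>z. a i j z * g j z * pd (0, i) (\<theta> n) z \<partial>lebesgue_on (S \<times> T)) \<longlonglongrightarrow> (\<integral>z. a i j z * g j z * g i z \<partial>lebesgue_on (S \<times> T))"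
    if ij: "i \<in> Basis" "j \<in> Basis" for i j
    using l2norm_tendsto_integral[OF test_L2(2)[OF \<theta>(1)] g[OF ij(1)] ag[OF ij] \<theta>g[OF ij(1)]]
    by (simp add: mult.commute)
  have limf: "(\<lambda>n. - (\<integral>z. f z * \<theta> n z \<partial>lebesgue_on (S \<times> T))) \<longlonglongrightarrow> - (\<integral>z. f z * (u (fst z) * p (snd z)) \<partial>lebesgue_on (S \<times> T))"
    using tendsto_minus[OF l2norm_tendsto_integral[OF test_L2(1)[OF \<theta>(1)] Lw Lf \<theta>(2)]] by (simp add: mult.commute)
  have "(\<lambda>n. \<Sum>i\<in>Basis. \<Sum>j\<in>Basis. \<integral>z. a i j z * g j z * pd (0, i) (\<theta> n) z \<partial>lebesgue_on (S \<times> T))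
      \<longlonglongrightarrow> (\<Sum>i\<in>Basis. \<Sum>j\<in>Basis. \<integral>z. a i j z * g j z * g i z \<partial>lebesgue_on (S \<times> T))"
    by (intro tendsto_sum lim)
  moreover have "(\<Sum>i\<in>Basis. \<Sum>j\<in>Basis. \<integral>z. a i j z * g j z * pd (0, i) (\<theta> n) z \<partial>lebesgue_on (S \<times> T))
      = - (\<integral>z. f z * \<theta> n z \<partial>lebesgue_on (S \<times> T))" for n
    using eq \<theta>(1)[of n] unfolding weak_eq_def a_def by blast
  ultimately have E: "(\<Sum>i\<in>Basis. \<Sum>j\<in>Basis. \<integral>z. a i j z * g j z * g i z \<partial>lebesgue_on (S \<times> T))
      = - (\<integral>z. f z * (u (fst z) * p (snd z)) \<partial>lebesgue_on (S \<times> T))"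
    using limf by (simp add: LIMSEQ_unique)
  have i1: "integrable (lebesgue_on (S \<times> T)) (\<lambda>z. a i j z * g j z * g i z)" if "i \<in> Basis" "j \<in> Basis" for i j
    by (intro L2_mult_integrable ag g that)
  have i2: "integrable (lebesgue_on (S \<times> T)) (\<lambda>z. lam * (\<Sum>j\<in>Basis. (g j z)\<^sup>2))"
    by (intro integrable_mult_right Bochner_Integration.integrable_sum L2_sq_integrable g)
  have "lam * (l2norm S u)\<^sup>2 * (\<Sum>j\<in>Basis. (l2norm T (q j))\<^sup>2) = lam * (\<Sum>j\<in>Basis. (l2norm (S \<times> T) (g j))\<^sup>2)"
    unfolding g_def[abs_def] using l2norm_tensor[OF Lu(1) Lp(2) S(1) T(1)]
    by (simp add: power_mult_distrib sum_distrib_left mult.assoc)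
  also have "\<dots> = (\<integral>z. lam * (\<Sum>j\<in>Basis. (g j z)\<^sup>2) \<partial>lebesgue_on (S \<times> T))"
    using g by (simp add: l2norm_sq Bochner_Integration.integral_sum L2_sq_integrable)
  also have "\<dots> \<le> (\<integral>z. (\<Sum>i\<in>Basis. \<Sum>j\<in>Basis. a i j z * g j z * g i z) \<partial>lebesgue_on (S \<times> T))"
  proof (rule integral_mono_AE[OF i2])
    show "integrable (lebesgue_on (S \<times> T)) (\<lambda>z. \<Sum>i\<in>Basis. \<Sum>j\<in>Basis. a i j z * g j z * g i z)"
      by (intro Bochner_Integration.integrable_sum i1)
    show "AE z in lebesgue_on (S \<times> T). lam * (\<Sum>j\<in>Basis. (g j z)\<^sup>2) \<le> (\<Sum>i\<in>Basis. \<Sum>j\<in>Basis. a i j z * g j z * g i z)"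
      using ellip
    proof eventually_elim
      case (elim z)
      \<comment> \<open>Ellipticity is applied to vectors (0, \<xi>), for which the quadratic form
        of A is that of the A22 block.\<close>
      define \<xi> where "\<xi> = (\<Sum>j\<in>Basis. g j z *\<^sub>R j)"
      have \<xi>: "\<xi> \<bullet> j = g j z" if "j \<in> Basis" for j unfolding \<xi>_def by (rule vector_of_components[OF that])
      have "(norm (0::'a, \<xi>))\<^sup>2 = (\<Sum>j\<in>Basis. (g j z)\<^sup>2)"
        unfolding power2_norm_eq_inner using euclidean_inner[of \<xi> \<xi>] by (simp add: \<xi> power2_eq_square)
      moreover have "A z (0, \<xi>) \<bullet> (0, \<xi>) = A22 A z \<xi> \<bullet> \<xi>" by (simp add: A22_def inner_prod_def)
      moreover have "A22 A z \<xi> \<bullet> \<xi> = (\<Sum>i\<in>Basis. \<Sum>j\<in>Basis. a i j z * g j z * g i z)"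
        unfolding A22_expand a_def by (intro sum.cong refl) (simp add: \<xi>)
      ultimately show ?case using elim[rule_format, of "(0, \<xi>)"] by simp
    qed
  qed
  also have "\<dots> = (\<Sum>i\<in>Basis. \<integral>z. (\<Sum>j\<in>Basis. a i j z * g j z * g i z) \<partial>lebesgue_on (S \<times> T))"
    by (intro Bochner_Integration.integral_sum Bochner_Integration.integrable_sum i1)
  also have "\<dots> = (\<Sum>i\<in>Basis. \<Sum>j\<in>Basis. \<integral>z. a i j z * g j z * g i z \<partial>lebesgue_on (S \<times> T))"
    by (intro sum.cong refl Bochner_Integration.integral_sum i1)
  also have "\<dots> \<le> l2norm (S \<times> T) f * l2norm (S \<times> T) (\<lambda>z. u (fst z) * p (snd z))"
    unfolding E using L2_Cauchy_Schwarz[OF Lf Lw] by simp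
  also have "\<dots> = l2norm (S \<times> T) f * (l2norm S u * l2norm T p)"
    using l2norm_tensor[OF Lu(1) Lp(1) S(1) T(1)] by simp
  finally show ?thesis .
qed

end

text \<open>\<open>H2\<close> speaks of second derivatives of u, while the product rule needs a weak
  derivative of the chosen first derivative \<open>k j\<close>; the pair is therefore taken in the
  order j, i.\<close>

lemma H2_second_derivatives:
  assumes U: "open U" "bounded U" and "H2 U u" and u: "H01_approx U u k"
  obtains k2 where "\<And>i j. i \<in> Basis \<Longrightarrow> j \<in> Basis \<Longrightarrow> L2 U (k2 i j) \<and> weak_pderiv U i (k j) (k2 i j)"
proof -
  have "\<exists>w. i \<in> Basis \<longrightarrow> j \<in> Basis \<longrightarrow> L2 U w \<and> weak_pderiv U i (k j) w" for i j
  proof (cases "i \<in> Basis \<and> j \<in> Basis")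
    case True
    then obtain w where w: "L2 U w" "weak_pderiv2 U j i u w"
      using assms(3) unfolding H2_def by blast
    have "weak_pderiv U i (k j) w"
      by (rule weak_pderiv2_weak_pderiv[OF H01_approx_weak_pderiv[OF U u] w(2) H01_approxD(2)[OF u] w(1) U])
         (use True in auto)
    then show ?thesis using w(1) by blast
  qed auto
  then obtain k2 where "\<And>i j. i \<in> Basis \<longrightarrow> j \<in> Basis \<longrightarrow> L2 U (k2 i j) \<and> weak_pderiv U i (k j) (k2 i j)"
    by metis
  then show ?thesis by (intro that[of k2]) auto
qed

subsection \<open>Density of tensors\<close>

lemma test_fun_H01_H2:
  assumes U: "open U" "bounded U" and \<phi>: "test_fun U \<phi>"
  shows "H01 U \<phi>" "H2 U \<phi>"
proof -
  show H: "H01 U \<phi>" by (rule H01_approx_H01[OF U H01_approx_test_fun[OF U \<phi>]])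
  \<comment> \<open>The outer derivative e1 is moved off \<psi> first and e2 second, so they reach
    \<phi> in reversed order.\<close>
  have "weak_pderiv2 U e1 e2 \<phi> (pd e2 (pd e1 \<phi>))" for e1 e2
    unfolding weak_pderiv2_def
  proof (intro allI impI conjI)
    fix \<psi> assume \<psi>: "test_fun U \<psi>"
    note \<psi>2 = test_fun_pd[OF \<psi>, of e2]
    show "integrable (lebesgue_on U) (\<lambda>x. \<phi> x * pd e1 (pd e2 \<psi>) x)"
      "integrable (lebesgue_on U) (\<lambda>x. pd e2 (pd e1 \<phi>) x * \<psi> x)"
      by (intro L2_mult_integrable test_fun_L2[OF _ U, of U] test_fun_pd \<phi> \<psi>)+
    show "(\<integral>x. \<phi> x * pd e1 (pd e2 \<psi>) x \<partial>lebesgue_on U) = (\<integral>x. pd e2 (pd e1 \<phi>) x * \<psi> x \<partial>lebesgue_on U)"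
      using weak_pderivD(3)[OF weak_pderiv_test_fun[OF \<phi> U, of e1] \<psi>2]
        weak_pderivD(3)[OF weak_pderiv_test_fun[OF test_fun_pd[OF \<phi>, of e1] U, of e2] \<psi>] by simp
  qed
  moreover have "L2 U (pd e2 (pd e1 \<phi>))" for e1 e2
    by (intro test_fun_L2[OF _ U, of U] test_fun_pd \<phi>)
  moreover have "H1 U \<phi>" using H unfolding H01_def H1_def by blast
  ultimately show "H2 U \<phi>" unfolding H2_def by blast
qed

lemma box_Pair: "box (a1, a2) (b1, b2) = box a1 b1 \<times> box a2 b2"
proof (rule set_eqI)
  show "x \<in> box (a1, a2) (b1, b2) \<longleftrightarrow> x \<in> box a1 b1 \<times> box a2 b2" for x
    by (simp add: mem_box Basis_prod_def ball_Un mem_Times_iff inner_prod_def)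
qed

lemma bumps_tensor:
  assumes "\<phi> \<in> bumps (S \<times> T)"
  obtains f g where "test_fun S f" "test_fun T g" "\<phi> = (\<lambda>z. f (fst z) * g (snd z))"
proof -
  obtain a b n where \<phi>: "\<phi> = bump a b n" "rational_box (S \<times> T) (a, b)" "n > 0"
    using assms by (rule bumpsE)
  obtain a1 a2 b1 b2 where ab: "a = (a1, a2)" "b = (b1, b2)" by (metis surj_pair)
  have sub: "box a1 b1 \<times> box a2 b2 \<subseteq> S \<times> T"
    using \<phi>(2) by (simp add: rational_box_def ab box_Pair)
  show ?thesis
  proof (cases "box a1 b1 = {} \<or> box a2 b2 = {}")
    \<comment> \<open>An inclusion of an empty product says nothing about its factors, one of which
      may leave S or T. The bump is identically 0 in this case and the zero tensor represents
      it.\<close>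
    case True
    then have "box a b = {}" by (simp add: ab box_Pair)
    have "\<phi> z = 0" for z
      unfolding \<phi>(1) by (rule test_fun_eq_0[OF test_fun_bump[of a b "{}" n]]) (use \<open>box a b = {}\<close> \<phi>(3) in auto)
    then have "\<phi> = (\<lambda>z. 0 * 0)" by auto
    then show ?thesis by (intro that[of "\<lambda>x. 0" "\<lambda>x. 0"]) auto
  next
    case False
    then have "box a1 b1 \<subseteq> S" "box a2 b2 \<subseteq> T" using sub by auto
    then show ?thesis
      by (intro that[of "bump a1 b1 n" "bump a2 b2 n"] test_fun_bump \<phi>(3)) (auto simp: \<phi>(1) ab bump_Pair)
  qed
qed

lemma bump_span_tensor:
  assumes S: "open S" "bounded S" and T: "open T" "bounded T"
    and "p \<in> bump_span (S \<times> T)"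
  shows "tensor_H012 S T p"
proof -
  have "\<exists>(n::nat) u v. (\<forall>k<n. H01 S (u k) \<and> H2 S (u k) \<and> H01 T (v k) \<and> H2 T (v k)) \<and>
    p = (\<lambda>z. \<Sum>k<n. u k (fst z) * v k (snd z))"
    using assms(5)
  proof induction
    case zero
    then show ?case by (intro exI[of _ 0]) simp
  next
    case (step \<phi> p c)
    obtain n :: nat and u v where p: "\<forall>k<n. H01 S (u k) \<and> H2 S (u k) \<and> H01 T (v k) \<and> H2 T (v k)"
      "p = (\<lambda>z. \<Sum>k<n. u k (fst z) * v k (snd z))"
      using step.IH by blast
    obtain f g where f: "test_fun S f" "test_fun T g" "\<phi> = (\<lambda>z. f (fst z) * g (snd z))"
      using bumps_tensor[OF step(1)] .
    note cf = test_fun_cmult[OF f(1), of c]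
    show ?case
    proof (intro exI conjI)
      show "\<forall>k<Suc n. H01 S ((u(n := \<lambda>x. c * f x)) k) \<and> H2 S ((u(n := \<lambda>x. c * f x)) k) \<and> H01 T ((v(n := g)) k) \<and> H2 T ((v(n := g)) k)"
        using p(1) test_fun_H01_H2[OF S cf] test_fun_H01_H2[OF T f(2)] by (auto simp: less_Suc_eq)
      show "(\<lambda>z. c * \<phi> z + p z) = (\<lambda>z. \<Sum>k<Suc n. (u(n := \<lambda>x. c * f x)) k (fst z) * (v(n := g)) k (snd z))"
        by (auto simp: p(2) f(3) fun_eq_iff)
    qed
  qed
  moreover have "L2 (S \<times> T) p"
    by (rule test_fun_L2[OF bump_span_test_fun[OF assms(5)] open_Times[OF S(1) T(1)] bounded_Times[OF S(2) T(2)]])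
  ultimately show ?thesis unfolding tensor_H012_def by (auto intro: AE_I2)
qed

subsection \<open>The rate for tensors\<close>

lemma semigroup_sum:
  assumes S: "C0_contraction_semigroup U S Op" and "t \<ge> 0" and g: "\<And>k. k < (n::nat) \<Longrightarrow> L2 U (g k)"
  shows "l2dist U (S t (\<lambda>x. \<Sum>k<n. g k x)) (\<lambda>x. \<Sum>k<n. S t (g k) x) = 0"
  using g
proof (induction n)
  case 0
  have "l2norm U (S t (\<lambda>x. 0)) \<le> l2norm U (\<lambda>x. 0)"
    by (rule semigroup_contraction[OF S \<open>t \<ge> 0\<close> L2_zero])
  then show ?case using l2norm_nonneg[of U "S t (\<lambda>x. 0)"] by simp
next
  case (Suc n)
  have Ls: "L2 U (\<lambda>x. \<Sum>k<n. g k x)" by (rule L2_sum) (use Suc.prems in auto)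
  have LS: "L2 U (S t (g k))" if "k < Suc n" for k by (rule semigroup_L2[OF S \<open>t \<ge> 0\<close> Suc.prems[OF that]])
  have LSs: "L2 U (\<lambda>x. \<Sum>k<n. S t (g k) x)" by (rule L2_sum) (use LS in auto)
  note LS1 = semigroup_L2[OF S \<open>t \<ge> 0\<close> Ls]
  have Lt: "L2 U (S t (\<lambda>x. (\<Sum>k<n. g k x) + g n x))"
    by (intro semigroup_L2[OF S \<open>t \<ge> 0\<close>] L2_add Ls Suc.prems) simp
  have "l2dist U (S t (\<lambda>x. (\<Sum>k<n. g k x) + g n x)) (\<lambda>x. (\<Sum>k<n. S t (g k) x) + S t (g n) x)
    \<le> l2dist U (S t (\<lambda>x. (\<Sum>k<n. g k x) + g n x)) (\<lambda>x. S t (\<lambda>x. \<Sum>k<n. g k x) x + S t (g n) x)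
      + l2dist U (\<lambda>x. S t (\<lambda>x. \<Sum>k<n. g k x) x + S t (g n) x) (\<lambda>x. (\<Sum>k<n. S t (g k) x) + S t (g n) x)"
    by (intro l2norm_triangle_diff Lt L2_add LS1 LSs LS) simp_all
  also have "\<dots> = 0"
    using semigroup_linear[OF S \<open>t \<ge> 0\<close> Ls Suc.prems[of n], of 1 1] Suc.IH Suc.prems by simp
  finally show ?case by (simp add: order_antisym)
qed

context anisotropic_operator
begin

lemma Aeps_expand:
  "Aeps A \<epsilon> z \<xi> \<bullet> \<eta> = (\<Sum>i\<in>Basis. \<Sum>j\<in>Basis.
    (if snd i = 0 then \<epsilon> else 1) * (if snd j = 0 then \<epsilon> else 1) * (entry A i j z * (\<xi> \<bullet> j) * (\<eta> \<bullet> i)))"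
proof -
  define D :: "'a \<times> 'b \<Rightarrow> 'a \<times> 'b" where "D x = (\<epsilon> *\<^sub>R fst x, snd x)" for x
  have D: "D x \<bullet> j = (if snd j = 0 then \<epsilon> else 1) * (x \<bullet> j)" if "j \<in> Basis" for x j
    using that by (auto simp: D_def Basis_prod_def inner_prod_def)
  have "Aeps A \<epsilon> z \<xi> \<bullet> \<eta> = A z (D \<xi>) \<bullet> D \<eta>"
    by (simp add: Aeps_def D_def Let_def inner_prod_def)
  also have "\<dots> = (\<Sum>i\<in>Basis. \<Sum>j\<in>Basis. (A z j \<bullet> i) * (D \<xi> \<bullet> j) * (D \<eta> \<bullet> i))"
    by (rule linear_inner_expand[OF lin])
  also have "\<dots> = (\<Sum>i\<in>Basis. \<Sum>j\<in>Basis.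
    (if snd i = 0 then \<epsilon> else 1) * (if snd j = 0 then \<epsilon> else 1) * (entry A i j z * (\<xi> \<bullet> j) * (\<eta> \<bullet> i)))"
    by (intro sum.cong refl) (simp only: D entry_def ac_simps)
  finally show ?thesis .
qed

text \<open>On a tensor \<open>u \<otimes> p\<close> in the domain of \<open>A0\<close> the difference \<open>A\<^sub>\<epsilon> - A0\<close> only involves the blocks with at least one
  index in the first factor; each of them carries a factor \<open>\<epsilon>\<close> and puts at most one derivative on \<open>p\<close>.\<close>
lemma gen_div_tensor:
  assumes u: "H01_approx S u k"
    and k2: "\<And>i j. i \<in> Basis \<Longrightarrow> j \<in> Basis \<Longrightarrow> L2 S (k2 i j) \<and> weak_pderiv S i (k j) (k2 i j)"
  obtains C where "C \<ge> 0" "\<And>p q f \<epsilon>. H01_approx T p q \<Longrightarrow> gen0 S T A (\<lambda>z. u (fst z) * p (snd z)) f \<Longrightarrow>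
    0 < \<epsilon> \<Longrightarrow> \<epsilon> \<le> 1 \<Longrightarrow> \<exists>f'. gen_div (S \<times> T) (Aeps A \<epsilon>) (\<lambda>z. u (fst z) * p (snd z)) f' \<and>
      l2dist (S \<times> T) f' f \<le> \<epsilon> * (C * (l2norm T p + (\<Sum>j\<in>Basis. l2norm T (q j))))"
proof -
  obtain a' M where M: "M \<ge> 0"
    "\<And>i j. i \<in> Basis \<Longrightarrow> j \<in> Basis \<Longrightarrow> Linf (S \<times> T) (a' i j)"
    "\<And>i j. i \<in> Basis \<Longrightarrow> j \<in> Basis \<Longrightarrow> weak_pderiv (S \<times> T) i (entry A i j) (a' i j)"
    "\<And>i j. i \<in> Basis \<Longrightarrow> j \<in> Basis \<Longrightarrow> AE z in lebesgue_on (S \<times> T). \<bar>entry A i j z\<bar> \<le> M"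
    "\<And>i j. i \<in> Basis \<Longrightarrow> j \<in> Basis \<Longrightarrow> AE z in lebesgue_on (S \<times> T). \<bar>a' i j z\<bar> \<le> M"
    by (rule coefficients) (rule that; assumption)
  note Lu = H01_approxD[OF u]
  \<comment> \<open>A common bound for the norms of u, its gradient and its second derivatives;
    \<open>N\<close> plays this role for p and its gradient. Every tensor of a derivative of u with
    p or a derivative of p then has norm at most c N.\<close>
  define c where "c = l2norm S u + (\<Sum>i\<in>Basis. l2norm S (k i)) + (\<Sum>i\<in>Basis. \<Sum>j\<in>Basis. l2norm S (k2 i j))"
  have c_k: "l2norm S (k i) \<le> c" if "i \<in> Basis" for i
    using member_le_sum[OF that, of "\<lambda>i. l2norm S (k i)"] by (simp add: c_def sum_nonneg add_increasing add_increasing2)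
  have c_u: "l2norm S u \<le> c" by (simp add: c_def sum_nonneg)
  have c_k2: "l2norm S (k2 i j) \<le> c" if "i \<in> Basis" "j \<in> Basis" for i j
  proof -
    have "l2norm S (k2 i j) \<le> (\<Sum>j\<in>Basis. l2norm S (k2 i j))"
      by (rule member_le_sum[OF that(2)]) auto
    also have "\<dots> \<le> (\<Sum>i\<in>Basis. \<Sum>j\<in>Basis. l2norm S (k2 i j))"
      by (rule member_le_sum[OF that(1), of "\<lambda>i. \<Sum>j\<in>Basis. l2norm S (k2 i j)"]) (auto intro: sum_nonneg)
    also have "\<dots> \<le> c" by (simp add: c_def sum_nonneg)
    finally show ?thesis .
  qed
  have c0: "c \<ge> 0" using c_u l2norm_nonneg[of S u] by linarith
  define C where "C = (\<Sum>i\<in>(Basis::('a \<times> 'b) set). \<Sum>j\<in>(Basis::('a \<times> 'b) set). 2 * M * c)"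
  show ?thesis
  proof (rule that[of C])
    show "C \<ge> 0" using M(1) c0 by (simp add: C_def)
    fix p q f and \<epsilon> :: real
    assume p: "H01_approx T p q" and gen: "gen0 S T A (\<lambda>z. u (fst z) * p (snd z)) f" and \<epsilon>: "0 < \<epsilon>" "\<epsilon> \<le> 1"
    note Lp = H01_approxD[OF p]
    define N where "N = l2norm T p + (\<Sum>j\<in>Basis. l2norm T (q j))"
    have N_p: "l2norm T p \<le> N" by (simp add: N_def sum_nonneg)
    have N_q: "l2norm T (q j) \<le> N" if "j \<in> Basis" for j
      using member_le_sum[OF that, of "\<lambda>j. l2norm T (q j)"] by (simp add: N_def add_increasing)
    have N0: "N \<ge> 0" using N_p l2norm_nonneg[of T p] by linarith
    define G where "G i z = k (fst i) (fst z) * p (snd z) * of_bool (snd i = 0) + u (fst z) * q (snd i) (snd z) * of_bool (fst i = 0)" for i z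
    have HG: "H01_approx (S \<times> T) (\<lambda>z. u (fst z) * p (snd z)) G"
      using H01_approx_tensor[OF S T u p] by (simp add: G_def[abs_def])
    note LG = H01_approxD[OF HG]
    have cases: "(\<exists>e\<in>Basis. i = (e, 0) \<and> e \<noteq> 0) \<or> (\<exists>e\<in>Basis. i = (0, e) \<and> e \<noteq> 0)" if "i \<in> Basis" for i :: "'a \<times> 'b"
      using that by (auto simp: Basis_prod_def)
    have G1: "G (e, 0) = (\<lambda>z. k e (fst z) * p (snd z))" if "e \<in> Basis" for e
    proof -
      have "e \<noteq> 0" using that by auto
      then show ?thesis by (auto simp: G_def fun_eq_iff)
    qed
    have G2: "G (0, e) = (\<lambda>z. u (fst z) * q e (snd z))" if "e \<in> Basis" for e
    proof -
      have "e \<noteq> 0" using that by auto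
      then show ?thesis by (auto simp: G_def fun_eq_iff)
    qed
    have tensor: "L2 (S \<times> T) (\<lambda>z. \<alpha> (fst z) * \<beta> (snd z)) \<and> l2norm (S \<times> T) (\<lambda>z. \<alpha> (fst z) * \<beta> (snd z)) \<le> c * N"
      if "L2 S \<alpha>" "l2norm S \<alpha> \<le> c" "L2 T \<beta>" "l2norm T \<beta> \<le> N" for \<alpha> \<beta>
      using L2_tensor[OF that(1,3) S(1) T(1)] l2norm_tensor[OF that(1,3) S(1) T(1)]
        mult_mono[OF that(2,4) c0 l2norm_nonneg] by simp
    have GN: "l2norm (S \<times> T) (G j) \<le> c * N" if "j \<in> Basis" for j
      using cases[OF that]
    proof (elim disjE bexE conjE)
      fix e :: 'a assume "e \<in> Basis" "j = (e, 0)"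
      then show ?thesis using tensor[OF Lu(2) c_k Lp(1) N_p] by (simp add: G1)
    next
      fix e :: 'b assume "e \<in> Basis" "j = (0, e)"
      then show ?thesis using tensor[OF Lu(1) c_u Lp(2) N_q] by (simp add: G2)
    qed
    \<comment> \<open>The three blocks with an index in the first factor: both derivatives fall on
      u, or one on u and one on p. The remaining block would need second derivatives of p and is
      excluded by the side condition.\<close>
    have "\<exists>d. L2 (S \<times> T) d \<and> l2norm (S \<times> T) d \<le> c * N \<and> weak_pderiv (S \<times> T) i (G j) d"
      if "i \<in> Basis" "j \<in> Basis" "snd i = 0 \<or> snd j = 0" for i j
      using cases[OF that(1)] cases[OF that(2)]
    proof (elim disjE bexE conjE)
      fix e e' assume e: "e \<in> Basis" "i = (e, 0)" "e' \<in> Basis" "j = (e', 0)"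
      show ?thesis
        unfolding e(2,4) G1[OF e(3)] using k2[OF e(1,3)] tensor[of "k2 e e'", OF _ c_k2[OF e(1,3)] Lp(1) N_p]
        by (intro exI[of _ "\<lambda>z. k2 e e' (fst z) * p (snd z)"] conjI weak_pderiv_tensor_fst S T Lu Lp e) auto
    next
      fix e e' assume e: "e \<in> Basis" "i = (e, 0)" "e' \<in> Basis" "j = (0, e')"
      show ?thesis
        unfolding e(2,4) G2[OF e(3)] using tensor[OF Lu(2)[OF e(1)] c_k[OF e(1)] Lp(2)[OF e(3)] N_q[OF e(3)]]
        by (intro exI[of _ "\<lambda>z. k e (fst z) * q e' (snd z)"] conjI weak_pderiv_tensor_fst S T Lu Lp e
            H01_approx_weak_pderiv[OF S u]) auto
    next
      fix e e' assume e: "e \<in> Basis" "i = (0, e)" "e' \<in> Basis" "j = (e', 0)"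
      show ?thesis
        unfolding e(2,4) G1[OF e(3)] using tensor[OF Lu(2)[OF e(3)] c_k[OF e(3)] Lp(2)[OF e(1)] N_q[OF e(1)]]
        by (intro exI[of _ "\<lambda>z. k e' (fst z) * q e (snd z)"] conjI weak_pderiv_tensor_snd S T Lu Lp e
            H01_approx_weak_pderiv[OF T p]) auto
    next
      fix e e' assume "i = (0, e)" "e \<noteq> 0" "j = (0, e')" "e' \<noteq> 0"
      then show ?thesis using that(3) by simp
    qed
    then obtain D where D: "\<And>i j. i \<in> Basis \<Longrightarrow> j \<in> Basis \<Longrightarrow> snd i = 0 \<or> snd j = 0 \<Longrightarrow>
        L2 (S \<times> T) (D i j) \<and> l2norm (S \<times> T) (D i j) \<le> c * N \<and> weak_pderiv (S \<times> T) i (G j) (D i j)"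
      by metis
    define r where "r i j z = a' i j z * G j z + entry A i j z * D i j z" for i j z
    have r: "weak_pderiv (S \<times> T) i (\<lambda>z. entry A i j z * G j z) (r i j)" "L2 (S \<times> T) (r i j)"
      "l2norm (S \<times> T) (r i j) \<le> 2 * M * c * N"
      if ij: "i \<in> Basis" "j \<in> Basis" "snd i = 0 \<or> snd j = 0" for i j
    proof -
      note Dij = D[OF ij]
      show "weak_pderiv (S \<times> T) i (\<lambda>z. entry A i j z * G j z) (r i j)"
        unfolding r_def[abs_def]
        using weak_pderiv_mult[OF ST' Linf_A[OF ij(1,2)] M(2,3)[OF ij(1,2)] LG(2)[OF ij(2)]] Dij by blast
      have m: "entry A i j \<in> borel_measurable (lebesgue_on (S \<times> T))" "a' i j \<in> borel_measurable (lebesgue_on (S \<times> T))"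
        using Linf_A[OF ij(1,2)] M(2)[OF ij(1,2)] by (auto simp: Linf_def)
      note b1 = L2_bounded_mult[OF LG(2)[OF ij(2)] m(2) M(5)[OF ij(1,2)]]
      have LD: "L2 (S \<times> T) (D i j)" using Dij by simp
      note b2 = L2_bounded_mult[OF LD m(1) M(4)[OF ij(1,2)]]
      show "L2 (S \<times> T) (r i j)" unfolding r_def[abs_def] by (intro L2_add b1 b2)
      have "l2norm (S \<times> T) (r i j) \<le> l2norm (S \<times> T) (\<lambda>z. a' i j z * G j z) + l2norm (S \<times> T) (\<lambda>z. entry A i j z * D i j z)"
        unfolding r_def[abs_def] by (intro l2norm_triangle b1 b2)
      also have "\<dots> \<le> M * (c * N) + M * (c * N)"
        using order_trans[OF b1(2)[OF M(1)] mult_left_mono[OF GN[OF ij(2)] M(1)]]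
          order_trans[OF b2(2)[OF M(1)] mult_left_mono[OF _ M(1)]] Dij by (intro add_mono) auto
      finally show "l2norm (S \<times> T) (r i j) \<le> 2 * M * c * N" by (simp add: algebra_simps)
    qed
    \<comment> \<open>\<open>s\<close> is the diagonal of the scaling with A_eps = D A D. On the
      blocks with an index in the first factor the weight \<open>s i * s j\<close> is \<epsilon> or
      \<epsilon>^2, at most \<epsilon> because \<epsilon> \<le> 1.\<close>
    define s where "s i = (if snd i = 0 then \<epsilon> else 1)" for i :: "'a \<times> 'b"
    define h where "h i j z = (if snd i = 0 \<or> snd j = 0 then s i * s j * r i j z else 0)" for i j z
    have s_le: "0 \<le> s i * s j" "s i * s j \<le> \<epsilon>" if "snd i = 0 \<or> snd j = 0" for i j
    proof -
      have "\<epsilon> * \<epsilon> \<le> \<epsilon>" using \<epsilon> by (simp add: mult_left_le)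
      then show "0 \<le> s i * s j" "s i * s j \<le> \<epsilon>" using that \<epsilon> by (auto simp: s_def)
    qed
    have h: "L2 (S \<times> T) (h i j)" "l2norm (S \<times> T) (h i j) \<le> \<epsilon> * (2 * M * c * N)" if ij: "i \<in> Basis" "j \<in> Basis" for i j
    proof -
      have nn: "0 \<le> \<epsilon> * (2 * M * c * N)" using \<epsilon> M(1) c0 N0 by simp
      show "L2 (S \<times> T) (h i j)"
        unfolding h_def[abs_def] using r(2)[OF ij] by (cases "snd i = 0 \<or> snd j = 0") (auto intro: L2_cmult)
      show "l2norm (S \<times> T) (h i j) \<le> \<epsilon> * (2 * M * c * N)"
      proof (cases "snd i = 0 \<or> snd j = 0")
        case True
        have "l2norm (S \<times> T) (h i j) = (s i * s j) * l2norm (S \<times> T) (r i j)"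
          using True s_le[OF True] l2norm_cmult[of "S \<times> T" "s i * s j" "r i j"] unfolding h_def[abs_def] by auto
        also have "\<dots> \<le> \<epsilon> * (2 * M * c * N)"
          using s_le[OF True] r(3)[OF ij True] \<epsilon> by (intro mult_mono) auto
        finally show ?thesis .
      next
        case False
        then have "h i j = (\<lambda>z. 0)" by (auto simp: h_def fun_eq_iff)
        then show ?thesis using nn by simp
      qed
    qed
    \<comment> \<open>The A22 block carries weight 1 and contributes \<open>f\<close> as a whole;
      only the other blocks are expanded by the product rule, into \<open>h\<close>.\<close>
    define f' where "f' z = f z + (\<Sum>i\<in>Basis. \<Sum>j\<in>Basis. h i j z)" for z
    note Lf = gen0D(2)[OF gen]
    have Lf': "L2 (S \<times> T) f'" unfolding f'_def[abs_def] by (intro L2_add L2_sum h Lf)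
    have "l2dist (S \<times> T) f' f = l2norm (S \<times> T) (\<lambda>z. \<Sum>i\<in>Basis. \<Sum>j\<in>Basis. h i j z)"
      by (simp add: f'_def)
    also have "\<dots> \<le> (\<Sum>i\<in>Basis. l2norm (S \<times> T) (\<lambda>z. \<Sum>j\<in>Basis. h i j z))"
      by (intro l2norm_sum_le L2_sum h)
    also have "\<dots> \<le> (\<Sum>i\<in>Basis. \<Sum>j\<in>Basis. l2norm (S \<times> T) (h i j))"
      by (intro sum_mono l2norm_sum_le h)
    also have "\<dots> \<le> (\<Sum>i\<in>(Basis::('a \<times> 'b) set). \<Sum>j\<in>(Basis::('a \<times> 'b) set). \<epsilon> * (2 * M * c * N))"
      by (intro sum_mono h)
    also have "\<dots> = \<epsilon> * (C * N)"
      unfolding C_def by simp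
    finally have dist: "l2dist (S \<times> T) f' f \<le> \<epsilon> * (C * (l2norm T p + (\<Sum>j\<in>Basis. l2norm T (q j))))"
      unfolding N_def .
    define Gv where "Gv z = (\<Sum>i\<in>Basis. G i z *\<^sub>R i)" for z
    have Gv: "Gv z \<bullet> i = G i z" if "i \<in> Basis" for z i
      unfolding Gv_def by (rule vector_of_components[OF that])
    have wg: "weak_grad (S \<times> T) (\<lambda>z. u (fst z) * p (snd z)) Gv"
      unfolding weak_grad_def using LG(2) H01_approx_weak_pderiv[OF ST' HG] by (simp add: Gv)
    have weq: "weak_eq (\<lambda>j. G (0, j)) f"
      by (rule gen0_weak_eq[OF gen]) (intro LG H01_approx_weak_pderiv[OF ST' HG] Basis_snd; assumption)+
    have "gen_div (S \<times> T) (Aeps A \<epsilon>) (\<lambda>z. u (fst z) * p (snd z)) f'"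
      unfolding gen_div_def
    proof (intro conjI exI[of _ Gv] allI impI)
      show "H01 (S \<times> T) (\<lambda>z. u (fst z) * p (snd z))" by (rule H01_approx_H01[OF ST' HG])
      show "L2 (S \<times> T) f'" by (rule Lf')
      show "weak_grad (S \<times> T) (\<lambda>z. u (fst z) * p (snd z)) Gv" by (rule wg)
      fix \<phi> assume \<phi>: "test_fun (S \<times> T) \<phi>"
      show "integrable (lebesgue_on (S \<times> T)) (\<lambda>z. f' z * \<phi> z)" by (intro L2_mult_integrable Lf' test_L2 \<phi>)
      define X where "X i j = (\<integral>z. entry A i j z * G j z * pd i \<phi> z \<partial>lebesgue_on (S \<times> T))" for i j
      have e: "Aeps A \<epsilon> z (Gv z) \<bullet> grad \<phi> z = (\<Sum>i\<in>Basis. \<Sum>j\<in>Basis. s i * s j * (entry A i j z * G j z * pd i \<phi> z))" for z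
        unfolding Aeps_expand s_def by (intro sum.cong refl) (simp only: Gv grad_inner)
      have i: "integrable (lebesgue_on (S \<times> T)) (\<lambda>z. s i * s j * (entry A i j z * G j z * pd i \<phi> z))" if "i \<in> Basis" "j \<in> Basis" for i j
        by (intro integrable_mult_right weak_term_integrable LG test_L2 \<phi> that)
      show "integrable (lebesgue_on (S \<times> T)) (\<lambda>z. Aeps A \<epsilon> z (Gv z) \<bullet> grad \<phi> z)"
        unfolding e by (intro Bochner_Integration.integrable_sum i)
      have "(\<integral>z. Aeps A \<epsilon> z (Gv z) \<bullet> grad \<phi> z \<partial>lebesgue_on (S \<times> T))
          = (\<Sum>i\<in>Basis. \<integral>z. (\<Sum>j\<in>Basis. s i * s j * (entry A i j z * G j z * pd i \<phi> z)) \<partial>lebesgue_on (S \<times> T))"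
        unfolding e by (intro Bochner_Integration.integral_sum Bochner_Integration.integrable_sum i)
      also have "\<dots> = (\<Sum>i\<in>Basis. \<Sum>j\<in>Basis. \<integral>z. s i * s j * (entry A i j z * G j z * pd i \<phi> z) \<partial>lebesgue_on (S \<times> T))"
        by (intro sum.cong refl Bochner_Integration.integral_sum i)
      also have "\<dots> = (\<Sum>i\<in>Basis. \<Sum>j\<in>Basis. s i * s j * X i j)"
        unfolding X_def by simp
      also have "\<dots> = (\<Sum>i\<in>Basis. \<Sum>j\<in>Basis. - (\<integral>z. h i j z * \<phi> z \<partial>lebesgue_on (S \<times> T)) + (if snd i = 0 \<or> snd j = 0 then 0 else X i j))"
      proof (intro sum.cong refl)
        fix i j :: "'a \<times> 'b" assume ij: "i \<in> Basis" "j \<in> Basis"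
        show "s i * s j * X i j = - (\<integral>z. h i j z * \<phi> z \<partial>lebesgue_on (S \<times> T)) + (if snd i = 0 \<or> snd j = 0 then 0 else X i j)"
        proof (cases "snd i = 0 \<or> snd j = 0")
          case True
          have "X i j = - (\<integral>z. r i j z * \<phi> z \<partial>lebesgue_on (S \<times> T))"
            unfolding X_def by (rule weak_pderivD(3)[OF r(1)[OF ij True] \<phi>])
          moreover have "(\<lambda>z. h i j z * \<phi> z) = (\<lambda>z. s i * s j * (r i j z * \<phi> z))"
            using True by (auto simp: h_def fun_eq_iff)
          ultimately show ?thesis using True by simp
        next
          case False
          then show ?thesis by (simp add: s_def h_def)
        qed
      qed
      also have "\<dots> = - (\<Sum>i\<in>Basis. \<Sum>j\<in>Basis. \<integral>z. h i j z * \<phi> z \<partial>lebesgue_on (S \<times> T))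
          + (\<Sum>i\<in>Basis. \<Sum>j\<in>Basis. if snd i = 0 \<or> snd j = 0 then 0 else X i j)"
        by (simp add: sum.distrib sum_negf sum_subtractf)
      \<comment> \<open>Splitting the basis leaves only indices from the second factor, and these
        terms form the weak equation of A0 tested with \<phi>.\<close>
      also have "(\<Sum>i\<in>Basis. \<Sum>j\<in>Basis. if snd i = 0 \<or> snd j = 0 then 0 else X i j) = (\<Sum>i\<in>Basis. \<Sum>j\<in>Basis. X (0, i) (0, j))"
        unfolding sum_Basis_prod by (auto intro!: sum.cong)
      also have "\<dots> = - (\<integral>z. f z * \<phi> z \<partial>lebesgue_on (S \<times> T))"
        using weq \<phi> unfolding weak_eq_def X_def by blast
      also have "(\<Sum>i\<in>Basis. \<Sum>j\<in>Basis. \<integral>z. h i j z * \<phi> z \<partial>lebesgue_on (S \<times> T)) = (\<Sum>i\<in>Basis. \<integral>z. (\<Sum>j\<in>Basis. h i j z * \<phi> z) \<partial>lebesgue_on (S \<times> T))"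
        by (intro sum.cong refl Bochner_Integration.integral_sum[symmetric] L2_mult_integrable h test_L2 \<phi>)
      also have "\<dots> = (\<integral>z. (\<Sum>i\<in>Basis. \<Sum>j\<in>Basis. h i j z * \<phi> z) \<partial>lebesgue_on (S \<times> T))"
        by (intro Bochner_Integration.integral_sum[symmetric] Bochner_Integration.integrable_sum L2_mult_integrable h test_L2 \<phi>)
      also have "- \<dots> + - (\<integral>z. f z * \<phi> z \<partial>lebesgue_on (S \<times> T)) = - (\<integral>z. f' z * \<phi> z \<partial>lebesgue_on (S \<times> T))"
      proof -
        have "integrable (lebesgue_on (S \<times> T)) (\<lambda>z. \<Sum>i\<in>Basis. \<Sum>j\<in>Basis. h i j z * \<phi> z)"
          by (intro Bochner_Integration.integrable_sum L2_mult_integrable h test_L2 \<phi>)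
        moreover have "integrable (lebesgue_on (S \<times> T)) (\<lambda>z. f z * \<phi> z)"
          by (intro L2_mult_integrable Lf test_L2 \<phi>)
        ultimately show ?thesis
          by (simp add: f'_def distrib_right sum_distrib_right)
      qed
      finally show "(\<integral>z. Aeps A \<epsilon> z (Gv z) \<bullet> grad \<phi> z \<partial>lebesgue_on (S \<times> T)) = - (\<integral>z. f' z * \<phi> z \<partial>lebesgue_on (S \<times> T))" .
    qed
    with dist show "\<exists>f'. gen_div (S \<times> T) (Aeps A \<epsilon>) (\<lambda>z. u (fst z) * p (snd z)) f' \<and>
      l2dist (S \<times> T) f' f \<le> \<epsilon> * (C * (l2norm T p + (\<Sum>j\<in>Basis. l2norm T (q j))))" by blast
  qed
qed

text \<open>If b is closer to u than the norm of u, Cauchy-Schwarz for u and u - b forces the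
  integral of u b to be positive; rescaling makes it 1.\<close>

lemma dual_test_fun:
  assumes u: "L2 S u" "l2norm S u \<noteq> 0"
  obtains b where "test_fun S b" "(\<integral>x. u x * b x \<partial>lebesgue_on S) = 1"
proof -
  have pos: "l2norm S u > 0" using u(2) l2norm_nonneg[of S u] by linarith
  obtain b where b: "b \<in> bump_span S" "l2norm S (\<lambda>x. u x - b x) < l2norm S u"
    using bump_span_dense[OF S u(1) pos] .
  have Lb: "L2 S b" by (rule bump_span_L2[OF S b(1)])
  define c where "c = (\<integral>x. u x * b x \<partial>lebesgue_on S)"
  have "(\<integral>x. u x * (u x - b x) \<partial>lebesgue_on S) = (l2norm S u)\<^sup>2 - c"
    using L2_mult_integrable[OF u(1) u(1)] L2_mult_integrable[OF u(1) Lb]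
    by (simp add: c_def l2norm_sq right_diff_distrib flip: power2_eq_square)
  moreover have "(\<integral>x. u x * (u x - b x) \<partial>lebesgue_on S) \<le> l2norm S u * l2norm S (\<lambda>x. u x - b x)"
    using L2_Cauchy_Schwarz[OF u(1) L2_diff[OF u(1) Lb]] by linarith
  moreover have "\<dots> < l2norm S u * l2norm S u" using b(2) pos by simp
  ultimately have "c > 0" by (simp add: power2_eq_square)
  then show ?thesis
    by (intro that[of "\<lambda>x. inverse c * b x"] test_fun_cmult bump_span_test_fun b)
       (simp add: mult.left_commute[of _ "inverse c"] flip: c_def)
qed

text \<open>The H2 regularity of u pays for the X1 derivatives in A_eps. That of v puts g into the
  domain of A0, so the generator stays bounded along the orbit and the constant is independent of t
  and \<epsilon>.\<close>

lemma tensor_estimate: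
  assumes u: "H01 S u" "H2 S u" and v: "H01 T v" "H2 T v"
    and Seps: "\<And>\<epsilon>. 0 < \<epsilon> \<Longrightarrow> \<epsilon> \<le> 1 \<Longrightarrow> C0_contraction_semigroup (S \<times> T) (Se \<epsilon>) (gen_div (S \<times> T) (Aeps A \<epsilon>))"
    and S0: "C0_contraction_semigroup (S \<times> T) S0 (gen0 S T A)"
  shows "\<exists>C\<ge>0. \<forall>\<epsilon> t. 0 < \<epsilon> \<and> \<epsilon> \<le> 1 \<and> t \<ge> 0 \<longrightarrow>
    l2dist (S \<times> T) (Se \<epsilon> t (\<lambda>z. u (fst z) * v (snd z))) (S0 t (\<lambda>z. u (fst z) * v (snd z))) \<le> C * t * \<epsilon>"
proof -
  define g where "g z = u (fst z) * v (snd z)" for z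
  have Lu: "L2 S u" and Lv: "L2 T v" using u v by (auto simp: H01_def)
  have Lg: "L2 (S \<times> T) g" unfolding g_def[abs_def] by (intro L2_tensor Lu Lv S T)
  have "\<exists>C\<ge>0. \<forall>\<epsilon> t. 0 < \<epsilon> \<and> \<epsilon> \<le> 1 \<and> t \<ge> 0 \<longrightarrow> l2dist (S \<times> T) (Se \<epsilon> t g) (S0 t g) \<le> C * t * \<epsilon>"
  proof (cases "l2norm S u = 0")
    \<comment> \<open>If u vanishes almost everywhere, no b has integral 1 against it. Both orbits
      then have norm 0 by contractivity.\<close>
    case True
    then have g0: "l2norm (S \<times> T) g = 0" unfolding g_def[abs_def] by (simp add: l2norm_tensor[OF Lu Lv S(1) T(1)])
    have "l2dist (S \<times> T) (Se \<epsilon> t g) (S0 t g) \<le> 0" if "0 < \<epsilon>" "\<epsilon> \<le> 1" "t \<ge> 0" for \<epsilon> t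
      using l2norm_diff_le[OF semigroup_L2[OF Seps[OF that(1,2)] that(3) Lg] semigroup_L2[OF S0 that(3) Lg]]
        semigroup_contraction[OF Seps[OF that(1,2)] that(3) Lg] semigroup_contraction[OF S0 that(3) Lg] g0 by linarith
    then show ?thesis by (intro exI[of _ 0]) auto
  next
    case False
    then have nu: "l2norm S u > 0" using l2norm_nonneg[of S u] by linarith
    obtain b where b: "test_fun S b" "(\<integral>x. u x * b x \<partial>lebesgue_on S) = 1"
      using dual_test_fun[OF Lu False] .
    note Lb = test_fun_L2[OF b(1) S]
    obtain k where k: "H01_approx S u k" by (rule H01_obtain_approx[OF S u(1)])
    obtain k2 where k2: "\<And>i j. i \<in> Basis \<Longrightarrow> j \<in> Basis \<Longrightarrow> L2 S (k2 i j) \<and> weak_pderiv S i (k j) (k2 i j)"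
      using H2_second_derivatives[OF S u(2) k] by blast
    obtain m where m: "H01_approx T v m" by (rule H01_obtain_approx[OF T v(1)])
    obtain m2 where m2: "\<And>i j. i \<in> Basis \<Longrightarrow> j \<in> Basis \<Longrightarrow> L2 T (m2 i j) \<and> weak_pderiv T i (m j) (m2 i j)"
      using H2_second_derivatives[OF T v(2) m] by blast
    obtain f where f: "gen0 S T A g f"
      using gen0_tensor_domain[OF Lu m m2] unfolding g_def[abs_def] by blast
    note Lf = gen0D(2)[OF f]
    obtain C where C: "C \<ge> 0" "\<And>p q f \<epsilon>. H01_approx T p q \<Longrightarrow> gen0 S T A (\<lambda>z. u (fst z) * p (snd z)) f \<Longrightarrow>
      0 < \<epsilon> \<Longrightarrow> \<epsilon> \<le> 1 \<Longrightarrow> \<exists>f'. gen_div (S \<times> T) (Aeps A \<epsilon>) (\<lambda>z. u (fst z) * p (snd z)) f' \<and>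
        l2dist (S \<times> T) f' f \<le> \<epsilon> * (C * (l2norm T p + (\<Sum>j\<in>Basis. l2norm T (q j))))"
      using gen_div_tensor[OF k k2] by blast
    define P where "P = proj u b"
    have P_g: "P g = g"
      by (simp add: P_def proj_def g_def fun_eq_iff b(2) mult.assoc mult.left_commute[of _ "v _"])
    have PL: "L2 (S \<times> T) (P h)" if "L2 (S \<times> T) h" for h unfolding P_def by (rule proj_L2[OF Lu Lb that])
    define \<kappa> where "\<kappa> = l2norm S u * l2norm S b"
    have PB: "l2norm (S \<times> T) (P h) \<le> \<kappa> * l2norm (S \<times> T) h" if "L2 (S \<times> T) h" for h
      unfolding P_def \<kappa>_def by (rule proj_bound[OF Lu Lb that])
    have \<kappa>0: "\<kappa> \<ge> 0" by (simp add: \<kappa>_def)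
    have Plin: "l2dist (S \<times> T) (P (\<lambda>z. \<alpha> * h z + \<beta> * h' z)) (\<lambda>z. \<alpha> * P h z + \<beta> * P h' z) = 0"
      if "L2 (S \<times> T) h" "L2 (S \<times> T) h'" for h h' \<alpha> \<beta>
      unfolding P_def by (rule proj_linear[OF Lu Lb that])
    have genP: "gen0 S T A (P w) (P w')" if w: "gen0 S T A w w'" for w w'
    proof -
      obtain q where "\<forall>j\<in>Basis. L2 (S \<times> T) (q j) \<and> weak_pderiv (S \<times> T) (0, j) w (q j)"
        using gen0D(4)[OF w] by blast
      then show ?thesis unfolding P_def using gen0_proj(2)[OF Lu b(1) w, of q] by blast
    qed
    have orbit: "gen0 S T A (S0 t g) (S0 t f)" if "t \<ge> 0" for t
      using semigroup_generator[OF S0, OF f that] .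
    have commute: "l2dist (S \<times> T) (S0 t g) (P (S0 t g)) = 0" if t: "t \<ge> 0" for t
    proof -
      have "l2dist (S \<times> T) (S0 t (P g)) (P (S0 t g)) \<le> 0 * t"
      \<comment> \<open>Both semigroups are \<open>S0\<close> and the intermediate operator is P.
        The generator value at P w is exactly P applied to the one at w, so the bound K is
        0.\<close>
      proof (rule semigroup_comparison[OF S0 S0 PL Plin PB \<kappa>0 Lg _ t])
        fix t :: real assume "t \<ge> 0"
        from orbit[OF this] show "\<exists>w w1 f1 f2. l2dist (S \<times> T) w (S0 t g) = 0 \<and> l2dist (S \<times> T) w1 (P w) = 0 \<and>
            gen0 S T A w1 f1 \<and> gen0 S T A w f2 \<and> l2dist (S \<times> T) f1 (P f2) \<le> 0"
          by (intro exI[of _ "S0 t g"] exI[of _ "P (S0 t g)"] exI[of _ "P (S0 t f)"] exI[of _ "S0 t f"]) (simp add: genP)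
      qed
      then show ?thesis using l2norm_nonneg[of "S \<times> T" "\<lambda>z. S0 t g z - P (S0 t g) z"] unfolding P_g by linarith
    qed
    \<comment> \<open>\<open>R\<close> bounds the norm of p for all t. \<open>E\<close> is the
      energy inequality solved for the squared gradient of p, with the generator bounded along the
      orbit, and \<open>B\<close> bounds p and its gradient together.\<close>
    define R where "R = l2norm S b * l2norm (S \<times> T) g"
    define E where "E = (\<kappa> * l2norm (S \<times> T) f) * (l2norm S u * R) / (lam * (l2norm S u)\<^sup>2)"
    define B where "B = R + (\<Sum>j\<in>(Basis :: 'b set). sqrt E)"
    have R0: "R \<ge> 0" by (simp add: R_def)
    have E0: "E \<ge> 0" using \<kappa>0 R0 lam_pos by (simp add: E_def)
    have B0: "B \<ge> 0" using R0 E0 by (simp add: B_def)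
    have est: "l2dist (S \<times> T) (Se \<epsilon> t g) (S0 t g) \<le> (\<epsilon> * (C * B)) * t" if \<epsilon>: "0 < \<epsilon>" "\<epsilon> \<le> 1" and t: "t \<ge> 0" for \<epsilon> t
    proof (rule semigroup_comparison[OF Seps[OF \<epsilon>] S0, of "\<lambda>h. h" 1])
      fix t :: real assume t: "t \<ge> 0"
      note o = orbit[OF t]
      obtain q where q: "\<And>j. j \<in> Basis \<Longrightarrow> L2 (S \<times> T) (q j)" "\<And>j. j \<in> Basis \<Longrightarrow> weak_pderiv (S \<times> T) (0, j) (S0 t g) (q j)"
        using gen0D(4)[OF o] by blast
      define p where "p x = (\<integral>y. S0 t g (y, x) * b y \<partial>lebesgue_on S)" for x
      define p' where "p' j x = (\<integral>y. q j (y, x) * b y \<partial>lebesgue_on S)" for j x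
      have p: "H01_approx T p p'"
        unfolding p_def[abs_def] p'_def[abs_def] by (rule gen0_proj(1)[OF Lu b(1) o q])
      have Pp: "P (S0 t g) = (\<lambda>z. u (fst z) * p (snd z))"
        by (auto simp: P_def proj_def p_def)
      have gp: "gen0 S T A (\<lambda>z. u (fst z) * p (snd z)) (P (S0 t f))"
        using genP[OF o] unfolding Pp .
      have pR: "l2norm T p \<le> R"
      proof -
        have "l2norm T p \<le> l2norm (S \<times> T) (S0 t g) * l2norm S b"
          unfolding p_def[abs_def] by (rule l2norm_integral_fst[OF S T semigroup_L2[OF S0 t Lg] Lb])
        also have "\<dots> \<le> l2norm (S \<times> T) g * l2norm S b"
          by (intro mult_right_mono semigroup_contraction[OF S0 t Lg]) simp
        finally show ?thesis by (simp add: R_def mult.commute)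
      qed
      have Pf: "l2norm (S \<times> T) (P (S0 t f)) \<le> \<kappa> * l2norm (S \<times> T) f"
        using PB[OF semigroup_L2[OF S0 t Lf]] mult_left_mono[OF semigroup_contraction[OF S0 t Lf] \<kappa>0] by linarith
      have "lam * (l2norm S u)\<^sup>2 * (\<Sum>j\<in>Basis. (l2norm T (p' j))\<^sup>2) \<le> l2norm (S \<times> T) (P (S0 t f)) * (l2norm S u * l2norm T p)"
        by (rule gen0_energy[OF k p gp])
      also have "\<dots> \<le> (\<kappa> * l2norm (S \<times> T) f) * (l2norm S u * R)"
        using \<kappa>0 R0 by (intro mult_mono Pf mult_left_mono pR) auto
      finally have sumE: "(\<Sum>j\<in>Basis. (l2norm T (p' j))\<^sup>2) \<le> E"
        unfolding E_def using lam_pos nu by (simp add: pos_le_divide_eq mult.commute)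
      have "l2norm T (p' j) \<le> sqrt E" if "j \<in> Basis" for j
        using member_le_sum[OF that, of "\<lambda>j. (l2norm T (p' j))\<^sup>2"] sumE by (intro real_le_rsqrt) simp
      then have "(\<Sum>j\<in>Basis. l2norm T (p' j)) \<le> (\<Sum>j\<in>(Basis :: 'b set). sqrt E)" by (rule sum_mono)
      then have N: "l2norm T p + (\<Sum>j\<in>Basis. l2norm T (p' j)) \<le> B" using pR by (simp add: B_def)
      obtain f' where f': "gen_div (S \<times> T) (Aeps A \<epsilon>) (\<lambda>z. u (fst z) * p (snd z)) f'"
        "l2dist (S \<times> T) f' (P (S0 t f)) \<le> \<epsilon> * (C * (l2norm T p + (\<Sum>j\<in>Basis. l2norm T (p' j))))"
        using C(2)[OF p gp \<epsilon>] by blast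
      have "l2dist (S \<times> T) f' (P (S0 t f)) \<le> \<epsilon> * (C * B)"
        using f'(2) mult_left_mono[OF mult_left_mono[OF N C(1)] less_imp_le[OF \<epsilon>(1)]] by linarith
      \<comment> \<open>The comparison takes place at the representative u \<otimes> p, equal to the
        orbit point almost everywhere since P fixes it; the structured form is what gives membership
        in the domain of A_eps.\<close>
      moreover have "l2dist (S \<times> T) (\<lambda>z. u (fst z) * p (snd z)) (S0 t g) = 0"
        using commute[OF t] unfolding Pp by (simp add: l2norm_minus_commute[of "S \<times> T" "S0 t g"])
      ultimately show "\<exists>w w1 f1 f2. l2dist (S \<times> T) w (S0 t g) = 0 \<and> l2dist (S \<times> T) w1 w = 0 \<and>
          gen_div (S \<times> T) (Aeps A \<epsilon>) w1 f1 \<and> gen0 S T A w f2 \<and> l2dist (S \<times> T) f1 f2 \<le> \<epsilon> * (C * B)"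
        using f'(1) gp by (intro exI[of _ "\<lambda>z. u (fst z) * p (snd z)"] exI[of _ f'] exI[of _ "P (S0 t f)"]) simp
    qed (use Lg t in auto)
    show ?thesis
      using est C(1) B0 by (intro exI[of _ "C * B"]) (auto simp: ac_simps)
  qed
  then show ?thesis unfolding g_def[abs_def] .
qed

lemma tensor_sum_estimate:
  assumes g: "tensor_H012 S T g"
    and Seps: "\<And>\<epsilon>. 0 < \<epsilon> \<Longrightarrow> \<epsilon> \<le> 1 \<Longrightarrow> C0_contraction_semigroup (S \<times> T) (Se \<epsilon>) (gen_div (S \<times> T) (Aeps A \<epsilon>))"
    and S0: "C0_contraction_semigroup (S \<times> T) S0 (gen0 S T A)"
  obtains C where "C > 0" "\<And>\<epsilon> t. 0 < \<epsilon> \<Longrightarrow> \<epsilon> \<le> 1 \<Longrightarrow> t \<ge> 0 \<Longrightarrow> l2dist (S \<times> T) (Se \<epsilon> t g) (S0 t g) \<le> C * t * \<epsilon>"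
proof -
  obtain n :: nat and u v where Lg: "L2 (S \<times> T) g"
    and uv': "\<forall>k<n. H01 S (u k) \<and> H2 S (u k) \<and> H01 T (v k) \<and> H2 T (v k)"
    and g_eq: "AE z in lebesgue_on (S \<times> T). g z = (\<Sum>k<n. u k (fst z) * v k (snd z))"
    using g unfolding tensor_H012_def by blast
  then have uv: "\<And>k. k < n \<Longrightarrow> H01 S (u k) \<and> H2 S (u k) \<and> H01 T (v k) \<and> H2 T (v k)"
    by blast
  define gk where "gk k z = u k (fst z) * v k (snd z)" for k z
  have Lk: "L2 (S \<times> T) (gk k)" if "k < n" for k
    unfolding gk_def[abs_def] using uv[OF that] by (intro L2_tensor S T) (auto simp: H01_def)
  \<comment> \<open>\<open>g\<close> is a sum of tensors only almost everywhere. Passing to this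
    literal sum costs distance 0 in both semigroups.\<close>
  define gs where "gs z = (\<Sum>k<n. gk k z)" for z
  have Ls: "L2 (S \<times> T) gs" unfolding gs_def[abs_def] by (rule L2_sum) (use Lk in auto)
  have gs: "l2dist (S \<times> T) g gs = 0"
    using g_eq by (subst l2norm_eq_0_iff[OF L2_diff[OF Lg Ls]]) (auto simp: gs_def gk_def elim: eventually_mono)
  have "\<exists>C. k < n \<longrightarrow> C \<ge> 0 \<and> (\<forall>\<epsilon> t. 0 < \<epsilon> \<and> \<epsilon> \<le> 1 \<and> t \<ge> 0 \<longrightarrow>
    l2dist (S \<times> T) (Se \<epsilon> t (gk k)) (S0 t (gk k)) \<le> C * t * \<epsilon>)" for k
    using tensor_estimate[of "u k" "v k" Se S0] uv[of k] Seps S0 unfolding gk_def[abs_def] by blast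
  then obtain c where c: "\<And>k. k < n \<Longrightarrow> c k \<ge> 0" "\<And>k \<epsilon> t. k < n \<Longrightarrow> 0 < \<epsilon> \<Longrightarrow> \<epsilon> \<le> 1 \<Longrightarrow> t \<ge> 0 \<Longrightarrow>
    l2dist (S \<times> T) (Se \<epsilon> t (gk k)) (S0 t (gk k)) \<le> c k * t * \<epsilon>"
    by metis
  \<comment> \<open>The summand 1 makes the constant strictly positive even if all the constants of
    the tensors vanish.\<close>
  define C where "C = (\<Sum>k<n. c k) + 1"
  have C0: "C > 0" unfolding C_def using sum_nonneg[of "{..<n}" c] c(1) by force
  show ?thesis
  proof (rule that[OF C0])
    fix \<epsilon> t :: real assume \<epsilon>: "0 < \<epsilon>" "\<epsilon> \<le> 1" and t: "t \<ge> 0"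
    note SE = Seps[OF \<epsilon>]
    note LE = semigroup_L2[OF SE t] and L0 = semigroup_L2[OF S0 t]
    have Lse: "L2 (S \<times> T) (\<lambda>z. \<Sum>k<n. Se \<epsilon> t (gk k) z)" and Ls0: "L2 (S \<times> T) (\<lambda>z. \<Sum>k<n. S0 t (gk k) z)"
      by (rule L2_sum; use LE L0 Lk in auto)+
    have 1: "l2dist (S \<times> T) (Se \<epsilon> t g) (Se \<epsilon> t gs) \<le> 0" "l2dist (S \<times> T) (S0 t gs) (S0 t g) \<le> 0"
      using semigroup_dist[OF SE t Lg Ls] semigroup_dist[OF S0 t Ls Lg] gs l2norm_minus_commute[of "S \<times> T" g gs] by simp_all
    have 2: "l2dist (S \<times> T) (Se \<epsilon> t gs) (\<lambda>z. \<Sum>k<n. Se \<epsilon> t (gk k) z) = 0" "l2dist (S \<times> T) (S0 t gs) (\<lambda>z. \<Sum>k<n. S0 t (gk k) z) = 0"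
      unfolding gs_def[abs_def] by (rule semigroup_sum[OF SE t Lk] semigroup_sum[OF S0 t Lk]; assumption)+
    have "l2dist (S \<times> T) (\<lambda>z. \<Sum>k<n. Se \<epsilon> t (gk k) z) (\<lambda>z. \<Sum>k<n. S0 t (gk k) z)
      = l2norm (S \<times> T) (\<lambda>z. \<Sum>k<n. Se \<epsilon> t (gk k) z - S0 t (gk k) z)"
      by (simp add: sum_subtractf)
    also have "\<dots> \<le> (\<Sum>k<n. l2dist (S \<times> T) (Se \<epsilon> t (gk k)) (S0 t (gk k)))"
      by (rule l2norm_sum_le) (use LE L0 Lk in \<open>auto intro: L2_diff\<close>)
    also have "\<dots> \<le> (\<Sum>k<n. c k * t * \<epsilon>)" by (rule sum_mono) (use c(2) \<epsilon> t in auto)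
    also have "\<dots> \<le> C * t * \<epsilon>" using \<epsilon> t by (simp add: C_def sum_distrib_right distrib_right)
    finally have 3: "l2dist (S \<times> T) (\<lambda>z. \<Sum>k<n. Se \<epsilon> t (gk k) z) (\<lambda>z. \<Sum>k<n. S0 t (gk k) z) \<le> C * t * \<epsilon>" .
    note tri = l2norm_triangle_diff[of "S \<times> T"]
    show "l2dist (S \<times> T) (Se \<epsilon> t g) (S0 t g) \<le> C * t * \<epsilon>"
      using tri[OF LE[OF Lg] LE[OF Ls] L0[OF Lg]] tri[OF LE[OF Ls] Lse L0[OF Lg]] tri[OF Lse Ls0 L0[OF Lg]]
        tri[OF Ls0 L0[OF Ls] L0[OF Lg]] 1 2 3 l2norm_minus_commute[of "S \<times> T" "S0 t gs" "\<lambda>z. \<Sum>k<n. S0 t (gk k) z"]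
      by linarith
  qed
qed

lemma semigroup_convergence:
  assumes Seps: "\<And>\<epsilon>. 0 < \<epsilon> \<Longrightarrow> \<epsilon> \<le> 1 \<Longrightarrow> C0_contraction_semigroup (S \<times> T) (Se \<epsilon>) (gen_div (S \<times> T) (Aeps A \<epsilon>))"
    and S0: "C0_contraction_semigroup (S \<times> T) S0 (gen0 S T A)"
    and g: "L2 (S \<times> T) g" and \<tau>: "\<tau> \<ge> 0"
  shows "((\<lambda>\<epsilon>. SUP t\<in>{0..\<tau>}. l2dist (S \<times> T) (Se \<epsilon> t g) (S0 t g)) \<longlongrightarrow> 0) (at_right 0)"
proof (rule tendstoI)
  fix e :: real assume e: "e > 0"
  then have "e / 4 > 0" by simp
  \<comment> \<open>Contractivity bounds the two errors of replacing \<open>g\<close> by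
    \<open>p\<close> uniformly in t and \<epsilon>, the rate for \<open>p\<close> bounds the third.
    Quarters are used because the supremum is only estimated with \<le>, while the limit needs a
    strict inequality.\<close>
  from bump_span_dense[OF ST' g this] obtain p where p: "p \<in> bump_span (S \<times> T)" "l2dist (S \<times> T) g p < e / 4" .
  have tp: "tensor_H012 S T p" by (rule bump_span_tensor[OF S T p(1)])
  then have Lp: "L2 (S \<times> T) p" by (simp add: tensor_H012_def)
  obtain C where C: "C > 0" "\<And>\<epsilon> t. 0 < \<epsilon> \<Longrightarrow> \<epsilon> \<le> 1 \<Longrightarrow> t \<ge> 0 \<Longrightarrow> l2dist (S \<times> T) (Se \<epsilon> t p) (S0 t p) \<le> C * t * \<epsilon>"
    using tensor_sum_estimate[OF tp Seps S0] by blast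
  \<comment> \<open>The factor \<tau> + 1 keeps the denominator positive for \<tau> = 0; the minimum
    with 1 keeps \<epsilon> in the range where the semigroups are given.\<close>
  define d where "d = min 1 (e / (4 * (C * (\<tau> + 1))))"
  have d: "d > 0" using e C(1) \<tau> by (simp add: d_def)
  have main: "dist (SUP t\<in>{0..\<tau>}. l2dist (S \<times> T) (Se \<epsilon> t g) (S0 t g)) 0 < e" if \<epsilon>: "0 < \<epsilon>" "\<epsilon> < d" for \<epsilon>
  proof -
    have \<epsilon>1: "\<epsilon> \<le> 1" and \<epsilon>2: "\<epsilon> \<le> e / (4 * (C * (\<tau> + 1)))" using \<epsilon> by (auto simp: d_def)
    note SE = Seps[OF \<epsilon>(1) \<epsilon>1]
    have le: "l2dist (S \<times> T) (Se \<epsilon> t g) (S0 t g) \<le> 3 * (e / 4)" if t: "t \<in> {0..\<tau>}" for t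
    proof -
      have t0: "t \<ge> 0" using t by simp
      note LE = semigroup_L2[OF SE t0] and L0 = semigroup_L2[OF S0 t0]
      have 1: "l2dist (S \<times> T) (Se \<epsilon> t g) (Se \<epsilon> t p) \<le> e / 4" "l2dist (S \<times> T) (S0 t p) (S0 t g) \<le> e / 4"
        using semigroup_dist[OF SE t0 g Lp] semigroup_dist[OF S0 t0 Lp g] p(2) l2norm_minus_commute[of "S \<times> T" g p] by simp_all
      have "C * t * \<epsilon> \<le> C * (\<tau> + 1) * (e / (4 * (C * (\<tau> + 1))))"
        using C(1) t \<epsilon> \<epsilon>2 by (intro mult_mono) auto
      also have "\<dots> = e / 4"
      proof -
        have "X * (e / (4 * X)) = e / 4" if "X \<noteq> 0" for X :: real using that by simp
        moreover have "C * (\<tau> + 1) \<noteq> 0" using C(1) \<tau> by simp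
        ultimately show ?thesis by blast
      qed
      finally have 2: "l2dist (S \<times> T) (Se \<epsilon> t p) (S0 t p) \<le> e / 4"
        using C(2)[OF \<epsilon>(1) \<epsilon>1 t0] by linarith
      show ?thesis
        using l2norm_triangle_diff[OF LE[OF g] LE[OF Lp] L0[OF g]] l2norm_triangle_diff[OF LE[OF Lp] L0[OF Lp] L0[OF g]] 1 2
        by linarith
    qed
    have up: "(SUP t\<in>{0..\<tau>}. l2dist (S \<times> T) (Se \<epsilon> t g) (S0 t g)) \<le> 3 * (e / 4)"
      by (rule cSUP_least) (use \<tau> le in auto)
    \<comment> \<open>The supremum dominates the nonnegative value at t = 0 only once the values are
      known to be bounded above.\<close>
    have "bdd_above ((\<lambda>t. l2dist (S \<times> T) (Se \<epsilon> t g) (S0 t g)) ` {0..\<tau>})"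
      by (rule bdd_aboveI2[OF le])
    from cSUP_upper[OF _ this, of 0] \<tau>
    have "l2dist (S \<times> T) (Se \<epsilon> 0 g) (S0 0 g) \<le> (SUP t\<in>{0..\<tau>}. l2dist (S \<times> T) (Se \<epsilon> t g) (S0 t g))" by simp
    then have "0 \<le> (SUP t\<in>{0..\<tau>}. l2dist (S \<times> T) (Se \<epsilon> t g) (S0 t g))"
      using l2norm_nonneg order_trans by blast
    then show ?thesis using up e by (simp add: dist_real_def)
  qed
  show "\<forall>\<^sub>F \<epsilon> in at_right 0. dist (SUP t\<in>{0..\<tau>}. l2dist (S \<times> T) (Se \<epsilon> t g) (S0 t g)) 0 < e"
    unfolding eventually_at_right_field using d main by (intro exI[of _ d]) auto
qed

end

theorem theorem4p2:
  fixes \<omega>1 :: "'a::euclidean_space set" and \<omega>2 :: "'b::euclidean_space set"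
    and A :: "'a \<times> 'b \<Rightarrow> 'a \<times> 'b \<Rightarrow> 'a \<times> 'b"
    and lam :: real
    and S :: "real \<Rightarrow> real \<Rightarrow> ('a \<times> 'b \<Rightarrow> real) \<Rightarrow> ('a \<times> 'b \<Rightarrow> real)"
    and S0 :: "real \<Rightarrow> ('a \<times> 'b \<Rightarrow> real) \<Rightarrow> ('a \<times> 'b \<Rightarrow> real)"
  assumes dom1: "open \<omega>1" "connected \<omega>1" "bounded \<omega>1" "\<omega>1 \<noteq> {}"
    and dom2: "open \<omega>2" "connected \<omega>2" "bounded \<omega>2" "\<omega>2 \<noteq> {}"
    and lin: "\<forall>x. linear (A x)"
    and lam_pos: "lam > 0"
    and ellip: "AE x in lebesgue_on (\<omega>1 \<times> \<omega>2). \<forall>\<xi>. A x \<xi> \<bullet> \<xi> \<ge> lam * (norm \<xi>)^2"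
    and Linf_coeff: "\<forall>i\<in>Basis. \<forall>j\<in>Basis. Linf (\<omega>1 \<times> \<omega>2) (entry A i j)"
    and A22_X2: "\<forall>x\<in>\<omega>1 \<times> \<omega>2. \<forall>y\<in>\<omega>1 \<times> \<omega>2. snd x = snd y \<longrightarrow> A22 A x = A22 A y"
    and mixed: "\<forall>i\<in>Basis. \<forall>j\<in>Basis. \<exists>w. L2 (\<omega>1 \<times> \<omega>2) w \<and>
                   weak_pderiv2 (\<omega>1 \<times> \<omega>2) (i, 0) (0, j) (entry A (i, 0) (0, j)) w"
    and W1inf: "\<forall>i\<in>Basis. \<forall>j\<in>Basis. Linf (\<omega>1 \<times> \<omega>2) (entry A i j) \<and>
                   (\<forall>e\<in>Basis. \<exists>w. Linf (\<omega>1 \<times> \<omega>2) w \<and> weak_pderiv (\<omega>1 \<times> \<omega>2) e (entry A i j) w)"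
    and S_eps: "\<forall>eps\<in>{0<..1}. C0_contraction_semigroup (\<omega>1 \<times> \<omega>2) (S eps) (gen_div (\<omega>1 \<times> \<omega>2) (Aeps A eps))"
    and S_0: "C0_contraction_semigroup (\<omega>1 \<times> \<omega>2) S0 (gen0 \<omega>1 \<omega>2 A)"
  shows "(\<forall>g T. L2 (\<omega>1 \<times> \<omega>2) g \<and> T \<ge> 0 \<longrightarrow>
            ((\<lambda>eps. SUP t\<in>{0..T}. l2norm (\<omega>1 \<times> \<omega>2) (\<lambda>x. S eps t g x - S0 t g x)) \<longlongrightarrow> 0) (at_right 0))
       \<and> (\<forall>g. tensor_H012 \<omega>1 \<omega>2 g \<longrightarrow>
            (\<exists>C>0. \<forall>T\<ge>0. \<forall>eps\<in>{0<..1}.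
               (SUP t\<in>{0..T}. l2norm (\<omega>1 \<times> \<omega>2) (\<lambda>x. S eps t g x - S0 t g x)) \<le> C * T * eps))"
proof -
  interpret anisotropic_operator \<omega>1 \<omega>2 A lam
    by (rule anisotropic_operator.intro)
       (fact | use lin Linf_coeff A22_X2 W1inf in blast)+
  have SE: "C0_contraction_semigroup (\<omega>1 \<times> \<omega>2) (S \<epsilon>) (gen_div (\<omega>1 \<times> \<omega>2) (Aeps A \<epsilon>))" if "0 < \<epsilon>" "\<epsilon> \<le> 1" for \<epsilon>
    using S_eps that by simp
  show ?thesis
  proof (intro conjI allI impI)
    fix g T assume "L2 (\<omega>1 \<times> \<omega>2) g \<and> T \<ge> (0::real)"
    then show "((\<lambda>eps. SUP t\<in>{0..T}. l2norm (\<omega>1 \<times> \<omega>2) (\<lambda>x. S eps t g x - S0 t g x)) \<longlongrightarrow> 0) (at_right 0)"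
      by (intro semigroup_convergence SE S_0) auto
  next
    fix g assume g: "tensor_H012 \<omega>1 \<omega>2 g"
    obtain C where C: "C > 0" "\<And>\<epsilon> t. 0 < \<epsilon> \<Longrightarrow> \<epsilon> \<le> 1 \<Longrightarrow> t \<ge> 0 \<Longrightarrow> l2dist (\<omega>1 \<times> \<omega>2) (S \<epsilon> t g) (S0 t g) \<le> C * t * \<epsilon>"
      using tensor_sum_estimate[OF g SE S_0] by blast
    show "\<exists>C>0. \<forall>T\<ge>0. \<forall>eps\<in>{0<..1}.
        (SUP t\<in>{0..T}. l2norm (\<omega>1 \<times> \<omega>2) (\<lambda>x. S eps t g x - S0 t g x)) \<le> C * T * eps"
    proof (intro exI[of _ C] conjI allI impI ballI)
      fix T eps :: real assume T: "T \<ge> 0" and eps: "eps \<in> {0<..1}"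
      show "(SUP t\<in>{0..T}. l2norm (\<omega>1 \<times> \<omega>2) (\<lambda>x. S eps t g x - S0 t g x)) \<le> C * T * eps"
      proof (rule cSUP_least)
        fix t assume t: "t \<in> {0..T}"
        have "l2dist (\<omega>1 \<times> \<omega>2) (S eps t g) (S0 t g) \<le> C * t * eps" using C(2) eps t by simp
        also have "\<dots> \<le> C * T * eps" using C(1) eps t by (intro mult_right_mono mult_left_mono) auto
        finally show "l2norm (\<omega>1 \<times> \<omega>2) (\<lambda>x. S eps t g x - S0 t g x) \<le> C * T * eps" .
      qed (use T in simp)
    qed (rule C(1))
  qed
qed

end
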